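(* There is a polynomial-time algorithm with oracle access to a decision oracle for LCE with the following property. Let $F,G\in\mathbb{F}_q^{k\times n}$ be generator matrices of two $k$-dimensional linear codes of length $n$ over $\mathbb{F}_q$ such that there exist a matrix $S_0\in\mathrm{GL}_k(\mathbb{F}_q)$, a permutation matrix $P_0\in\{0,1\}^{n\times n}$ and an $n\times n$ diagonal matrix $D_0$ over $\mathbb{F}_q$ with all diagonal entries nonzero such that $S_0GP_0D_0=F$. Given $F$ and $G$, the algorithm computes a matrix $S\in\mathrm{GL}_k(\mathbb{F}_q)$, a permutation matrix $P\in\{0,1\}^{n\times n}$ and an $n\times n$ diagonal matrix $D$ with all diagonal entries nonzero such that $F=SGPD$.
   Context: $\mathbb{F}_q$ is the finite field with $q$ elements. A generator matrix of a $k$-dimensional linear code $\mathcal{C}\subseteq\mathbb{F}_q^n$ is a matrix in $\mathbb{F}_q^{k\times n}$ whose rows span $\mathcal{C}$. LCE (Linear Code Equivalence, decision problem): given two linear codes of the same length $N$ and dimension $K$ over $\mathbb{F}_q$ by generator matrices $G_1,G_2$, decide whether there are $S\in\mathrm{GL}_K(\mathbb{F}_q)$, an $N\times N$ permutation matrix $P$ and an $N\times N$ diagonal matrix $D$ with nonzero diagonal entries such that $G_2=SG_1PD$. Polynomial time means polynomial in the size of the input, each oracle call counting as one step. *)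

theory Defs
  imports
    "Jordan_Normal_Form.Matrix"
    "HOL-Computational_Algebra.Polynomial"
    "HOL-Library.Log_Nat"
begin

section \<open>Finite fields\<close>

text \<open>
  The ring Z_p[x]/(h) for the monic polynomial h = x^m + f_(m-1) x^(m-1) + ... + f_0, where
  f = [f_0, ..., f_(m-1)]. A residue class is represented by the coefficient list (constant term
  first) of its representative of degree less than m with coefficients in {0, ..., p-1}.
  Every finite field is isomorphic to some \<open>GF p f\<close> with p prime and h irreducible modulo p,
  and these are exactly the cases in which \<open>field (GF p f)\<close> holds. All elements have the common
  type \<^typ>\<open>nat list\<close>, so that a single program can be quantified before the field.
  Since h is monic, \<^const>\<open>pseudo_mod\<close> is the ordinary remainder over the integers.
\<close>

type_synonym elem = "nat list"

definition int_poly :: "nat list \<Rightarrow> int poly" where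
  "int_poly a = Poly (map int a)"

definition gf_modulus :: "nat list \<Rightarrow> int poly" where
  "gf_modulus f = monom 1 (length f) + int_poly f"

definition GF :: "nat \<Rightarrow> nat list \<Rightarrow> elem ring" where
  "GF p f = \<lparr>
     carrier = {a. length a = length f \<and> (\<forall>c\<in>set a. c < p)},
     mult = (\<lambda>a b. map (\<lambda>i. nat (coeff (pseudo_mod (int_poly a * int_poly b) (gf_modulus f)) i mod int p))
                       [0..<length f]),
     one = map (\<lambda>i. if i = 0 then 1 else 0) [0..<length f],
     zero = replicate (length f) 0,
     add = (\<lambda>a b. map (\<lambda>i. (a ! i + b ! i) mod p) [0..<length f])\<rparr>"


section \<open>Matrices over a ring record\<close>

text \<open>
  The library types \<^typ>\<open>'a vec\<close> and \<^typ>\<open>'a mat\<close> are used as containers; the products of the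
  library need a type class and are therefore restated for a ring record.
\<close>

definition vecs :: "('a, 'b) ring_scheme \<Rightarrow> nat \<Rightarrow> 'a vec set" where
  "vecs R n = {v \<in> carrier_vec n. \<forall>i<n. v $ i \<in> carrier R}"

definition mats :: "('a, 'b) ring_scheme \<Rightarrow> nat \<Rightarrow> nat \<Rightarrow> 'a mat set" where
  "mats R k n = {A \<in> carrier_mat k n. \<forall>i<k. \<forall>j<n. A $$ (i, j) \<in> carrier R}"

definition mat_prod :: "('a, 'b) ring_scheme \<Rightarrow> 'a mat \<Rightarrow> 'a mat \<Rightarrow> 'a mat" where
  "mat_prod R A B = mat (dim_row A) (dim_col B)
     (\<lambda>(i, j). \<Oplus>\<^bsub>R\<^esub>l\<in>{..<dim_col A}. A $$ (i, l) \<otimes>\<^bsub>R\<^esub> B $$ (l, j))"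

definition mat_one :: "('a, 'b) ring_scheme \<Rightarrow> nat \<Rightarrow> 'a mat" where
  "mat_one R n = mat n n (\<lambda>(i, j). if i = j then \<one>\<^bsub>R\<^esub> else \<zero>\<^bsub>R\<^esub>)"

definition vec_mat_prod :: "('a, 'b) ring_scheme \<Rightarrow> 'a vec \<Rightarrow> 'a mat \<Rightarrow> 'a vec" where
  "vec_mat_prod R x A = vec (dim_col A)
     (\<lambda>j. \<Oplus>\<^bsub>R\<^esub>i\<in>{..<dim_row A}. x $ i \<otimes>\<^bsub>R\<^esub> A $$ (i, j))"

definition vec_zero :: "('a, 'b) ring_scheme \<Rightarrow> nat \<Rightarrow> 'a vec" where
  "vec_zero R n = vec n (\<lambda>_. \<zero>\<^bsub>R\<^esub>)"

definition vec_add :: "('a, 'b) ring_scheme \<Rightarrow> 'a vec \<Rightarrow> 'a vec \<Rightarrow> 'a vec" where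
  "vec_add R v w = vec (dim_vec v) (\<lambda>i. v $ i \<oplus>\<^bsub>R\<^esub> w $ i)"

definition vec_scale :: "('a, 'b) ring_scheme \<Rightarrow> 'a \<Rightarrow> 'a vec \<Rightarrow> 'a vec" where
  "vec_scale R c v = vec (dim_vec v) (\<lambda>i. c \<otimes>\<^bsub>R\<^esub> v $ i)"

definition GL :: "('a, 'b) ring_scheme \<Rightarrow> nat \<Rightarrow> 'a mat set" where
  "GL R k = {S \<in> mats R k k. \<exists>T\<in>mats R k k. mat_prod R S T = mat_one R k \<and> mat_prod R T S = mat_one R k}"

definition perm_mats :: "('a, 'b) ring_scheme \<Rightarrow> nat \<Rightarrow> 'a mat set" where
  "perm_mats R n = {P \<in> mats R n n.
     (\<forall>i<n. \<forall>j<n. P $$ (i, j) \<in> {\<zero>\<^bsub>R\<^esub>, \<one>\<^bsub>R\<^esub>}) \<and>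
     (\<forall>i<n. \<exists>!j. j < n \<and> P $$ (i, j) = \<one>\<^bsub>R\<^esub>) \<and>
     (\<forall>j<n. \<exists>!i. i < n \<and> P $$ (i, j) = \<one>\<^bsub>R\<^esub>)}"

definition nz_diag_mats :: "('a, 'b) ring_scheme \<Rightarrow> nat \<Rightarrow> 'a mat set" where
  "nz_diag_mats R n = {D \<in> mats R n n.
     (\<forall>i<n. \<forall>j<n. i \<noteq> j \<longrightarrow> D $$ (i, j) = \<zero>\<^bsub>R\<^esub>) \<and>
     (\<forall>i<n. D $$ (i, i) \<noteq> \<zero>\<^bsub>R\<^esub>)}"


section \<open>Linear codes and linear code equivalence\<close>

definition row_span :: "('a, 'b) ring_scheme \<Rightarrow> 'a mat \<Rightarrow> 'a vec set" where
  "row_span R A = (\<lambda>x. vec_mat_prod R x A) ` vecs R (dim_row A)"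

definition independent_rows :: "('a, 'b) ring_scheme \<Rightarrow> 'a mat \<Rightarrow> bool" where
  "independent_rows R A \<longleftrightarrow>
     (\<forall>x\<in>vecs R (dim_row A). vec_mat_prod R x A = vec_zero R (dim_col A) \<longrightarrow> x = vec_zero R (dim_row A))"

definition linear_code :: "('a, 'b) ring_scheme \<Rightarrow> nat \<Rightarrow> nat \<Rightarrow> 'a vec set \<Rightarrow> bool" where
  "linear_code R k n C \<longleftrightarrow>
     C \<subseteq> vecs R n \<and> vec_zero R n \<in> C \<and>
     (\<forall>v\<in>C. \<forall>w\<in>C. vec_add R v w \<in> C) \<and>
     (\<forall>c\<in>carrier R. \<forall>v\<in>C. vec_scale R c v \<in> C) \<and>
     (\<exists>B\<in>mats R k n. independent_rows R B \<and> row_span R B = C)"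

definition generator_matrix :: "('a, 'b) ring_scheme \<Rightarrow> nat \<Rightarrow> nat \<Rightarrow> 'a mat \<Rightarrow> bool" where
  "generator_matrix R k n A \<longleftrightarrow>
     A \<in> mats R k n \<and> (\<exists>C. linear_code R k n C \<and> row_span R A = C)"

definition code_equivalence ::
    "('a, 'b) ring_scheme \<Rightarrow> nat \<Rightarrow> nat \<Rightarrow> 'a mat \<Rightarrow> 'a mat \<Rightarrow> 'a mat \<Rightarrow> 'a mat \<Rightarrow> 'a mat \<Rightarrow> bool" where
  "code_equivalence R k n G1 G2 S P D \<longleftrightarrow>
     S \<in> GL R k \<and> P \<in> perm_mats R n \<and> D \<in> nz_diag_mats R n \<and>
     G2 = mat_prod R (mat_prod R (mat_prod R S G1) P) D"

definition LCE :: "('a, 'b) ring_scheme \<Rightarrow> nat \<Rightarrow> nat \<Rightarrow> 'a mat \<Rightarrow> 'a mat \<Rightarrow> bool" where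
  "LCE R k n G1 G2 \<longleftrightarrow> (\<exists>S P D. code_equivalence R k n G1 G2 S P D)"


section \<open>Oracle programs and their running time\<close>

text \<open>
  First-order recursive programs, evaluated by value, over binary trees with natural numbers at
  the leaves. Arithmetic on numbers is charged by bit length (logarithmic cost) and every other
  evaluation step costs one unit, so that, up to polynomial factors, running time is Turing
  machine time. Trees are handled by reference and may share subtrees; an oracle call
  therefore costs, besides the one step, the size of the query written out, as it would on an
  oracle Turing machine. This only strengthens a time bound in which a call counts as one step.
\<close>

datatype val = Num nat | Pair val val

primrec vsize :: "val \<Rightarrow> nat" where
  "vsize (Num a) = 1 + floorlog 2 a"
| "vsize (Pair u v) = 1 + vsize u + vsize v"

datatype arith_op = Add | Sub | Mul | Div | Mod | Less

fun arith :: "arith_op \<Rightarrow> nat \<Rightarrow> nat \<Rightarrow> nat" where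
  "arith Add a b = a + b"
| "arith Sub a b = a - b"
| "arith Mul a b = a * b"
| "arith Div a b = a div b"
| "arith Mod a b = a mod b"
| "arith Less a b = (if a < b then 1 else 0)"

text \<open>
  Variables are de Bruijn indices into the environment. \<open>ECall i es\<close> calls the i-th function of
  the program, whose body sees exactly the arguments.
\<close>

datatype expr =
    EVar nat
  | ENum nat
  | EPair expr expr
  | EFst expr
  | ESnd expr
  | EIsPair expr
  | EArith arith_op expr expr
  | EIf expr expr expr
  | ELet expr expr
  | ECall nat "expr list"
  | EOracle expr

inductive
  eval :: "(val \<Rightarrow> bool) \<Rightarrow> expr list \<Rightarrow> val list \<Rightarrow> expr \<Rightarrow> val \<Rightarrow> nat \<Rightarrow> bool" and
  evals :: "(val \<Rightarrow> bool) \<Rightarrow> expr list \<Rightarrow> val list \<Rightarrow> expr list \<Rightarrow> val list \<Rightarrow> nat \<Rightarrow> bool"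
  for Orc :: "val \<Rightarrow> bool" and funs :: "expr list"
where
  eval_Var: "i < length env \<Longrightarrow> eval Orc funs env (EVar i) (env ! i) 1"
| eval_Num: "eval Orc funs env (ENum a) (Num a) 1"
| eval_Pair: "eval Orc funs env e1 v1 t1 \<Longrightarrow> eval Orc funs env e2 v2 t2 \<Longrightarrow>
    eval Orc funs env (EPair e1 e2) (Pair v1 v2) (1 + t1 + t2)"
| eval_Fst: "eval Orc funs env e (Pair u v) t \<Longrightarrow> eval Orc funs env (EFst e) u (1 + t)"
| eval_Snd: "eval Orc funs env e (Pair u v) t \<Longrightarrow> eval Orc funs env (ESnd e) v (1 + t)"
| eval_IsPair_Pair: "eval Orc funs env e (Pair u v) t \<Longrightarrow> eval Orc funs env (EIsPair e) (Num 1) (1 + t)"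
| eval_IsPair_Num: "eval Orc funs env e (Num a) t \<Longrightarrow> eval Orc funs env (EIsPair e) (Num 0) (1 + t)"
| eval_Arith: "eval Orc funs env e1 (Num a) t1 \<Longrightarrow> eval Orc funs env e2 (Num b) t2 \<Longrightarrow>
    eval Orc funs env (EArith f e1 e2) (Num (arith f a b))
      (1 + floorlog 2 a + floorlog 2 b + t1 + t2)"
| eval_If_True: "eval Orc funs env c (Num a) t1 \<Longrightarrow> a \<noteq> 0 \<Longrightarrow> eval Orc funs env e1 v t2 \<Longrightarrow>
    eval Orc funs env (EIf c e1 e2) v (1 + t1 + t2)"
| eval_If_False: "eval Orc funs env c (Num 0) t1 \<Longrightarrow> eval Orc funs env e2 v t2 \<Longrightarrow>
    eval Orc funs env (EIf c e1 e2) v (1 + t1 + t2)"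
| eval_Let: "eval Orc funs env e1 u t1 \<Longrightarrow> eval Orc funs (u # env) e2 v t2 \<Longrightarrow>
    eval Orc funs env (ELet e1 e2) v (1 + t1 + t2)"
| eval_Call: "evals Orc funs env es us t1 \<Longrightarrow> i < length funs \<Longrightarrow> eval Orc funs us (funs ! i) v t2 \<Longrightarrow>
    eval Orc funs env (ECall i es) v (1 + t1 + t2)"
| eval_Oracle: "eval Orc funs env e u t \<Longrightarrow>
    eval Orc funs env (EOracle e) (Num (if Orc u then 1 else 0)) (1 + vsize u + t)"
| evals_Nil: "evals Orc funs env [] [] 0"
| evals_Cons: "eval Orc funs env e v t1 \<Longrightarrow> evals Orc funs env es vs t2 \<Longrightarrow>
    evals Orc funs env (e # es) (v # vs) (t1 + t2)"

inductive_cases eval_VarE: "eval Orc funs env (EVar i) v t"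
inductive_cases eval_NumE: "eval Orc funs env (ENum a) v t"
inductive_cases eval_PairE: "eval Orc funs env (EPair e1 e2) v t"
inductive_cases eval_FstE: "eval Orc funs env (EFst e) v t"
inductive_cases eval_SndE: "eval Orc funs env (ESnd e) v t"
inductive_cases eval_IsPairE: "eval Orc funs env (EIsPair e) v t"
inductive_cases eval_ArithE: "eval Orc funs env (EArith f e1 e2) v t"
inductive_cases eval_IfE: "eval Orc funs env (EIf c e1 e2) v t"
inductive_cases eval_LetE: "eval Orc funs env (ELet e1 e2) v t"
inductive_cases eval_CallE: "eval Orc funs env (ECall i es) v t"
inductive_cases eval_OracleE: "eval Orc funs env (EOracle e) v t"
inductive_cases evals_NilE: "evals Orc funs env [] vs t"
inductive_cases evals_ConsE: "evals Orc funs env (e # es) vs t"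

lemma eval_deterministic:
  "eval Orc funs env e v t \<Longrightarrow> (\<And>v' t'. eval Orc funs env e v' t' \<Longrightarrow> v' = v \<and> t' = t)"
  "evals Orc funs env es vs t \<Longrightarrow> (\<And>vs' t'. evals Orc funs env es vs' t' \<Longrightarrow> vs' = vs \<and> t' = t)"
proof (induction rule: eval_evals.inducts)
  case eval_Var
  from eval_Var.prems show ?case
    by (rule eval_VarE) auto
next
  case eval_Num
  from eval_Num.prems show ?case
    by (rule eval_NumE) auto
next
  case eval_Pair
  from eval_Pair.prems show ?case
    by (rule eval_PairE) (auto dest!: eval_Pair.IH(2) eval_Pair.IH(4))
next
  case eval_Fst
  from eval_Fst.prems show ?case
    by (rule eval_FstE) (auto dest!: eval_Fst.IH(2))
next
  case eval_Snd
  from eval_Snd.prems show ?case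
    by (rule eval_SndE) (auto dest!: eval_Snd.IH(2))
next
  case eval_IsPair_Pair
  from eval_IsPair_Pair.prems show ?case
    by (rule eval_IsPairE) (auto dest!: eval_IsPair_Pair.IH(2))
next
  case eval_IsPair_Num
  from eval_IsPair_Num.prems show ?case
    by (rule eval_IsPairE) (auto dest!: eval_IsPair_Num.IH(2))
next
  case eval_Arith
  from eval_Arith.prems show ?case
    by (rule eval_ArithE) (auto dest!: eval_Arith.IH(2) eval_Arith.IH(4))
next
  case eval_If_True
  from eval_If_True.prems show ?case
    by (rule eval_IfE) (use eval_If_True.hyps in \<open>auto dest!: eval_If_True.IH(2) eval_If_True.IH(4)\<close>)
next
  case eval_If_False
  from eval_If_False.prems show ?case
    by (rule eval_IfE) (auto dest!: eval_If_False.IH(2) eval_If_False.IH(4))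
next
  case eval_Let
  from eval_Let.prems show ?case
    by (rule eval_LetE) (auto dest!: eval_Let.IH(2) eval_Let.IH(4))
next
  case eval_Call
  from eval_Call.prems show ?case
    by (rule eval_CallE) (auto dest!: eval_Call.IH(2) eval_Call.IH(5))
next
  case eval_Oracle
  from eval_Oracle.prems show ?case
    by (rule eval_OracleE) (auto dest!: eval_Oracle.IH(2))
next
  case evals_Nil
  from evals_Nil.prems show ?case
    by (rule evals_NilE) auto
next
  case evals_Cons
  from evals_Cons.prems show ?case
    by (rule evals_ConsE) (auto dest!: evals_Cons.IH(2) evals_Cons.IH(4))
qed

text \<open>A program consists of its function bodies and a main expression whose variable 0 is the input.\<close>

type_synonym oracle_program = "expr list \<times> expr"

definition computes :: "oracle_program \<Rightarrow> (val \<Rightarrow> bool) \<Rightarrow> val \<Rightarrow> val \<Rightarrow> nat \<Rightarrow> bool" where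
  "computes prog Orc x y t \<longleftrightarrow> eval Orc (fst prog) [x] (snd prog) y t"


section \<open>Encodings\<close>

text \<open>
  A matrix is encoded as the list of its columns. For a generator matrix of a k-dimensional code
  of length n (so k is at most n) this determines k and n even if k = 0, and the encoding
  has size at least n.
\<close>

primrec enc_list :: "('a \<Rightarrow> val) \<Rightarrow> 'a list \<Rightarrow> val" where
  "enc_list e [] = Num 0"
| "enc_list e (x # xs) = Pair (e x) (enc_list e xs)"

definition enc_nats :: "nat list \<Rightarrow> val" where
  "enc_nats = enc_list Num"

definition enc_mat :: "elem mat \<Rightarrow> val" where
  "enc_mat A = enc_list (enc_list enc_nats) (map list_of_vec (cols A))"

definition enc_instance :: "nat \<Rightarrow> nat list \<Rightarrow> elem mat \<Rightarrow> elem mat \<Rightarrow> val" where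
  "enc_instance p f A B = Pair (Pair (Num p) (enc_nats f)) (Pair (enc_mat A) (enc_mat B))"

definition enc_solution :: "elem mat \<Rightarrow> elem mat \<Rightarrow> elem mat \<Rightarrow> val" where
  "enc_solution S P D = Pair (enc_mat S) (Pair (enc_mat P) (enc_mat D))"

text \<open>The answers of an LCE oracle to queries that do not encode an instance are arbitrary.\<close>

definition LCE_oracle :: "(val \<Rightarrow> bool) \<Rightarrow> bool" where
  "LCE_oracle Orc \<longleftrightarrow>
     (\<forall>p f K N G1 G2.
        field (GF p f) \<longrightarrow>
        generator_matrix (GF p f) K N G1 \<longrightarrow>
        generator_matrix (GF p f) K N G2 \<longrightarrow>
        (Orc (enc_instance p f G1 G2) \<longleftrightarrow> LCE (GF p f) K N G1 G2))"

end

theory Submission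
  imports Defs
begin

text \<open>
  The algorithm first recovers the permutation. It extends a partial matching of columns one column
  at a time and asks the oracle whether a candidate is compatible with some equivalence; the columns
  matched so far are marked by repeating them. Repetition only marks classes of parallel columns, so
  just one column of each class is repeated, and the program itself tests parallelism.

  Once the permutation is known, S and D are found by linear algebra. The pairs (S, d) with
  S G = F diag(d) form a vector space whose d-parts, divided by those of an invertible solution, are
  closed under the componentwise product. A reduced basis of such a space consists of vectors with
  disjoint supports, so the sum of the basis has no zero entry and gives D; its S-part is then invertible.

  Polynomial running time is established by a class of computable functions closed under
  composition, iteration over lists and polynomially bounded loops, in which the whole algorithm is written.
\<close>


section \<open>Polynomial bounds\<close>

text \<open>The oracle only says yes or no, so a partial matching must be written into the queried
  codes. An equivalence of extended codes may exchange parallel columns, original or appended; all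
  that survives is how often each class of parallel columns occurs. The weights make this number
  reveal two things: modulo n + 1 it is the size of the class, and the quotient names the repeated
  column. That column is the last of its class, and the matching grows from the last column
  downwards, so a class that meets the matched range has its repeated column in it. The equivalence
  may change at every step: the invariant is only that some equivalence agrees with the matching
  found so far. With the permutation known, F = S G P D is still bilinear in S and D. Moving the
  diagonal matrix to the side of F makes the system linear, but a solution may have zeros in d, and
  over a small field no generic choice of a combination avoids them. Hence the detour through
  products of solutions.\<close>

definition pb :: "(nat \<Rightarrow> nat) \<Rightarrow> bool" where
  "pb g \<longleftrightarrow> mono g \<and> (\<exists>d. \<forall>s. g s \<le> (s + 2) ^ d)"

lemma pb_mono: "pb g \<Longrightarrow> a \<le> b \<Longrightarrow> g a \<le> g b"
  by (auto simp: pb_def mono_def)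

text \<open>The base \<open>s + 2\<close> in \<open>pb\<close> is always at least 2, so the exponent
  absorbs constants and no coefficients have to be carried along.\<close>

lemma pb_const: "pb (\<lambda>_. a)"
proof -
  have "a \<le> (s + 2) ^ a" for s :: nat
    using less_exp[of a] power_mono[of 2 "s + 2" a] by linarith
  then show ?thesis unfolding pb_def mono_def by blast
qed

lemma pb_id: "pb (\<lambda>s. s)"
  unfolding pb_def by (auto simp: mono_def intro!: exI[of _ 1])

lemma pb_mult:
  assumes "pb g" "pb h" shows "pb (\<lambda>s. g s * h s)"
proof -
  obtain a b where ab: "\<And>s. g s \<le> (s + 2) ^ a" "\<And>s. h s \<le> (s + 2) ^ b"
    using assms by (auto simp: pb_def)
  have "g s * h s \<le> (s + 2) ^ (a + b)" for s
    using mult_mono[OF ab] by (simp add: power_add)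
  moreover have "mono (\<lambda>s. g s * h s)"
    using assms by (auto simp: pb_def mono_def intro!: mult_mono)
  ultimately show ?thesis unfolding pb_def by blast
qed

lemma pb_add:
  assumes "pb g" "pb h" shows "pb (\<lambda>s. g s + h s)"
proof -
  obtain a b where ab: "\<And>s. g s \<le> (s + 2) ^ a" "\<And>s. h s \<le> (s + 2) ^ b"
    using assms by (auto simp: pb_def)
  have "g s + h s \<le> (s + 2) ^ (a + b + 1)" for s
  proof -
    have "g s + h s \<le> (s + 2) ^ (a + b) + (s + 2) ^ (a + b)"
      using ab[of s] power_increasing[of a "a + b" "s + 2"] power_increasing[of b "a + b" "s + 2"] by linarith
    also have "\<dots> \<le> (s + 2) ^ (a + b + 1)" by simp
    finally show ?thesis .
  qed
  moreover have "mono (\<lambda>s. g s + h s)"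
    using assms by (auto simp: pb_def mono_def intro!: add_mono)
  ultimately show ?thesis unfolding pb_def by blast
qed

lemma pb_Suc: "pb g \<Longrightarrow> pb (\<lambda>s. Suc (g s))"
  using pb_add[of g "\<lambda>_. 1"] pb_const by simp

lemma pb_comp:
  assumes "pb g" "pb h" shows "pb (\<lambda>s. g (h s))"
proof -
  obtain a b where ab: "\<And>s. g s \<le> (s + 2) ^ a" "\<And>s. h s \<le> (s + 2) ^ b"
    using assms by (auto simp: pb_def)
  have "g (h s) \<le> (s + 2) ^ ((b + 2) * a)" for s
  proof -
    \<comment> \<open>The outer bound is a power of \<open>h s + 2\<close>, which must come below a
      power of \<open>s + 2\<close>. The factor 4 is at most (s + 2)^2; hence the exponent b +
      2.\<close>
    have "h s + 2 \<le> 4 * (s + 2) ^ b"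
      using ab(2)[of s] one_le_power[of "s + 2" b] by linarith
    also have "\<dots> \<le> (s + 2) ^ 2 * (s + 2) ^ b"
      by (rule mult_le_mono1) (simp add: power2_eq_square)
    finally have "h s + 2 \<le> (s + 2) ^ (b + 2)" by (simp only: power_add mult.commute)
    then have "(h s + 2) ^ a \<le> ((s + 2) ^ (b + 2)) ^ a" by (rule power_mono) simp
    then show ?thesis using ab(1)[of "h s"] order_trans unfolding power_mult by blast
  qed
  moreover have "mono (\<lambda>s. g (h s))"
    using assms by (auto simp: pb_def mono_def)
  ultimately show ?thesis unfolding pb_def by blast
qed


lemmas pb_intros = pb_const pb_id pb_add pb_mult pb_Suc

section \<open>Evaluation in bounded time\<close>

text \<open>An upper bound in place of the exact cost: the rules below end in an inequality that
  leaves room for slack, so costs never have to be computed exactly.\<close>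

definition ev :: "(val \<Rightarrow> bool) \<Rightarrow> expr list \<Rightarrow> val list \<Rightarrow> expr \<Rightarrow> val \<Rightarrow> nat \<Rightarrow> bool" where
  "ev Orc funs env e v T \<longleftrightarrow> (\<exists>t\<le>T. eval Orc funs env e v t)"

lemma ev_mono: "ev Orc funs env e v T \<Longrightarrow> T \<le> T' \<Longrightarrow> ev Orc funs env e v T'"
  unfolding ev_def by (meson order_trans)

lemma ev_Var: "i < length env \<Longrightarrow> env ! i = v \<Longrightarrow> 1 \<le> T \<Longrightarrow> ev Orc funs env (EVar i) v T"
  unfolding ev_def using eval_Var by blast

lemma ev_Num: "1 \<le> T \<Longrightarrow> ev Orc funs env (ENum a) (Num a) T"
  unfolding ev_def using eval_Num by blast

lemma ev_Pair:
  assumes "ev Orc funs env e1 v1 t1" "ev Orc funs env e2 v2 t2" "1 + t1 + t2 \<le> T"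
  shows "ev Orc funs env (EPair e1 e2) (Pair v1 v2) T"
proof -
  obtain s1 s2 where "s1 \<le> t1" "s2 \<le> t2" "eval Orc funs env e1 v1 s1" "eval Orc funs env e2 v2 s2"
    using assms unfolding ev_def by blast
  then show ?thesis
    unfolding ev_def using assms(3) by (intro exI[of _ "1 + s1 + s2"]) (auto intro: eval_Pair[simplified])
qed

lemma ev_Fst: "ev Orc funs env e (Pair u v) t \<Longrightarrow> 1 + t \<le> T \<Longrightarrow> ev Orc funs env (EFst e) u T"
  unfolding ev_def by (meson eval_Fst add_left_mono order_trans)

lemma ev_Snd: "ev Orc funs env e (Pair u v) t \<Longrightarrow> 1 + t \<le> T \<Longrightarrow> ev Orc funs env (ESnd e) v T"
  unfolding ev_def by (meson eval_Snd add_left_mono order_trans)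

lemma ev_IsPair_Pair: "ev Orc funs env e (Pair u v) t \<Longrightarrow> 1 + t \<le> T \<Longrightarrow> ev Orc funs env (EIsPair e) (Num 1) T"
  unfolding ev_def by (meson eval_IsPair_Pair add_left_mono order_trans)

lemma ev_IsPair_Num: "ev Orc funs env e (Num a) t \<Longrightarrow> 1 + t \<le> T \<Longrightarrow> ev Orc funs env (EIsPair e) (Num 0) T"
  unfolding ev_def by (meson eval_IsPair_Num add_left_mono order_trans)

lemma ev_Arith:
  assumes "ev Orc funs env e1 (Num a) t1" "ev Orc funs env e2 (Num b) t2"
    "arith f a b = r" "1 + floorlog 2 a + floorlog 2 b + t1 + t2 \<le> T"
  shows "ev Orc funs env (EArith f e1 e2) (Num r) T"
proof -
  obtain s1 s2 where "s1 \<le> t1" "s2 \<le> t2" "eval Orc funs env e1 (Num a) s1" "eval Orc funs env e2 (Num b) s2"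
    using assms unfolding ev_def by blast
  then show ?thesis
    unfolding ev_def using assms(3,4)
    by (intro exI[of _ "1 + floorlog 2 a + floorlog 2 b + s1 + s2"]) (auto intro: eval_Arith[simplified])
qed

lemma ev_If:
  assumes "ev Orc funs env c (Num a) t1" "a \<noteq> 0 \<Longrightarrow> ev Orc funs env e1 v t2" "a = 0 \<Longrightarrow> ev Orc funs env e2 v t2"
    "1 + t1 + t2 \<le> T"
  shows "ev Orc funs env (EIf c e1 e2) v T"
proof -
  obtain s1 where s1: "s1 \<le> t1" "eval Orc funs env c (Num a) s1"
    using assms unfolding ev_def by blast
  obtain s2 where s2: "s2 \<le> t2" "a \<noteq> 0 \<longrightarrow> eval Orc funs env e1 v s2" "a = 0 \<longrightarrow> eval Orc funs env e2 v s2"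
    using assms(2,3) unfolding ev_def by (cases "a = 0") auto
  have "eval Orc funs env (EIf c e1 e2) v (1 + s1 + s2)"
    using s1 s2 by (cases "a = 0") (auto intro: eval_If_True[simplified] eval_If_False[simplified])
  then show ?thesis
    unfolding ev_def using assms(4) s1(1) s2(1) by (intro exI[of _ "1 + s1 + s2"]) auto
qed

lemma ev_Let:
  assumes "ev Orc funs env e1 u t1" "ev Orc funs (u # env) e2 v t2" "1 + t1 + t2 \<le> T"
  shows "ev Orc funs env (ELet e1 e2) v T"
proof -
  obtain s1 s2 where "s1 \<le> t1" "s2 \<le> t2" "eval Orc funs env e1 u s1" "eval Orc funs (u # env) e2 v s2"
    using assms unfolding ev_def by blast
  then show ?thesis
    unfolding ev_def using assms(3) by (intro exI[of _ "1 + s1 + s2"]) (auto intro: eval_Let[simplified])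
qed

definition evs :: "(val \<Rightarrow> bool) \<Rightarrow> expr list \<Rightarrow> val list \<Rightarrow> expr list \<Rightarrow> val list \<Rightarrow> nat \<Rightarrow> bool" where
  "evs Orc funs env es vs T \<longleftrightarrow> (\<exists>t\<le>T. evals Orc funs env es vs t)"

lemma evs_Nil: "evs Orc funs env [] [] T"
  unfolding evs_def using evals_Nil by blast

lemma evs_Cons:
  assumes "ev Orc funs env e v t1" "evs Orc funs env es vs t2" "t1 + t2 \<le> T"
  shows "evs Orc funs env (e # es) (v # vs) T"
proof -
  obtain s1 s2 where "s1 \<le> t1" "s2 \<le> t2" "eval Orc funs env e v s1" "evals Orc funs env es vs s2"
    using assms unfolding ev_def evs_def by blast
  then show ?thesis
    unfolding evs_def using assms(3) by (intro exI[of _ "s1 + s2"]) (auto intro: evals_Cons)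
qed

lemma ev_Call:
  assumes "evs Orc funs env es us t1" "i < length funs" "ev Orc funs us (funs ! i) v t2" "1 + t1 + t2 \<le> T"
  shows "ev Orc funs env (ECall i es) v T"
proof -
  obtain s1 s2 where "s1 \<le> t1" "s2 \<le> t2" "evals Orc funs env es us s1" "eval Orc funs us (funs ! i) v s2"
    using assms unfolding ev_def evs_def by blast
  then show ?thesis
    unfolding ev_def using assms(2,4) by (intro exI[of _ "1 + s1 + s2"]) (auto intro: eval_Call[simplified])
qed

lemma ev_Oracle:
  assumes "ev Orc funs env e u t" "1 + vsize u + t \<le> T"
  shows "ev Orc funs env (EOracle e) (Num (if Orc u then 1 else 0)) T"
proof -
  obtain s where "s \<le> t" "eval Orc funs env e u s"
    using assms unfolding ev_def by blast
  then show ?thesis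
    unfolding ev_def using assms(2) by (intro exI[of _ "1 + vsize u + s"]) (use eval_Oracle[of Orc funs env e u s] in auto)
qed


section \<open>Linking programs\<close>

lemma eval_append:
  "eval Orc funs env e v t \<Longrightarrow> eval Orc (funs @ funs') (env @ env') e v t"
  "evals Orc funs env es vs t \<Longrightarrow> evals Orc (funs @ funs') (env @ env') es vs t"
proof (induction arbitrary: env' and env' rule: eval_evals.inducts)
  case (eval_Var i env)
  then show ?case using eval_evals.eval_Var[of i "env @ env'" Orc "funs @ funs'"] by (simp add: nth_append)
next
  case (eval_Call env es us t1 i v t2)
  \<comment> \<open>A called body sees its arguments only, so the induction hypothesis is taken here
    with nothing appended to the environment.\<close>
  have "eval Orc (funs @ funs') us ((funs @ funs') ! i) v t2"
    using eval_Call(5)[of "[]"] eval_Call(3) by (simp add: nth_append)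
  with eval_Call(2)[of env'] eval_Call(3) show ?case by (intro eval_evals.eval_Call) simp_all
next
  case (eval_Oracle env e u t)
  show ?case by (rule eval_evals.eval_Oracle) (rule eval_Oracle)
qed (auto intro: eval_evals.intros[simplified])

fun shift_calls :: "nat \<Rightarrow> expr \<Rightarrow> expr" where
  "shift_calls n (EVar i) = EVar i"
| "shift_calls n (ENum a) = ENum a"
| "shift_calls n (EPair e1 e2) = EPair (shift_calls n e1) (shift_calls n e2)"
| "shift_calls n (EFst e) = EFst (shift_calls n e)"
| "shift_calls n (ESnd e) = ESnd (shift_calls n e)"
| "shift_calls n (EIsPair e) = EIsPair (shift_calls n e)"
| "shift_calls n (EArith f e1 e2) = EArith f (shift_calls n e1) (shift_calls n e2)"
| "shift_calls n (EIf c e1 e2) = EIf (shift_calls n c) (shift_calls n e1) (shift_calls n e2)"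
| "shift_calls n (ELet e1 e2) = ELet (shift_calls n e1) (shift_calls n e2)"
| "shift_calls n (ECall i es) = ECall (n + i) (map (shift_calls n) es)"
| "shift_calls n (EOracle e) = EOracle (shift_calls n e)"

text \<open>Two programs are merged by concatenating their function tables. The first keeps its call
  indices by \<open>eval_append\<close>; in the second every index moves up by the length of the
  first table.\<close>

lemma eval_shift:
  "eval Orc funs env e v t \<Longrightarrow>
     eval Orc (pre @ map (shift_calls (length pre)) funs) env (shift_calls (length pre) e) v t"
  "evals Orc funs env es vs t \<Longrightarrow>
     evals Orc (pre @ map (shift_calls (length pre)) funs) env (map (shift_calls (length pre)) es) vs t"
proof (induction rule: eval_evals.inducts)
  case (eval_Call env es us t1 i v t2)
  then show ?case
    using eval_evals.eval_Call[of Orc "pre @ map (shift_calls (length pre)) funs" env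
        "map (shift_calls (length pre)) es" us t1 "length pre + i" v t2]
    by (simp add: nth_append)
next
  case (eval_Oracle env e u t)
  then show ?case
    using eval_evals.eval_Oracle[of Orc "pre @ map (shift_calls (length pre)) funs" env "shift_calls (length pre) e" u t]
    by simp
qed (auto intro: eval_evals.intros[simplified])

lemma ev_append: "ev Orc funs env e v T \<Longrightarrow> ev Orc (funs @ funs') (env @ env') e v T"
  unfolding ev_def using eval_append(1) by blast

lemma ev_append_funs: "ev Orc funs env e v T \<Longrightarrow> ev Orc (funs @ funs') env e v T"
  using ev_append[of Orc funs env e v T funs' "[]"] by simp

text \<open>Code written for a single input can be run under \<open>ELet\<close>, which puts that
  input at variable 0; the older variables behind it are invisible to the code.\<close>

lemma ev_env_Cons: "ev Orc funs [x] e v T \<Longrightarrow> ev Orc funs (x # env) e v T"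
  using ev_append[of Orc funs "[x]" e v T "[]" env] by simp

lemma ev_shift:
  "ev Orc funs env e v T \<Longrightarrow>
     ev Orc (pre @ map (shift_calls (length pre)) funs) env (shift_calls (length pre) e) v T"
  unfolding ev_def using eval_shift(1) by blast


section \<open>Polynomial-time computable functions\<close>

text \<open>
  The size bound on the result is a separate requirement: values may share subtrees, so a program
  can build exponentially large values in linear time.
\<close>

definition PT :: "('c \<Rightarrow> val) \<Rightarrow> ('b \<Rightarrow> val) \<Rightarrow> ((val \<Rightarrow> bool) \<Rightarrow> 'c \<Rightarrow> 'b) \<Rightarrow> bool" where
  "PT E e f \<longleftrightarrow> (\<exists>funs b g. pb g \<and>
     (\<forall>Orc c. ev Orc funs [E c] b (e (f Orc c)) (g (vsize (E c))) \<and> vsize (e (f Orc c)) \<le> g (vsize (E c))))"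

lemma PTI:
  assumes "pb g" "\<And>Orc c. ev Orc funs [E c] b (e (f Orc c)) (g (vsize (E c)))"
    "\<And>Orc c. vsize (e (f Orc c)) \<le> g (vsize (E c))"
  shows "PT E e f"
  unfolding PT_def using assms by blast

lemma PTE:
  assumes "PT E e f"
  obtains funs b g where "pb g" "\<And>Orc c. ev Orc funs [E c] b (e (f Orc c)) (g (vsize (E c)))"
    "\<And>Orc c. vsize (e (f Orc c)) \<le> g (vsize (E c))"
  using assms unfolding PT_def by blast

lemma PT_link:
  assumes "PT E1 e1 f1" "pb g2" "\<And>Orc c. ev Orc funs2 [E2 c] b2 (e2 (f2 Orc c)) (g2 (vsize (E2 c)))"
    "\<And>Orc c. vsize (e2 (f2 Orc c)) \<le> g2 (vsize (E2 c))"
  obtains funs b1 b2 g where "pb g"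
    "\<And>Orc c. ev Orc funs [E1 c] b1 (e1 (f1 Orc c)) (g (vsize (E1 c)))"
    "\<And>Orc c. vsize (e1 (f1 Orc c)) \<le> g (vsize (E1 c))"
    "\<And>Orc c. ev Orc funs [E2 c] b2 (e2 (f2 Orc c)) (g (vsize (E2 c)))"
    "\<And>Orc c. vsize (e2 (f2 Orc c)) \<le> g (vsize (E2 c))"
proof -
  obtain funs1 b1 g1 where 1: "pb g1" "\<And>Orc c. ev Orc funs1 [E1 c] b1 (e1 (f1 Orc c)) (g1 (vsize (E1 c)))"
    "\<And>Orc c. vsize (e1 (f1 Orc c)) \<le> g1 (vsize (E1 c))"
    using assms(1) by (rule PTE) blast
  let ?funs = "funs1 @ map (shift_calls (length funs1)) funs2"
  show ?thesis
  proof (rule that[of "\<lambda>s. g1 s + g2 s" ?funs b1 "shift_calls (length funs1) b2"])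
    fix Orc c
    show "ev Orc ?funs [E1 c] b1 (e1 (f1 Orc c)) (g1 (vsize (E1 c)) + g2 (vsize (E1 c)))"
      by (rule ev_mono[OF ev_append_funs[OF 1(2)]]) simp
    show "vsize (e1 (f1 Orc c)) \<le> g1 (vsize (E1 c)) + g2 (vsize (E1 c))"
      using 1(3)[of Orc c] by simp
  next
    fix Orc c
    show "ev Orc ?funs [E2 c] (shift_calls (length funs1) b2) (e2 (f2 Orc c)) (g1 (vsize (E2 c)) + g2 (vsize (E2 c)))"
      by (rule ev_mono[OF ev_shift[OF assms(3)]]) simp
    show "vsize (e2 (f2 Orc c)) \<le> g1 (vsize (E2 c)) + g2 (vsize (E2 c))"
      using assms(4)[of Orc c] by simp
  qed (intro pb_intros 1(1) assms(2))
qed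

lemma PTE2:
  assumes "PT E1 e1 f1" "PT E2 e2 f2"
  obtains funs b1 b2 g where "pb g"
    "\<And>Orc c. ev Orc funs [E1 c] b1 (e1 (f1 Orc c)) (g (vsize (E1 c)))"
    "\<And>Orc c. vsize (e1 (f1 Orc c)) \<le> g (vsize (E1 c))"
    "\<And>Orc c. ev Orc funs [E2 c] b2 (e2 (f2 Orc c)) (g (vsize (E2 c)))"
    "\<And>Orc c. vsize (e2 (f2 Orc c)) \<le> g (vsize (E2 c))"
proof -
  obtain funs2 b2 g2 where 2: "pb g2" "\<And>Orc c. ev Orc funs2 [E2 c] b2 (e2 (f2 Orc c)) (g2 (vsize (E2 c)))"
    "\<And>Orc c. vsize (e2 (f2 Orc c)) \<le> g2 (vsize (E2 c))"
    using assms(2) by (rule PTE) blast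
  show ?thesis
    by (rule PT_link[where ?E2.0 = E2 and ?e2.0 = e2 and ?f2.0 = f2, OF assms(1) 2]) (rule that)
qed

section \<open>Closure under composition, pairing, arithmetic, branching and oracle calls\<close>

definition pair_enc :: "('a \<Rightarrow> val) \<Rightarrow> ('b \<Rightarrow> val) \<Rightarrow> 'a \<times> 'b \<Rightarrow> val" where
  "pair_enc e1 e2 x = Pair (e1 (fst x)) (e2 (snd x))"

definition bool_enc :: "bool \<Rightarrow> val" where
  "bool_enc b = Num (if b then 1 else 0)"

lemma PT_id: "PT E E (\<lambda>Orc c. c)"
  by (rule PTI[where funs = "[]" and b = "EVar 0" and g = "\<lambda>s. s + 1"]) (auto intro!: pb_intros ev_Var)

lemma PT_comp:
  assumes "PT E e f" "PT e e' h"
  shows "PT E e' (\<lambda>Orc c. h Orc (f Orc c))"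
proof -
  obtain funs b1 b2 g where *: "pb g"
    "\<And>Orc c. ev Orc funs [E c] b1 (e (f Orc c)) (g (vsize (E c)))"
    "\<And>Orc c. vsize (e (f Orc c)) \<le> g (vsize (E c))"
    "\<And>Orc c. ev Orc funs [e c] b2 (e' (h Orc c)) (g (vsize (e c)))"
    "\<And>Orc c. vsize (e' (h Orc c)) \<le> g (vsize (e c))"
    by (rule PTE2[OF assms]) blast
  show ?thesis
  proof (rule PTI[where funs = funs and b = "ELet b1 b2" and g = "\<lambda>s. 1 + g s + g (g s)"])
    fix Orc c
    \<comment> \<open>The second program runs on the intermediate value, so its time is controlled
      by the size bound in \<open>PT\<close> together with monotonicity of \<open>g\<close>.\<close>
    have m: "g (vsize (e (f Orc c))) \<le> g (g (vsize (E c)))"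
      by (rule pb_mono[OF *(1) *(3)])
    show "ev Orc funs [E c] (ELet b1 b2) (e' (h Orc (f Orc c))) (1 + g (vsize (E c)) + g (g (vsize (E c))))"
      by (rule ev_Let[OF *(2) ev_env_Cons[OF *(4)]]) (use m in simp)
    show "vsize (e' (h Orc (f Orc c))) \<le> 1 + g (vsize (E c)) + g (g (vsize (E c)))"
      using *(5)[of Orc "f Orc c"] m by linarith
  qed (intro pb_intros pb_comp[OF *(1)] *(1))
qed

lemma PT_Pair:
  assumes "PT E e1 f1" "PT E e2 f2"
  shows "PT E (pair_enc e1 e2) (\<lambda>Orc c. (f1 Orc c, f2 Orc c))"
proof -
  obtain funs b1 b2 g where *: "pb g"
    "\<And>Orc c. ev Orc funs [E c] b1 (e1 (f1 Orc c)) (g (vsize (E c)))"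
    "\<And>Orc c. vsize (e1 (f1 Orc c)) \<le> g (vsize (E c))"
    "\<And>Orc c. ev Orc funs [E c] b2 (e2 (f2 Orc c)) (g (vsize (E c)))"
    "\<And>Orc c. vsize (e2 (f2 Orc c)) \<le> g (vsize (E c))"
    by (rule PTE2[OF assms]) blast
  show ?thesis
  proof (rule PTI[where funs = funs and b = "EPair b1 b2" and g = "\<lambda>s. 1 + g s + g s"])
    fix Orc c
    show "ev Orc funs [E c] (EPair b1 b2) (pair_enc e1 e2 (f1 Orc c, f2 Orc c)) (1 + g (vsize (E c)) + g (vsize (E c)))"
      unfolding pair_enc_def fst_conv snd_conv by (rule ev_Pair[OF *(2) *(4)]) simp
    show "vsize (pair_enc e1 e2 (f1 Orc c, f2 Orc c)) \<le> 1 + g (vsize (E c)) + g (vsize (E c))"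
      using *(3)[of Orc c] *(5)[of Orc c] by (simp add: pair_enc_def)
  qed (intro pb_intros *(1))
qed

lemma PT_fst: "PT E (pair_enc e1 e2) f \<Longrightarrow> PT E e1 (\<lambda>Orc c. fst (f Orc c))"
proof (erule PT_comp)
  show "PT (pair_enc e1 e2) e1 (\<lambda>Orc. fst)"
  proof (rule PTI[where funs = "[]" and b = "EFst (EVar 0)" and g = "\<lambda>s. s + 2"])
    show "ev Orc [] [pair_enc e1 e2 c] (EFst (EVar 0)) (e1 (fst c)) (vsize (pair_enc e1 e2 c) + 2)" for Orc c
      by (rule ev_Fst[OF ev_Var[OF _ _ order_refl]]) (auto simp: pair_enc_def)
  qed (intro pb_intros, simp add: pair_enc_def)
qed

lemma PT_snd: "PT E (pair_enc e1 e2) f \<Longrightarrow> PT E e2 (\<lambda>Orc c. snd (f Orc c))"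
proof (erule PT_comp)
  show "PT (pair_enc e1 e2) e2 (\<lambda>Orc. snd)"
  proof (rule PTI[where funs = "[]" and b = "ESnd (EVar 0)" and g = "\<lambda>s. s + 2"])
    show "ev Orc [] [pair_enc e1 e2 c] (ESnd (EVar 0)) (e2 (snd c)) (vsize (pair_enc e1 e2 c) + 2)" for Orc c
      by (rule ev_Snd[OF ev_Var[OF _ _ order_refl]]) (auto simp: pair_enc_def)
  qed (intro pb_intros, simp add: pair_enc_def)
qed

lemma PT_Num: "PT E Num (\<lambda>Orc c. a)"
  by (rule PTI[where funs = "[]" and b = "ENum a" and g = "\<lambda>s. s + (1 + floorlog 2 a)"]) (auto intro!: pb_intros ev_Num)

lemma PT_bool: "PT E bool_enc (\<lambda>Orc c. a)"
  using PT_Num[of E "if a then 1 else 0"] by (simp add: PT_def bool_enc_def)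

lemma PT_Nil: "PT E (enc_list e) (\<lambda>Orc c. [])"
  using PT_Num[of E 0] by (simp add: PT_def)

lemma PT_Cons: "PT E e x \<Longrightarrow> PT E (enc_list e) xs \<Longrightarrow> PT E (enc_list e) (\<lambda>Orc c. x Orc c # xs Orc c)"
  using PT_Pair[of E e x "enc_list e" xs] by (simp add: PT_def pair_enc_def)

lemma floorlog_le: "floorlog 2 a \<le> a"
  using less_exp[of a] by (simp add: floorlog_le_iff)

lemma floorlog_add: "floorlog 2 (a + b) \<le> floorlog 2 a + floorlog 2 b + 1"
proof -
  have "a < 2 ^ (floorlog 2 a + floorlog 2 b)" "b < 2 ^ (floorlog 2 a + floorlog 2 b)"
    using floorlog_leD[of 2 a "floorlog 2 a + floorlog 2 b"] floorlog_leD[of 2 b "floorlog 2 a + floorlog 2 b"] by auto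
  then have "a + b < 2 ^ (floorlog 2 a + floorlog 2 b + 1)" by simp
  then show ?thesis by (simp add: floorlog_le_iff)
qed

lemma floorlog_mult: "floorlog 2 (a * b) \<le> floorlog 2 a + floorlog 2 b"
proof -
  have "a * b < 2 ^ floorlog 2 a * 2 ^ floorlog 2 b"
    using floorlog_leD[of 2 a] floorlog_leD[of 2 b] by (intro mult_strict_mono) auto
  then show ?thesis by (simp add: floorlog_le_iff power_add)
qed

lemma floorlog_arith: "floorlog 2 (arith f a b) \<le> floorlog 2 a + floorlog 2 b + 1"
proof (cases f)
  case Add
  then show ?thesis using floorlog_add by simp
next
  case Sub
  then show ?thesis using floorlog_mono[of "a - b" a 2] by simp
next
  case Mul
  then show ?thesis using floorlog_mult[of a b] by simp
next
  case Div
  then show ?thesis using floorlog_mono[of "a div b" a 2] by simp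
next
  case Mod
  then show ?thesis using floorlog_mono[of "a mod b" a 2] by simp
next
  case Less
  then show ?thesis using floorlog_le[of 1] by (simp add: floorlog_def)
qed

lemma PT_arith:
  assumes "PT E Num f1" "PT E Num f2"
  shows "PT E Num (\<lambda>Orc c. arith f (f1 Orc c) (f2 Orc c))"
proof -
  obtain funs b1 b2 g where *: "pb g"
    "\<And>Orc c. ev Orc funs [E c] b1 (Num (f1 Orc c)) (g (vsize (E c)))"
    "\<And>Orc c. vsize (Num (f1 Orc c)) \<le> g (vsize (E c))"
    "\<And>Orc c. ev Orc funs [E c] b2 (Num (f2 Orc c)) (g (vsize (E c)))"
    "\<And>Orc c. vsize (Num (f2 Orc c)) \<le> g (vsize (E c))"
    by (rule PTE2[OF assms]) blast
  show ?thesis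
  proof (rule PTI[where funs = funs and b = "EArith f b1 b2" and g = "\<lambda>s. 2 + g s + g s + g s + g s"])
    fix Orc c
    show "ev Orc funs [E c] (EArith f b1 b2) (Num (arith f (f1 Orc c) (f2 Orc c)))
        (2 + g (vsize (E c)) + g (vsize (E c)) + g (vsize (E c)) + g (vsize (E c)))"
      by (rule ev_Arith[OF *(2) *(4) refl]) (use *(3)[of Orc c] *(5)[of Orc c] in simp)
    show "vsize (Num (arith f (f1 Orc c) (f2 Orc c)))
        \<le> 2 + g (vsize (E c)) + g (vsize (E c)) + g (vsize (E c)) + g (vsize (E c))"
      using *(3)[of Orc c] *(5)[of Orc c] floorlog_arith[of f "f1 Orc c" "f2 Orc c"] by simp
  qed (intro pb_intros *(1))
qed

lemmas PT_add = PT_arith[where f = Add, simplified]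
lemmas PT_sub = PT_arith[where f = Sub, simplified]
lemmas PT_mult = PT_arith[where f = Mul, simplified]
lemmas PT_div = PT_arith[where f = Div, simplified]
lemmas PT_mod = PT_arith[where f = Mod, simplified]

lemma PT_less: "PT E Num f1 \<Longrightarrow> PT E Num f2 \<Longrightarrow> PT E bool_enc (\<lambda>Orc c. f1 Orc c < f2 Orc c)"
  using PT_arith[where f = Less, of E f1 f2] by (simp add: PT_def bool_enc_def)

lemma PT_If:
  assumes "PT E bool_enc p" "PT E e f1" "PT E e f2"
  shows "PT E e (\<lambda>Orc c. if p Orc c then f1 Orc c else f2 Orc c)"
proof -
  obtain funs0 b1 b2 g0 where 0: "pb g0"
    "\<And>Orc c. ev Orc funs0 [E c] b1 (e (f1 Orc c)) (g0 (vsize (E c)))"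
    "\<And>Orc c. vsize (e (f1 Orc c)) \<le> g0 (vsize (E c))"
    "\<And>Orc c. ev Orc funs0 [E c] b2 (e (f2 Orc c)) (g0 (vsize (E c)))"
    "\<And>Orc c. vsize (e (f2 Orc c)) \<le> g0 (vsize (E c))"
    by (rule PTE2[OF assms(2,3)]) blast
  obtain funs1 bp g1 where 1: "pb g1"
    "\<And>Orc c. ev Orc funs1 [E c] bp (bool_enc (p Orc c)) (g1 (vsize (E c)))"
    using assms(1) by (rule PTE) blast
  let ?n = "length funs1"
  let ?funs = "funs1 @ map (shift_calls ?n) funs0"
  show ?thesis
  proof (rule PTI[where funs = ?funs and b = "EIf bp (shift_calls ?n b1) (shift_calls ?n b2)" and g = "\<lambda>s. 1 + g1 s + g0 s"])
    fix Orc c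
    show "ev Orc ?funs [E c] (EIf bp (shift_calls ?n b1) (shift_calls ?n b2))
        (e (if p Orc c then f1 Orc c else f2 Orc c)) (1 + g1 (vsize (E c)) + g0 (vsize (E c)))"
      by (rule ev_If[OF ev_append_funs[OF 1(2)[unfolded bool_enc_def]], where ?t2.0 = "g0 (vsize (E c))"])
        (use ev_shift[OF 0(2)] ev_shift[OF 0(4)] in \<open>auto split: if_splits\<close>)
    show "vsize (e (if p Orc c then f1 Orc c else f2 Orc c)) \<le> 1 + g1 (vsize (E c)) + g0 (vsize (E c))"
      using 0(3)[of Orc c] 0(5)[of Orc c] by simp
  qed (intro pb_intros 0(1) 1(1))
qed

lemma PT_conj:
  assumes "PT E bool_enc p" "PT E bool_enc q" shows "PT E bool_enc (\<lambda>Orc c. p Orc c \<and> q Orc c)"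
proof -
  have "(\<lambda>Orc c. p Orc c \<and> q Orc c) = (\<lambda>Orc c. if p Orc c then q Orc c else False)"
    by (intro ext) auto
  then show ?thesis using assms by (simp only: PT_If PT_bool)
qed

lemma PT_not:
  assumes "PT E bool_enc p" shows "PT E bool_enc (\<lambda>Orc c. \<not> p Orc c)"
proof -
  have "(\<lambda>Orc c. \<not> p Orc c) = (\<lambda>Orc c. if p Orc c then False else True)"
    by (intro ext) auto
  then show ?thesis using assms by (simp only: PT_If PT_bool)
qed

text \<open>The language compares numbers only by \<open>Less\<close>; the other relations are
  Boolean combinations of it.\<close>

lemma PT_le: "PT E Num f1 \<Longrightarrow> PT E Num f2 \<Longrightarrow> PT E bool_enc (\<lambda>Orc c. f1 Orc c \<le> f2 Orc c)"
  unfolding not_less[symmetric] by (intro PT_not PT_less)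

lemma PT_eq: "PT E Num f1 \<Longrightarrow> PT E Num f2 \<Longrightarrow> PT E bool_enc (\<lambda>Orc c. f1 Orc c = f2 Orc c)"
  unfolding order_eq_iff by (intro PT_conj PT_le)

lemma PT_bool_eq:
  assumes "PT E bool_enc p" "PT E bool_enc q" shows "PT E bool_enc (\<lambda>Orc c. p Orc c = q Orc c)"
proof -
  have "(\<lambda>Orc c. p Orc c = q Orc c) = (\<lambda>Orc c. if p Orc c then q Orc c else \<not> q Orc c)"
    by (intro ext) auto
  then show ?thesis using assms by (simp only: PT_If PT_not)
qed

text \<open>A call is charged with the size of the query, which the size bound in \<open>PT\<close>
  keeps polynomial.\<close>

lemma PT_oracle:
  assumes "PT E e q"
  shows "PT E bool_enc (\<lambda>Orc c. Orc (e (q Orc c)))"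
proof -
  obtain funs b g where *: "pb g" "\<And>Orc c. ev Orc funs [E c] b (e (q Orc c)) (g (vsize (E c)))"
    "\<And>Orc c. vsize (e (q Orc c)) \<le> g (vsize (E c))"
    using assms by (rule PTE) blast
  show ?thesis
  proof (rule PTI[where funs = funs and b = "EOracle b" and g = "\<lambda>s. 2 + g s + g s"])
    fix Orc c
    show "ev Orc funs [E c] (EOracle b) (bool_enc (Orc (e (q Orc c)))) (2 + g (vsize (E c)) + g (vsize (E c)))"
      unfolding bool_enc_def by (rule ev_Oracle[OF *(2)]) (use *(3)[of Orc c] in simp)
    show "vsize (bool_enc (Orc (e (q Orc c)))) \<le> 2 + g (vsize (E c)) + g (vsize (E c))"
      by (simp add: bool_enc_def floorlog_def)
  qed (intro pb_intros *(1))
qed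

section \<open>Iteration over lists\<close>

lemma floorlog_0 [simp]: "floorlog b 0 = 0"
  by (simp add: floorlog_def)

lemma vsize_pos: "1 \<le> vsize v"
  by (cases v) auto

lemma vsize_enc_list: "vsize (enc_list e xs) = 1 + (\<Sum>x\<leftarrow>xs. 1 + vsize (e x))"
  by (induction xs) auto

lemma length_le_vsize: "2 * length xs \<le> vsize (enc_list e xs)"
proof (induction xs)
  case (Cons x xs)
  then show ?case using vsize_pos[of "e x"] by simp
qed simp

lemma vsize_mem_le: "x \<in> set xs \<Longrightarrow> vsize (e x) \<le> vsize (enc_list e xs)"
  by (induction xs) auto

lemma vsize_enc_list_le:
  assumes "length xs \<le> n" "\<And>x. x \<in> set xs \<Longrightarrow> vsize (e x) \<le> b"
  shows "vsize (enc_list e xs) \<le> 1 + n * (1 + b)"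
proof -
  have "vsize (enc_list e xs) \<le> 1 + length xs * (1 + b)"
    using assms(2)
  proof (induction xs)
    case (Cons x xs)
    then have "vsize (e x) \<le> b" "vsize (enc_list e xs) \<le> 1 + length xs * (1 + b)" by auto
    then show ?case by simp
  qed simp
  also have "\<dots> \<le> 1 + n * (1 + b)"
    using assms(1) by (intro add_left_mono mult_le_mono1)
  finally show ?thesis .
qed

lemma ev_IsPair_list:
  "ev Orc funs env b (enc_list e xs) t \<Longrightarrow> 1 + t \<le> T \<Longrightarrow> ev Orc funs env (EIsPair b) (Num (if xs = [] then 0 else 1)) T"
  by (cases xs) (auto intro: ev_IsPair_Num[simplified] ev_IsPair_Pair[simplified])

text \<open>Composing polynomially many polynomial steps can give exponential growth, so the size of
  every intermediate state has to be bounded beforehand in terms of the context. For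
  \<open>foldr\<close> these states are the folds over suffixes of the list.\<close>

lemma PT_foldr:
  fixes E :: "'c \<Rightarrow> val" and ex :: "'x \<Rightarrow> val" and es :: "'s \<Rightarrow> val"
  assumes step: "PT (pair_enc E (pair_enc ex es)) es (\<lambda>Orc z. h Orc (fst z) (fst (snd z)) (snd (snd z)))"
    and xs: "PT E (enc_list ex) xs" and s0: "PT E es s0"
    and bound: "\<exists>g. pb g \<and> (\<forall>Orc c ys zs. xs Orc c = ys @ zs \<longrightarrow>
      vsize (es (foldr (h Orc c) zs (s0 Orc c))) \<le> g (vsize (E c)))"
  shows "PT E es (\<lambda>Orc c. foldr (h Orc c) (xs Orc c) (s0 Orc c))"
proof -
  obtain g where g: "pb g" "\<And>Orc c ys zs. xs Orc c = ys @ zs \<Longrightarrow>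
      vsize (es (foldr (h Orc c) zs (s0 Orc c))) \<le> g (vsize (E c))"
    using bound by blast
  obtain funs0 bx bs g0 where 0: "pb g0"
    "\<And>Orc c. ev Orc funs0 [E c] bx (enc_list ex (xs Orc c)) (g0 (vsize (E c)))"
    "\<And>Orc c. vsize (enc_list ex (xs Orc c)) \<le> g0 (vsize (E c))"
    "\<And>Orc c. ev Orc funs0 [E c] bs (es (s0 Orc c)) (g0 (vsize (E c)))"
    by (rule PTE2[OF xs s0]) blast
  obtain funs1 b g1 where 1: "pb g1"
    "\<And>Orc z. ev Orc funs1 [pair_enc E (pair_enc ex es) z] b
       (es (h Orc (fst z) (fst (snd z)) (snd (snd z)))) (g1 (vsize (pair_enc E (pair_enc ex es) z)))"
    using step by (rule PTE) blast
  let ?n = "length funs1" and ?m = "length funs1 + length funs0"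
  let ?sh = "shift_calls ?n"
  \<comment> \<open>Variable 0 is the context, 1 the remaining list, 2 the initial state. The index
    \<open>?m\<close> is the position of \<open>body\<close> itself, behind the two linked tables;
    the recursive call sits inside the triple that becomes the input of \<open>b\<close>.\<close>
  define body where "body = EIf (EIsPair (EVar 1))
    (ELet (EPair (EVar 0) (EPair (EFst (EVar 1)) (ECall ?m [EVar 0, ESnd (EVar 1), EVar 2]))) b) (EVar 2)"
  define funs where "funs = (funs1 @ map ?sh funs0) @ [body]"
  have ev0: "ev Orc funs0 env d v T \<Longrightarrow> ev Orc funs env (?sh d) v T" for Orc env d v T
    unfolding funs_def by (rule ev_append_funs, rule ev_shift)
  have ev1: "ev Orc funs1 env d v T \<Longrightarrow> ev Orc funs env d v T" for Orc env d v T
    unfolding funs_def by (rule ev_append_funs, rule ev_append_funs)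
  \<comment> \<open>The argument of one step consists of two pair nodes, the context, an entry of
    the list and the current state.\<close>
  define T where "T = (\<lambda>s. g1 (2 + s + (g0 s + g s)))"
  have nth: "?m < length funs" "funs ! ?m = body" by (auto simp: funs_def nth_append)
  have rec: "ev Orc funs [E c, enc_list ex zs, es (s0 Orc c)] body (es (foldr (h Orc c) zs (s0 Orc c)))
      (4 + length zs * (T (vsize (E c)) + 20))" if "xs Orc c = ys @ zs" for Orc c ys zs
    using that
  proof (induction zs arbitrary: ys)
    case Nil
    show ?case unfolding body_def
      by (rule ev_If[OF ev_IsPair_list[where xs = "[]", OF ev_Var[OF _ _ order_refl] order_refl], where ?t2.0 = 1])
        (auto intro!: ev_Var)
  next
    case (Cons x zs)
    let ?env = "[E c, enc_list ex (x # zs), es (s0 Orc c)]"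
    let ?s = "foldr (h Orc c) zs (s0 Orc c)"
    have IH: "ev Orc funs [E c, enc_list ex zs, es (s0 Orc c)] body (es ?s) (4 + length zs * (T (vsize (E c)) + 20))"
      using Cons.IH[of "ys @ [x]"] Cons.prems by simp
    have args: "evs Orc funs ?env [EVar 0, ESnd (EVar 1), EVar 2] [E c, enc_list ex zs, es (s0 Orc c)] 4"
      by (rule evs_Cons[OF ev_Var[OF _ _ order_refl]
          evs_Cons[OF ev_Snd[OF ev_Var[OF _ _ order_refl] order_refl]
          evs_Cons[OF ev_Var[OF _ _ order_refl] evs_Nil[of _ _ _ 0] order_refl] order_refl]]) auto
    have call: "ev Orc funs ?env (ECall ?m [EVar 0, ESnd (EVar 1), EVar 2]) (es ?s)
        (5 + (4 + length zs * (T (vsize (E c)) + 20)))"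
      by (rule ev_Call[OF args nth(1)]) (use nth(2) IH in auto)
    have x: "ev Orc funs ?env (EFst (EVar 1)) (ex x) 2"
      by (rule ev_Fst[OF ev_Var[where v = "Pair (ex x) (enc_list ex zs)" and T = 1]]) auto
    have z: "ev Orc funs ?env (EPair (EVar 0) (EPair (EFst (EVar 1)) (ECall ?m [EVar 0, ESnd (EVar 1), EVar 2])))
        (pair_enc E (pair_enc ex es) (c, x, ?s)) (14 + (length zs * (T (vsize (E c)) + 20)))"
      unfolding pair_enc_def fst_conv snd_conv
      by (rule ev_Pair[OF ev_Var[OF _ _ order_refl] ev_Pair[OF x call order_refl]]) auto
    have sz: "vsize (pair_enc E (pair_enc ex es) (c, x, ?s)) \<le> 2 + vsize (E c) + (g0 (vsize (E c)) + g (vsize (E c)))"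
      using g(2)[of Orc c "ys @ [x]" zs] vsize_mem_le[of x "xs Orc c" ex] 0(3)[of Orc c] Cons.prems
      by (simp add: pair_enc_def)
    have st: "ev Orc funs [pair_enc E (pair_enc ex es) (c, x, ?s)] b (es (h Orc c x ?s)) (T (vsize (E c)))"
      using ev_mono[OF ev1[OF 1(2)[of Orc "(c, x, ?s)"]] pb_mono[OF 1(1) sz]] by (simp add: T_def)
    show ?case unfolding body_def foldr.simps o_apply
      by (rule ev_If[OF ev_IsPair_list[where xs = "x # zs", OF ev_Var[OF _ _ order_refl] order_refl] ev_Let[OF z ev_env_Cons[OF st] order_refl]])
        auto
  qed
  show ?thesis
  proof (rule PTI[where funs = funs and b = "ECall ?m [EVar 0, ?sh bx, ?sh bs]"
        and g = "\<lambda>s. g s + (10 + g0 s + g0 s + g0 s * (T s + 20))"])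
    fix Orc c
    let ?s = "vsize (E c)"
    have args: "evs Orc funs [E c] [EVar 0, ?sh bx, ?sh bs] [E c, enc_list ex (xs Orc c), es (s0 Orc c)]
        (1 + (g0 ?s + (g0 ?s + 0)))"
      by (rule evs_Cons[OF ev_Var[OF _ _ order_refl] evs_Cons[OF ev0[OF 0(2)] evs_Cons[OF ev0[OF 0(4)] evs_Nil order_refl] order_refl]])
        auto
    have len: "length (xs Orc c) * (T ?s + 20) \<le> g0 ?s * (T ?s + 20)"
      using length_le_vsize[of "xs Orc c" ex] 0(3)[of Orc c] by (intro mult_le_mono1) linarith
    show "ev Orc funs [E c] (ECall ?m [EVar 0, ?sh bx, ?sh bs]) (es (foldr (h Orc c) (xs Orc c) (s0 Orc c)))
        (g ?s + (10 + g0 ?s + g0 ?s + g0 ?s * (T ?s + 20)))"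
      by (rule ev_Call[OF args nth(1)]) (unfold nth(2), rule rec[of Orc c "[]" "xs Orc c"], simp, use len in linarith)
    show "vsize (es (foldr (h Orc c) (xs Orc c) (s0 Orc c))) \<le> g ?s + (10 + g0 ?s + g0 ?s + g0 ?s * (T ?s + 20))"
      using g(2)[of Orc c "[]" "xs Orc c"] by simp
  next
    show "pb (\<lambda>s. g s + (10 + g0 s + g0 s + g0 s * (T s + 20)))"
      unfolding T_def by (intro pb_intros g(1) 0(1) pb_comp[OF 1(1)])
  qed
qed

lemma PT_size:
  assumes "PT E e f"
  shows "\<exists>g. pb g \<and> (\<forall>Orc c. vsize (e (f Orc c)) \<le> g (vsize (E c)))"
  using assms by (rule PTE) blast

lemma PT_append:
  fixes e :: "'a \<Rightarrow> val"
  assumes "PT E (enc_list e) xs" "PT E (enc_list e) ys"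
  shows "PT E (enc_list e) (\<lambda>Orc c. xs Orc c @ ys Orc c)"
proof -
  obtain g1 where 1: "pb g1" "\<And>Orc c. vsize (enc_list e (xs Orc c)) \<le> g1 (vsize (E c))"
    using PT_size[OF assms(1)] by blast
  obtain g2 where 2: "pb g2" "\<And>Orc c. vsize (enc_list e (ys Orc c)) \<le> g2 (vsize (E c))"
    using PT_size[OF assms(2)] by blast
  have b: "vsize (enc_list e (us @ vs)) \<le> vsize (enc_list e us) + vsize (enc_list e vs)" for us vs
    by (simp add: vsize_enc_list)
  have "PT E (enc_list e) (\<lambda>Orc c. foldr Cons (xs Orc c) (ys Orc c))"
  proof (rule PT_foldr[OF _ assms], goal_cases)
    case 1
    show ?case by (rule PT_Cons PT_fst PT_snd PT_id)+
  next
    case 2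
    have "vsize (enc_list e (foldr Cons vs (ys Orc c))) \<le> g1 (vsize (E c)) + g2 (vsize (E c))"
      if "xs Orc c = us @ vs" for Orc c us vs
    proof -
      have "foldr Cons vs (ys Orc c) = vs @ ys Orc c" by (induction vs) auto
      moreover have "vsize (enc_list e vs) \<le> vsize (enc_list e (xs Orc c))"
        unfolding that by (simp add: vsize_enc_list)
      ultimately show ?thesis using b[of vs "ys Orc c"] 1(2)[of Orc c] \<open>\<And>Orc c. vsize (enc_list e (ys Orc c)) \<le> g2 (vsize (E c))\<close>[of Orc c] by simp
    qed
    then show ?case by (intro exI[of _ "\<lambda>s. g1 s + g2 s"] conjI pb_add 1(1) \<open>pb g2\<close>) blast
  qed
  moreover have "foldr Cons us vs = us @ vs" for us vs :: "'a list" by (induction us) auto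
  ultimately show ?thesis by (simp only:)
qed

lemma PT_map:
  assumes "PT (pair_enc E ex) ey (\<lambda>Orc z. h Orc (fst z) (snd z))" "PT E (enc_list ex) xs"
  shows "PT E (enc_list ey) (\<lambda>Orc c. map (h Orc c) (xs Orc c))"
proof -
  obtain g1 where 1: "pb g1" "\<And>Orc z. vsize (ey (h Orc (fst z) (snd z))) \<le> g1 (vsize (pair_enc E ex z))"
    using PT_size[OF assms(1)] by blast
  obtain g2 where 2: "pb g2" "\<And>Orc c. vsize (enc_list ex (xs Orc c)) \<le> g2 (vsize (E c))"
    using PT_size[OF assms(2)] by blast
  have "PT E (enc_list ey) (\<lambda>Orc c. foldr (\<lambda>x ys. h Orc c x # ys) (xs Orc c) [])"
  proof (rule PT_foldr[OF _ assms(2) PT_Nil])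
    have *: "PT (pair_enc E (pair_enc ex (enc_list ey))) ey
        (\<lambda>Orc z. h Orc (fst (fst z, fst (snd z))) (snd (fst z, fst (snd z))))"
      by (rule PT_comp[OF _ assms(1)]) ((rule PT_Pair PT_fst PT_snd PT_id)+)
    show "PT (pair_enc E (pair_enc ex (enc_list ey))) (enc_list ey)
        (\<lambda>Orc z. h Orc (fst z) (fst (snd z)) # snd (snd z))"
      by (rule PT_Cons *[unfolded fst_conv snd_conv] PT_snd PT_id)+
    have "vsize (enc_list ey (foldr (\<lambda>x ys. h Orc c x # ys) zs [])) \<le> 1 + g2 (vsize (E c)) * (1 + g1 (1 + vsize (E c) + g2 (vsize (E c))))"
      if "xs Orc c = us @ zs" for Orc c us zs
    proof -
      have *: "foldr (\<lambda>x ys. h Orc c x # ys) zs [] = map (h Orc c) zs" by (induction zs) auto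
      show ?thesis unfolding *
      proof (rule vsize_enc_list_le)
        show "length (map (h Orc c) zs) \<le> g2 (vsize (E c))"
          using length_le_vsize[of "xs Orc c" ex] 2(2)[of Orc c] that by simp
        fix y assume "y \<in> set (map (h Orc c) zs)"
        then obtain x where x: "x \<in> set zs" "y = h Orc c x" by auto
        have "vsize (pair_enc E ex (c, x)) \<le> 1 + vsize (E c) + g2 (vsize (E c))"
          using vsize_mem_le[of x "xs Orc c" ex] 2(2)[of Orc c] that x(1) by (simp add: pair_enc_def)
        then show "vsize (ey y) \<le> g1 (1 + vsize (E c) + g2 (vsize (E c)))"
          using 1(2)[of Orc "(c, x)"] pb_mono[OF 1(1)] x(2) by (metis fst_conv snd_conv order_trans)
      qed
    qed
    then show "\<exists>g. pb g \<and> (\<forall>Orc c us zs. xs Orc c = us @ zs \<longrightarrow>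
        vsize (enc_list ey (foldr (\<lambda>x ys. h Orc c x # ys) zs [])) \<le> g (vsize (E c)))"
      by (intro exI[of _ "\<lambda>s. 1 + g2 s * (1 + g1 (1 + s + g2 s))"] conjI pb_intros 2(1) pb_comp[OF 1(1)]) blast
  qed
  moreover have "foldr (\<lambda>x ys. h Orc c x # ys) zs [] = map (h Orc c) zs" for Orc c zs by (induction zs) auto
  ultimately show ?thesis by (simp only:)
qed

lemma PT_concat:
  assumes "PT E (enc_list (enc_list e)) xss"
  shows "PT E (enc_list e) (\<lambda>Orc c. concat (xss Orc c))"
proof -
  obtain g where g: "pb g" "\<And>Orc c. vsize (enc_list (enc_list e) (xss Orc c)) \<le> g (vsize (E c))"
    using PT_size[OF assms] by blast
  have b: "vsize (enc_list e (concat yss)) \<le> vsize (enc_list (enc_list e) yss)" for yss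
    by (induction yss) (auto simp: vsize_enc_list)
  have "PT E (enc_list e) (\<lambda>Orc c. foldr (\<lambda>ys zs. ys @ zs) (xss Orc c) [])"
  proof (rule PT_foldr[OF _ assms PT_Nil])
    show "PT (pair_enc E (pair_enc (enc_list e) (enc_list e))) (enc_list e) (\<lambda>Orc z. fst (snd z) @ snd (snd z))"
      by (rule PT_append PT_fst PT_snd PT_id)+
    have "vsize (enc_list e (foldr (\<lambda>ys zs. ys @ zs) zss [])) \<le> g (vsize (E c))" if "xss Orc c = uss @ zss" for Orc c uss zss
    proof -
      have "vsize (enc_list e (foldr (\<lambda>ys zs. ys @ zs) zss [])) \<le> vsize (enc_list (enc_list e) zss)"
        using b[of zss] by (simp add: concat_conv_foldr)
      also have "\<dots> \<le> vsize (enc_list (enc_list e) (xss Orc c))" unfolding that by (simp add: vsize_enc_list)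
      also have "\<dots> \<le> g (vsize (E c))" by (rule g(2))
      finally show ?thesis .
    qed
    then show "\<exists>g. pb g \<and> (\<forall>Orc c uss zss. xss Orc c = uss @ zss \<longrightarrow>
        vsize (enc_list e (foldr (\<lambda>ys zs. ys @ zs) zss [])) \<le> g (vsize (E c)))"
      using g(1) by blast
  qed
  then show ?thesis by (simp add: concat_conv_foldr)
qed

lemma vsize_bool_enc: "vsize (bool_enc b) \<le> 2"
  by (simp add: bool_enc_def floorlog_def)

lemma PT_list_all:
  assumes "PT (pair_enc E ex) bool_enc (\<lambda>Orc z. P Orc (fst z) (snd z))" "PT E (enc_list ex) xs"
  shows "PT E bool_enc (\<lambda>Orc c. list_all (P Orc c) (xs Orc c))"
proof -
  have "PT E bool_enc (\<lambda>Orc c. foldr (\<lambda>x b. P Orc c x \<and> b) (xs Orc c) True)"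
  proof (rule PT_foldr[OF _ assms(2) PT_bool])
    have *: "PT (pair_enc E (pair_enc ex bool_enc)) bool_enc
        (\<lambda>Orc z. P Orc (fst (fst z, fst (snd z))) (snd (fst z, fst (snd z))))"
      by (rule PT_comp[OF _ assms(1)]) ((rule PT_Pair PT_fst PT_snd PT_id)+)
    show "PT (pair_enc E (pair_enc ex bool_enc)) bool_enc
        (\<lambda>Orc z. P Orc (fst z) (fst (snd z)) \<and> snd (snd z))"
      by (rule PT_conj *[unfolded fst_conv snd_conv] PT_snd PT_id)+
  qed (use vsize_bool_enc pb_const[of 2] in blast)
  moreover have "foldr (\<lambda>x b. P Orc c x \<and> b) ys True = list_all (P Orc c) ys" for Orc c ys
    by (induction ys) auto
  ultimately show ?thesis by (simp only:)
qed

lemma PT_length: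
  fixes e :: "'b \<Rightarrow> val"
  assumes "PT E (enc_list e) xs"
  shows "PT E Num (\<lambda>Orc c. length (xs Orc c))"
proof -
  obtain g where g: "pb g" "\<And>Orc c. vsize (enc_list e (xs Orc c)) \<le> g (vsize (E c))"
    using PT_size[OF assms] by blast
  have "PT E Num (\<lambda>Orc c. foldr (\<lambda>x m. m + 1) (xs Orc c) 0)"
  proof (rule PT_foldr[OF _ assms PT_Num])
    show "PT (pair_enc E (pair_enc e Num)) Num (\<lambda>Orc z. snd (snd z) + 1)"
      by (rule PT_add PT_Num PT_snd PT_id)+
    have "vsize (Num (foldr (\<lambda>x m. m + 1) zs 0)) \<le> 1 + g (vsize (E c))" if "xs Orc c = us @ zs" for Orc c us zs
    proof -
      have "foldr (\<lambda>x m. m + 1) zs 0 = length zs" by (induction zs) auto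
      then show ?thesis
        using length_le_vsize[of "xs Orc c" e] g(2)[of Orc c] floorlog_le[of "length zs"] that by simp
    qed
    then show "\<exists>g. pb g \<and> (\<forall>Orc c us zs. xs Orc c = us @ zs \<longrightarrow>
        vsize (Num (foldr (\<lambda>x m. m + 1) zs 0)) \<le> g (vsize (E c)))"
      by (intro exI[of _ "\<lambda>s. 1 + g s"] conjI pb_intros g(1)) blast
  qed
  moreover have "foldr (\<lambda>x m. m + 1) zs 0 = length zs" for zs :: "'b list" by (induction zs) auto
  ultimately show ?thesis by (simp only:)
qed

text \<open>\<open>foldr\<close> meets the list from its end, so position i is recognised by
  counting the entries already passed: exactly n - i - 1 entries lie behind it. The default keeps
  the operation total.\<close>

lemma PT_nth:
  fixes e :: "'b \<Rightarrow> val"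
  assumes "PT E e d" "PT E (enc_list e) xs" "PT E Num i"
  shows "PT E e (\<lambda>Orc c. nth_default (d Orc c) (xs Orc c) (i Orc c))"
proof -
  obtain gx where gx: "pb gx" "\<And>Orc c. vsize (enc_list e (xs Orc c)) \<le> gx (vsize (E c))"
    using PT_size[OF assms(2)] by blast
  obtain gd where gd: "pb gd" "\<And>Orc c. vsize (e (d Orc c)) \<le> gd (vsize (E c))"
    using PT_size[OF assms(1)] by blast
  define h where "h = (\<lambda>j n x (s :: nat \<times> 'b). (fst s + 1, if fst s + j + 1 = n then x else snd s))"
  have h: "foldr (h j n) zs (0, d) = (length zs, if j < n \<and> n \<le> j + length zs then zs ! (j + length zs - n) else d)" for j n zs d
    by (induction zs) (auto simp: h_def nth_Cons' Suc_diff_le)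
  have "PT E (pair_enc Num e) (\<lambda>Orc c. foldr (h (i Orc c) (length (xs Orc c))) (xs Orc c) (0, d Orc c))"
  proof (rule PT_foldr[OF _ assms(2) PT_Pair[OF PT_Num assms(1)]])
    have i: "PT (pair_enc E (pair_enc e (pair_enc Num e))) Num (\<lambda>Orc z. i Orc (fst z))"
      by (rule PT_comp[OF _ assms(3)]) ((rule PT_fst PT_id)+)
    have x: "PT (pair_enc E (pair_enc e (pair_enc Num e))) (enc_list e) (\<lambda>Orc z. xs Orc (fst z))"
      by (rule PT_comp[OF _ assms(2)]) ((rule PT_fst PT_id)+)
    show "PT (pair_enc E (pair_enc e (pair_enc Num e))) (pair_enc Num e)
        (\<lambda>Orc z. h (i Orc (fst z)) (length (xs Orc (fst z))) (fst (snd z)) (snd (snd z)))"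
      unfolding h_def by (rule PT_Pair PT_If PT_eq PT_add PT_length[OF x] i PT_Num PT_fst PT_snd PT_id)+
    have "vsize (pair_enc Num e (foldr (h (i Orc c) (length (xs Orc c))) zs (0, d Orc c)))
        \<le> 2 + gx (vsize (E c)) + (gx (vsize (E c)) + gd (vsize (E c)))" if "xs Orc c = us @ zs" for Orc c us zs
    proof -
      have "floorlog 2 (length zs) \<le> gx (vsize (E c))"
        using floorlog_le[of "length zs"] length_le_vsize[of "xs Orc c" e] gx(2)[of Orc c] that by simp
      moreover have "vsize (e (zs ! (i Orc c + length zs - length (xs Orc c)))) \<le> gx (vsize (E c))"
        if "i Orc c < length (xs Orc c)" "length (xs Orc c) \<le> i Orc c + length zs"
        using vsize_mem_le[of "zs ! (i Orc c + length zs - length (xs Orc c))" "xs Orc c" e] gx(2)[of Orc c]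
          that \<open>xs Orc c = us @ zs\<close> by fastforce
      ultimately show ?thesis using gd(2)[of Orc c] unfolding h pair_enc_def by auto
    qed
    then show "\<exists>g. pb g \<and> (\<forall>Orc c us zs. xs Orc c = us @ zs \<longrightarrow>
        vsize (pair_enc Num e (foldr (h (i Orc c) (length (xs Orc c))) zs (0, d Orc c))) \<le> g (vsize (E c)))"
      by (intro exI[of _ "\<lambda>s. 2 + gx s + (gx s + gd s)"] conjI pb_intros gx(1) gd(1)) blast
  qed
  from PT_snd[OF this] show ?thesis unfolding h nth_default_def snd_conv by (simp cong: if_cong conj_cong)
qed

lemma PT_notin:
  assumes "PT E Num j" "PT E (enc_list Num) xs"
  shows "PT E bool_enc (\<lambda>Orc c. j Orc c \<notin> set (xs Orc c))"
proof -
  have j: "PT (pair_enc E Num) Num (\<lambda>Orc z. j Orc (fst z))"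
    by (rule PT_comp[OF _ assms(1)]) ((rule PT_fst PT_id)+)
  have "PT E bool_enc (\<lambda>Orc c. list_all (\<lambda>x. \<not> j Orc c = x) (xs Orc c))"
    by (rule PT_list_all PT_not PT_eq j assms(2) PT_snd PT_id)+
  moreover have "list_all (\<lambda>x. \<not> j = x) xs = (j \<notin> set xs)" for j :: nat and xs
    by (auto simp: list_all_iff)
  ultimately show ?thesis by (simp only:)
qed


section \<open>Counting loops\<close>

text \<open>
  A number that is polynomially bounded by value, not only by bit length, as required of the
  bound of a counting loop.
\<close>

definition UB :: "('c \<Rightarrow> val) \<Rightarrow> ((val \<Rightarrow> bool) \<Rightarrow> 'c \<Rightarrow> nat) \<Rightarrow> bool" where
  "UB E N \<longleftrightarrow> (\<exists>g. pb g \<and> (\<forall>Orc c. N Orc c \<le> g (vsize (E c))))"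

lemma UB_const: "UB E (\<lambda>Orc c. a)"
  unfolding UB_def using pb_const by blast

lemma UB_add: assumes "UB E M" "UB E N" shows "UB E (\<lambda>Orc c. M Orc c + N Orc c)"
proof -
  obtain g h where "pb g" "pb h" "\<And>Orc c. M Orc c \<le> g (vsize (E c))" "\<And>Orc c. N Orc c \<le> h (vsize (E c))"
    using assms unfolding UB_def by blast
  then show ?thesis
    unfolding UB_def by (intro exI[of _ "\<lambda>s. g s + h s"] conjI pb_add allI add_mono)
qed

lemma UB_mult: assumes "UB E M" "UB E N" shows "UB E (\<lambda>Orc c. M Orc c * N Orc c)"
proof -
  obtain g h where "pb g" "pb h" "\<And>Orc c. M Orc c \<le> g (vsize (E c))" "\<And>Orc c. N Orc c \<le> h (vsize (E c))"
    using assms unfolding UB_def by blast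
  then show ?thesis
    unfolding UB_def by (intro exI[of _ "\<lambda>s. g s * h s"] conjI pb_mult allI mult_mono) auto
qed

lemma UB_le: assumes "UB E N" "\<And>Orc c. M Orc c \<le> N Orc c" shows "UB E M"
  using assms unfolding UB_def by (meson order_trans)

lemma UB_sub: "UB E M \<Longrightarrow> UB E (\<lambda>Orc c. M Orc c - N Orc c)"
  by (erule UB_le) simp

lemma UB_length: "PT E (enc_list e) xs \<Longrightarrow> UB E (\<lambda>Orc c. length (xs Orc c))"
proof -
  assume "PT E (enc_list e) xs"
  then obtain g where "pb g" "\<And>Orc c. vsize (enc_list e (xs Orc c)) \<le> g (vsize (E c))"
    using PT_size by blast
  moreover have "length (xs Orc c) \<le> vsize (enc_list e (xs Orc c))" for Orc c
    using length_le_vsize[of "xs Orc c" e] by simp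
  ultimately show ?thesis unfolding UB_def by (meson order_trans)
qed

lemma vsize_upt_le: "vsize (enc_list Num [i..<n]) \<le> 1 + n * (1 + (1 + floorlog 2 n))"
  by (rule vsize_enc_list_le) (auto intro: floorlog_mono)

lemma PT_upt:
  assumes "PT E Num N" "UB E N"
  shows "PT E (enc_list Num) (\<lambda>Orc c. [0..<N Orc c])"
proof -
  obtain h where h: "pb h" "\<And>Orc c. N Orc c \<le> h (vsize (E c))"
    using assms(2) unfolding UB_def by blast
  obtain funs0 b g where 0: "pb g" "\<And>Orc c. ev Orc funs0 [E c] b (Num (N Orc c)) (g (vsize (E c)))"
    "\<And>Orc c. vsize (Num (N Orc c)) \<le> g (vsize (E c))"
    using assms(1) by (rule PTE) blast
  let ?m = "length funs0"
  define body where "body = EIf (EArith Less (EVar 0) (EVar 1))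
    (EPair (EVar 0) (ECall ?m [EArith Add (EVar 0) (ENum 1), EVar 1])) (ENum 0)"
  define funs where "funs = funs0 @ [body]"
  have nth: "?m < length funs" "funs ! ?m = body" by (auto simp: funs_def)
  have rec: "ev Orc funs [Num i, Num n] body (enc_list Num [i..<n]) (6 + 2 * floorlog 2 n + (n - i) * (20 + 4 * floorlog 2 n))"
    if "i \<le> n" for Orc i n
    using that
  proof (induction "n - i" arbitrary: i)
    case 0
    show ?case unfolding body_def
      by (rule ev_If[OF ev_Arith[OF ev_Var[OF _ _ order_refl] ev_Var[OF _ _ order_refl] refl order_refl], where ?t2.0 = 1])
        (use 0 in \<open>auto intro!: ev_Num\<close>)
  next
    case (Suc k)
    let ?L = "floorlog 2 n"
    have "i < n" using Suc(2) by simp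
    then have ar: "arith Less i n = 1" by simp
    have i: "floorlog 2 i \<le> ?L" using Suc by (intro floorlog_mono) simp
    have args: "evs Orc funs [Num i, Num n] [EArith Add (EVar 0) (ENum 1), EVar 1] [Num (i + 1), Num n] (6 + ?L)"
      by (rule evs_Cons[OF ev_Arith[OF ev_Var[OF _ _ order_refl] ev_Num[OF order_refl] _ order_refl]
            evs_Cons[OF ev_Var[OF _ _ order_refl] evs_Nil[of _ _ _ 0] order_refl]])
        (use i in \<open>auto simp: floorlog_def\<close>)
    have IH: "ev Orc funs [Num (i + 1), Num n] (funs ! ?m) (enc_list Num [i+1..<n]) (6 + 2 * ?L + (n - (i + 1)) * (20 + 4 * ?L))"
      unfolding nth(2) by (rule Suc(1)) (use Suc(2) in auto)
    have *: "enc_list Num [i..<n] = Pair (Num i) (enc_list Num [i+1..<n])"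
      using Suc(2) by (simp add: upt_conv_Cons)
    have **: "(n - i) * (20 + 4 * ?L) = (n - (i + 1)) * (20 + 4 * ?L) + (20 + 4 * ?L)"
      using Suc(2) by (metis Suc_diff_Suc add.commute mult_Suc zero_less_Suc zero_less_diff Suc_eq_plus1)
    show ?case unfolding body_def *
      by (rule ev_If[OF ev_Arith[OF ev_Var[OF _ _ order_refl] ev_Var[OF _ _ order_refl] ar order_refl]
            ev_Pair[OF ev_Var[OF _ _ order_refl] ev_Call[OF args nth(1) IH order_refl] order_refl]])
        (use i ** in auto)
  qed
  show ?thesis
  proof (rule PTI[where funs = funs and b = "ECall ?m [ENum 0, b]"
        and g = "\<lambda>s. 10 + g s + 2 * g s + h s * (20 + 4 * g s)"])
    fix Orc c
    let ?s = "vsize (E c)"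
    have args: "evs Orc funs [E c] [ENum 0, b] [Num 0, Num (N Orc c)] (1 + (g ?s + 0))"
      unfolding funs_def by (rule evs_Cons[OF ev_Num[OF order_refl] evs_Cons[OF ev_append_funs[OF 0(2)] evs_Nil order_refl] order_refl])
    have L: "floorlog 2 (N Orc c) + 1 \<le> g ?s" using 0(3)[of Orc c] by simp
    have NL: "N Orc c * (20 + 4 * floorlog 2 (N Orc c)) \<le> h ?s * (20 + 4 * g ?s)"
      using h(2)[of Orc c] L by (intro mult_mono) auto
    show "ev Orc funs [E c] (ECall ?m [ENum 0, b]) (enc_list Num [0..<N Orc c]) (10 + g ?s + 2 * g ?s + h ?s * (20 + 4 * g ?s))"
      by (rule ev_Call[OF args nth(1)], unfold nth(2), rule rec[OF le0]) (use L NL in simp)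
    have "N Orc c * (1 + (1 + floorlog 2 (N Orc c))) \<le> h ?s * (20 + 4 * g ?s)"
      using h(2)[of Orc c] L by (intro mult_mono) auto
    then show "vsize (enc_list Num [0..<N Orc c]) \<le> 10 + g ?s + 2 * g ?s + h ?s * (20 + 4 * g ?s)"
      using vsize_upt_le[of 0 "N Orc c"] by simp
  qed (intro pb_intros 0(1) h(1))
qed

text \<open>The least significant bit comes first, so that \<open>foldr\<close> starts with the most
  significant one, as repeated squaring requires.\<close>

fun nat_bits :: "nat \<Rightarrow> bool list" where
  "nat_bits n = (if n = 0 then [] else odd n # nat_bits (n div 2))"

declare nat_bits.simps [simp del]

lemma PT_nat_bits: 
  assumes "PT E Num N" shows "PT E (enc_list bool_enc) (\<lambda>Orc c. nat_bits (N Orc c))"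
proof (rule PT_comp[OF assms])
  define body where "body = EIf (EVar 0)
    (EPair (EArith Mod (EVar 0) (ENum 2)) (ECall 0 [EArith Div (EVar 0) (ENum 2)])) (ENum 0)"
  have len: "length (nat_bits n) \<le> floorlog 2 n" for n
  proof (induction n rule: nat_bits.induct)
    case (1 n)
    then show ?case by (simp add: nat_bits.simps[of n] compute_floorlog[of 2 n])
  qed
  have rec: "ev Orc [body] [Num n] body (enc_list bool_enc (nat_bits n)) (3 + floorlog 2 n * (20 + 2 * floorlog 2 n))" for Orc n
  proof (induction n rule: nat_bits.induct)
    case (1 n)
    show ?case
    proof (cases "n = 0")
      case True
      show ?thesis unfolding body_def
        by (rule ev_If[OF ev_Var[OF _ _ order_refl], where ?t2.0 = 1])
          (use True in \<open>auto simp: nat_bits.simps intro!: ev_Num\<close>)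
    next
      case False
      let ?L = "floorlog 2 n" and ?K = "floorlog 2 (n div 2)"
      have LK: "?L = ?K + 1" using False by (simp add: compute_floorlog[of 2 n])
      have K: "?K * (20 + 2 * ?K) \<le> ?K * (20 + 2 * ?L)" by (rule mult_le_mono2) (simp add: LK)
      have two: "floorlog 2 2 = 2" using floorlog_power[of 1 2 1] by (simp add: floorlog_def)
      have args: "evs Orc [body] [Num n] [EArith Div (EVar 0) (ENum 2)] [Num (n div 2)] (5 + ?L)"
        by (rule evs_Cons[OF ev_Arith[OF ev_Var[OF _ _ order_refl] ev_Num[OF order_refl] _ order_refl]
            evs_Nil[of _ _ _ 0]]) (auto simp: two)
      have IH: "ev Orc [body] [Num (n div 2)] ([body] ! 0) (enc_list bool_enc (nat_bits (n div 2))) (3 + ?K * (20 + 2 * ?L))"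
        using ev_mono[OF 1[OF False]] K by simp
      have m: "ev Orc [body] [Num n] (EArith Mod (EVar 0) (ENum 2)) (bool_enc (odd n)) (5 + ?L)"
        unfolding bool_enc_def
        by (rule ev_Arith[OF ev_Var[OF _ _ order_refl] ev_Num[OF order_refl]]) (auto simp: two odd_iff_mod_2_eq_one even_iff_mod_2_eq_zero)
      have bs: "enc_list bool_enc (nat_bits n) = Pair (bool_enc (odd n)) (enc_list bool_enc (nat_bits (n div 2)))"
        using False by (simp add: nat_bits.simps[of n])
      have "ev Orc [body] [Num n] (EIf (EVar 0)
    (EPair (EArith Mod (EVar 0) (ENum 2)) (ECall 0 [EArith Div (EVar 0) (ENum 2)])) (ENum 0)) (enc_list bool_enc (nat_bits n)) (3 + ?L * (20 + 2 * ?L))"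
        unfolding bs
        by (rule ev_If[OF ev_Var[OF _ _ order_refl] ev_Pair[OF m ev_Call[OF args _ IH order_refl] order_refl]])
          (use False in \<open>auto simp: LK\<close>)
      then show ?thesis by (simp only: body_def[symmetric])
    qed
  qed
  show "PT Num (enc_list bool_enc) (\<lambda>Orc. nat_bits)"
  proof (rule PTI[where funs = "[body]" and b = body and g = "\<lambda>s. 3 + s * (20 + 2 * s)"])
    fix Orc c
    have "floorlog 2 c * (20 + 2 * floorlog 2 c) \<le> vsize (Num c) * (20 + 2 * vsize (Num c))"
      by (intro mult_mono) auto
    then show "ev Orc [body] [Num c] body (enc_list bool_enc (nat_bits c)) (3 + vsize (Num c) * (20 + 2 * vsize (Num c)))"
      by (intro ev_mono[OF rec]) simp
    have "vsize (enc_list bool_enc (nat_bits c)) \<le> 1 + floorlog 2 c * (1 + 2)"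
      using len vsize_bool_enc by (rule vsize_enc_list_le)
    also have "\<dots> \<le> 3 + vsize (Num c) * (20 + 2 * vsize (Num c))"
      using mult_le_mono[of "floorlog 2 c" "vsize (Num c)" 3 "20 + 2 * vsize (Num c)"] by simp
    finally show "vsize (enc_list bool_enc (nat_bits c)) \<le> 3 + vsize (Num c) * (20 + 2 * vsize (Num c))" .
  qed (intro pb_intros)
qed

text \<open>A program is proved once on an encoded tuple of its arguments; these lemmas turn that
  into a rule for arguments that are themselves computed from a context. The primed facts below are
  the tuple versions.\<close>

lemma PT_app2:
  assumes "PT (pair_enc e1 e2) e (\<lambda>Orc z. F Orc (fst z) (snd z))" "PT E e1 a" "PT E e2 b"
  shows "PT E e (\<lambda>Orc c. F Orc (a Orc c) (b Orc c))"
  using PT_comp[OF PT_Pair[OF assms(2,3)] assms(1)] by simp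

lemma PT_app3:
  assumes "PT (pair_enc e1 (pair_enc e2 e3)) e (\<lambda>Orc z. F Orc (fst z) (fst (snd z)) (snd (snd z)))"
    "PT E e1 a" "PT E e2 b" "PT E e3 d"
  shows "PT E e (\<lambda>Orc c. F Orc (a Orc c) (b Orc c) (d Orc c))"
  using PT_comp[OF PT_Pair[OF assms(2) PT_Pair[OF assms(3,4)]] assms(1)] by simp

lemma PT_app4:
  assumes "PT (pair_enc e1 (pair_enc e2 (pair_enc e3 e4))) e
      (\<lambda>Orc z. F Orc (fst z) (fst (snd z)) (fst (snd (snd z))) (snd (snd (snd z))))"
    "PT E e1 a" "PT E e2 b" "PT E e3 d" "PT E e4 h"
  shows "PT E e (\<lambda>Orc c. F Orc (a Orc c) (b Orc c) (d Orc c) (h Orc c))"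
  using PT_comp[OF PT_Pair[OF assms(2) PT_Pair[OF assms(3) PT_Pair[OF assms(4,5)]]] assms(1)] by simp

lemma PT_app5:
  assumes "PT (pair_enc e1 (pair_enc e2 (pair_enc e3 (pair_enc e4 e5)))) e
      (\<lambda>Orc z. F Orc (fst z) (fst (snd z)) (fst (snd (snd z))) (fst (snd (snd (snd z)))) (snd (snd (snd (snd z)))))"
    "PT E e1 a" "PT E e2 b" "PT E e3 d" "PT E e4 h" "PT E e5 i"
  shows "PT E e (\<lambda>Orc c. F Orc (a Orc c) (b Orc c) (d Orc c) (h Orc c) (i Orc c))"
  using PT_comp[OF PT_Pair[OF assms(2) PT_Pair[OF assms(3) PT_Pair[OF assms(4) PT_Pair[OF assms(5,6)]]]] assms(1)]
  by simp

lemmas PT_rules = PT_id PT_fst PT_snd PT_Pair PT_Num PT_bool PT_Nil PT_Cons PT_add PT_sub PT_mult PT_div PT_mod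
  PT_less PT_le PT_eq PT_bool_eq PT_conj PT_not PT_If PT_append PT_map PT_concat PT_list_all PT_notin
  PT_length PT_nth PT_upt UB_const UB_add UB_mult UB_sub UB_length


section \<open>Arithmetic of the finite field\<close>

text \<open>
  The field is given by the pair of p and f. All operations are total and keep their results small
  also on arguments outside the carrier, so that no bound on a running time needs a validity
  hypothesis.
\<close>

abbreviation field_enc :: "nat \<times> nat list \<Rightarrow> val" where
  "field_enc \<equiv> pair_enc Num (enc_list Num)"

abbreviation elem_enc :: "elem \<Rightarrow> val" where
  "elem_enc \<equiv> enc_list Num"

text \<open>Since \<open>x mod 0 = x\<close>, the case p = 0 is caught separately; otherwise results
  could grow on invalid inputs.\<close>

definition gmod :: "nat \<times> nat list \<Rightarrow> nat \<Rightarrow> nat" where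
  "gmod K x = (if fst K = 0 then 0 else x mod fst K)"

definition gadd :: "nat \<times> nat list \<Rightarrow> elem \<Rightarrow> elem \<Rightarrow> elem" where
  "gadd K a b = map (\<lambda>i. gmod K (nth_default 0 a i + nth_default 0 b i)) [0..<length (snd K)]"

text \<open>The term \<open>fst K - gmod K y\<close> represents -y modulo p; reducing y first keeps
  the natural subtraction from being truncated.\<close>

definition gsub :: "nat \<times> nat list \<Rightarrow> elem \<Rightarrow> elem \<Rightarrow> elem" where
  "gsub K a b = map (\<lambda>i. gmod K (nth_default 0 a i + (fst K - gmod K (nth_default 0 b i)))) [0..<length (snd K)]"

definition gzero :: "nat \<times> nat list \<Rightarrow> elem" where
  "gzero K = map (\<lambda>i. 0) [0..<length (snd K)]"

definition gone :: "nat \<times> nat list \<Rightarrow> elem" where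
  "gone K = map (\<lambda>i. if i = 0 then 1 else 0) [0..<length (snd K)]"

text \<open>Multiplication by the residue class of x: the coefficients move up by one place and the
  overflowing x^m is replaced by -(f_0 + ... + f_(m-1) x^(m-1)).\<close>

definition gshift :: "nat \<times> nat list \<Rightarrow> elem \<Rightarrow> elem" where
  "gshift K a = map (\<lambda>i. gmod K ((if i = 0 then 0 else nth_default 0 a (i - 1)) +
     (fst K - gmod K (nth_default 0 a (length (snd K) - 1) * nth_default 0 (snd K) i)))) [0..<length (snd K)]"

definition gaddmul :: "nat \<times> nat list \<Rightarrow> elem \<Rightarrow> nat \<Rightarrow> elem \<Rightarrow> elem" where
  "gaddmul K a x b = map (\<lambda>i. gmod K (nth_default 0 a i + x * nth_default 0 b i)) [0..<length (snd K)]"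

text \<open>Horner's scheme in the first factor, with a reduction after every step so that neither
  degree nor coefficients grow.\<close>

definition gmul :: "nat \<times> nat list \<Rightarrow> elem \<Rightarrow> elem \<Rightarrow> elem" where
  "gmul K a b = foldr (\<lambda>x acc. gaddmul K (gshift K acc) x b) a (gzero K)"

definition gpow :: "nat \<times> nat list \<Rightarrow> elem \<Rightarrow> nat \<Rightarrow> elem" where
  "gpow K a n = foldr (\<lambda>b acc. if b then gmul K (gmul K acc acc) a else gmul K acc acc) (nat_bits n) (gone K)"

definition gord :: "nat \<times> nat list \<Rightarrow> nat" where
  "gord K = foldr (\<lambda>_ n. n * fst K) (snd K) 1"

text \<open>In a field with q elements the inverse of a nonzero a is a^(q-2), which saves a
  Euclidean algorithm for polynomials.\<close>

definition ginv :: "nat \<times> nat list \<Rightarrow> elem \<Rightarrow> elem" where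
  "ginv K a = gpow K a (gord K - 2)"

definition gnull :: "elem \<Rightarrow> bool" where
  "gnull a = list_all (\<lambda>x. x = 0) a"

text \<open>The bound depends on the field alone, hence is stable under iteration. The slack of 1 is
  for the entry 1 of \<open>gone\<close> when p = 0.\<close>

definition gsmall :: "nat \<times> nat list \<Rightarrow> elem \<Rightarrow> bool" where
  "gsmall K a \<longleftrightarrow> length a \<le> length (snd K) \<and> (\<forall>x\<in>set a. x \<le> fst K + 1)"

lemma gmod_le: "gmod K x \<le> fst K + 1"
  by (cases "fst K = 0") (auto simp: gmod_def intro: less_imp_le[OF less_SucI])

lemma gsmall_gadd: "gsmall K (gadd K a b)"
  and gsmall_gsub: "gsmall K (gsub K a b)"
  and gsmall_gzero: "gsmall K (gzero K)"
  and gsmall_gone: "gsmall K (gone K)"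
  and gsmall_gaddmul: "gsmall K (gaddmul K a x b)"
  by (auto simp: gsmall_def gadd_def gsub_def gzero_def gone_def gaddmul_def intro: gmod_le[simplified])

lemma gsmall_gmul: "gsmall K (gmul K a b)"
  by (cases a) (simp_all add: gmul_def gsmall_gzero gsmall_gaddmul)

lemma vsize_gsmall:
  assumes "gsmall K a"
  shows "vsize (elem_enc a) \<le> 1 + vsize (field_enc K) * (3 + vsize (field_enc K))"
proof -
  have "floorlog 2 x \<le> vsize (field_enc K) + 1" if "x \<in> set a" for x
  proof -
    have "floorlog 2 x \<le> floorlog 2 (fst K + 1)" using assms that by (intro floorlog_mono) (auto simp: gsmall_def)
    also have "\<dots> \<le> floorlog 2 (fst K) + floorlog 2 1 + 1" by (rule floorlog_add)
    also have "\<dots> \<le> vsize (field_enc K) + 1"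
      using floorlog_le[of 1] by (simp add: pair_enc_def)
    finally show ?thesis .
  qed
  moreover have "length a \<le> vsize (field_enc K)"
    using assms length_le_vsize[of "snd K" Num] by (simp add: gsmall_def pair_enc_def)
  ultimately have "vsize (elem_enc a) \<le> 1 + vsize (field_enc K) * (1 + (2 + vsize (field_enc K)))"
    by (intro vsize_enc_list_le) auto
  then show ?thesis by (simp add: algebra_simps)
qed

lemma gsmall_bound:
  assumes "PT E field_enc K"
  shows "\<exists>g. pb g \<and> (\<forall>Orc c a. gsmall (K Orc c) a \<longrightarrow> vsize (elem_enc a) \<le> g (vsize (E c)))"
proof -
  obtain g where g: "pb g" "\<And>Orc c. vsize (field_enc (K Orc c)) \<le> g (vsize (E c))"
    using PT_size[OF assms] by blast
  have "vsize (elem_enc a) \<le> 1 + g (vsize (E c)) * (3 + g (vsize (E c)))" if "gsmall (K Orc c) a" for Orc c a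
    using vsize_gsmall[OF that] mult_mono[OF g(2)[of Orc c] add_left_mono[OF g(2)[of Orc c], of 3]] by linarith
  then show ?thesis
    by (intro exI[of _ "\<lambda>s. 1 + g s * (3 + g s)"] conjI pb_intros g(1)) blast
qed

lemma PT_gmod': "PT (pair_enc field_enc Num) Num (\<lambda>Orc z. gmod (fst z) (snd z))"
  unfolding gmod_def by (rule PT_rules)+

lemmas PT_gmod = PT_app2[where F = "\<lambda>_. gmod", OF PT_gmod']

lemma PT_gadd': "PT (pair_enc field_enc (pair_enc elem_enc elem_enc)) elem_enc
    (\<lambda>Orc z. gadd (fst z) (fst (snd z)) (snd (snd z)))"
  unfolding gadd_def by (rule PT_rules PT_gmod)+

lemmas PT_gadd = PT_app3[where F = "\<lambda>_. gadd", OF PT_gadd']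

lemma PT_gsub': "PT (pair_enc field_enc (pair_enc elem_enc elem_enc)) elem_enc
    (\<lambda>Orc z. gsub (fst z) (fst (snd z)) (snd (snd z)))"
  unfolding gsub_def by (rule PT_rules PT_gmod)+

lemmas PT_gsub = PT_app3[where F = "\<lambda>_. gsub", OF PT_gsub']

lemma PT_gzero: assumes "PT E field_enc K" shows "PT E elem_enc (\<lambda>Orc c. gzero (K Orc c))"
proof (rule PT_comp[OF assms])
  show "PT field_enc elem_enc (\<lambda>Orc. gzero)"
    unfolding gzero_def[abs_def] by (rule PT_rules)+
qed

lemma PT_gone: assumes "PT E field_enc K" shows "PT E elem_enc (\<lambda>Orc c. gone (K Orc c))"
proof (rule PT_comp[OF assms])
  show "PT field_enc elem_enc (\<lambda>Orc. gone)"
    unfolding gone_def[abs_def] by (rule PT_rules)+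
qed

lemma PT_gshift': "PT (pair_enc field_enc elem_enc) elem_enc (\<lambda>Orc z. gshift (fst z) (snd z))"
  unfolding gshift_def by (rule PT_rules PT_gmod)+

lemmas PT_gshift = PT_app2[where F = "\<lambda>_. gshift", OF PT_gshift']

lemma PT_gaddmul': "PT (pair_enc field_enc (pair_enc elem_enc (pair_enc Num elem_enc))) elem_enc
    (\<lambda>Orc z. gaddmul (fst z) (fst (snd z)) (fst (snd (snd z))) (snd (snd (snd z))))"
  unfolding gaddmul_def by (rule PT_rules PT_gmod)+

lemmas PT_gaddmul = PT_app4[where F = "\<lambda>_. gaddmul", OF PT_gaddmul']

lemma PT_gmul': "PT (pair_enc field_enc (pair_enc elem_enc elem_enc)) elem_enc
    (\<lambda>Orc z. gmul (fst z) (fst (snd z)) (snd (snd z)))" (is "PT ?E _ _")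
  unfolding gmul_def
proof (rule PT_foldr)
  obtain g where g: "pb g" "\<And>Orc c a. gsmall (fst c) a \<longrightarrow> vsize (elem_enc a) \<le> g (vsize (?E c))"
    using gsmall_bound[OF PT_fst[OF PT_id], of "pair_enc elem_enc elem_enc"] by blast
  have "gsmall (fst c) (foldr (\<lambda>x acc. gaddmul (fst c) (gshift (fst c) acc) x b) zs (gzero (fst c)))"
    for c :: "(nat \<times> nat list) \<times> elem \<times> elem" and zs b
    by (cases zs) (simp_all add: gsmall_gzero gsmall_gaddmul)
  then show "\<exists>g. pb g \<and> (\<forall>Orc c ys zs. fst (snd c) = ys @ zs \<longrightarrow>
      vsize (elem_enc (foldr (\<lambda>x acc. gaddmul (fst c) (gshift (fst c) acc) x (snd (snd c))) zs (gzero (fst c)))) \<le> g (vsize (?E c)))"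
    using g by blast
qed (rule PT_rules PT_gaddmul PT_gshift PT_gzero)+

lemmas PT_gmul = PT_app3[where F = "\<lambda>_. gmul", OF PT_gmul']

lemma PT_gpow': "PT (pair_enc field_enc (pair_enc elem_enc Num)) elem_enc
    (\<lambda>Orc z. gpow (fst z) (fst (snd z)) (snd (snd z)))" (is "PT ?E _ _")
  unfolding gpow_def
proof (rule PT_foldr)
  obtain g where g: "pb g" "\<And>Orc c a. gsmall (fst c) a \<longrightarrow> vsize (elem_enc a) \<le> g (vsize (?E c))"
    using gsmall_bound[OF PT_fst[OF PT_id], of "pair_enc elem_enc Num"] by blast
  have "gsmall (fst c) (foldr (\<lambda>b acc. if b then gmul (fst c) (gmul (fst c) acc acc) (fst (snd c))
      else gmul (fst c) acc acc) zs (gone (fst c)))"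
    for c :: "(nat \<times> nat list) \<times> elem \<times> nat" and zs
    by (cases zs) (simp_all add: gsmall_gone gsmall_gmul)
  then show "\<exists>g. pb g \<and> (\<forall>Orc c ys zs. nat_bits (snd (snd c)) = ys @ zs \<longrightarrow>
      vsize (elem_enc (foldr (\<lambda>b acc. if b then gmul (fst c) (gmul (fst c) acc acc) (fst (snd c))
      else gmul (fst c) acc acc) zs (gone (fst c)))) \<le> g (vsize (?E c)))"
    using g by blast
qed (rule PT_rules PT_gmul PT_nat_bits PT_gone)+

lemmas PT_gpow = PT_app3[where F = "\<lambda>_. gpow", OF PT_gpow']

lemma gord_eq: "gord (p, f) = p ^ length f"
  unfolding gord_def fst_conv snd_conv by (induction f) auto

lemma floorlog_power_le: "floorlog 2 (a ^ n) \<le> n * floorlog 2 a + 1"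
proof (induction n)
  case 0
  show ?case using floorlog_le[of 1] by simp
next
  case (Suc n)
  then show ?case using floorlog_mult[of a "a ^ n"] by simp
qed

lemma PT_gord': "PT field_enc Num (\<lambda>Orc. gord)"
  unfolding gord_def[abs_def]
proof (rule PT_foldr)
  have "vsize (Num (foldr (\<lambda>_ n. n * fst c) zs 1)) \<le> 2 + vsize (field_enc c) * vsize (field_enc c)"
    if "snd c = ys @ zs" for c ys zs
  proof -
    have *: "foldr (\<lambda>_ n. n * fst c) zs 1 = fst c ^ length zs" by (induction zs) auto
    have "length zs * floorlog 2 (fst c) \<le> vsize (field_enc c) * vsize (field_enc c)"
      using length_le_vsize[of "snd c" Num] that by (intro mult_mono) (auto simp: pair_enc_def)
    then show ?thesis unfolding * using floorlog_power_le[of "fst c" "length zs"] by simp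
  qed
  then show "\<exists>g. pb g \<and> (\<forall>Orc c ys zs. snd c = ys @ zs \<longrightarrow>
      vsize (Num (foldr (\<lambda>_ n. n * fst c) zs 1)) \<le> g (vsize (field_enc c)))"
    by (intro exI[of _ "\<lambda>s. 2 + s * s"] conjI pb_intros) blast
qed (rule PT_rules)+

lemma PT_gord: "PT E field_enc K \<Longrightarrow> PT E Num (\<lambda>Orc c. gord (K Orc c))"
  by (erule PT_comp) (rule PT_gord')

lemma PT_ginv': "PT (pair_enc field_enc elem_enc) elem_enc (\<lambda>Orc z. ginv (fst z) (snd z))"
  unfolding ginv_def by (rule PT_rules PT_gpow PT_gord)+

lemmas PT_ginv = PT_app2[where F = "\<lambda>_. ginv", OF PT_ginv']

lemma PT_gnull: assumes "PT E elem_enc a" shows "PT E bool_enc (\<lambda>Orc c. gnull (a Orc c))"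
proof (rule PT_comp[OF assms])
  show "PT elem_enc bool_enc (\<lambda>Orc. gnull)"
    unfolding gnull_def[abs_def] by (rule PT_rules)+
qed

section \<open>The algorithm\<close>

abbreviation vec_enc :: "elem list \<Rightarrow> val" where
  "vec_enc \<equiv> enc_list elem_enc"

abbreviation mat_enc :: "elem list list \<Rightarrow> val" where
  "mat_enc \<equiv> enc_list vec_enc"

abbreviation inst_enc :: "(nat \<times> nat list) \<times> elem list list \<times> elem list list \<Rightarrow> val" where
  "inst_enc \<equiv> pair_enc field_enc (pair_enc mat_enc mat_enc)"

abbreviation basis_enc :: "(nat \<times> elem list) list \<Rightarrow> val" where
  "basis_enc \<equiv> enc_list (pair_enc Num vec_enc)"

lemma UB_If: assumes "UB E M" "UB E N" shows "UB E (\<lambda>Orc c. if P Orc c then M Orc c else N Orc c)"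
  by (rule UB_le[OF UB_add[OF assms]]) simp

text \<open>Proportionality as vanishing of all 2 by 2 minors. A zero column would pass this test
  against every column; the first conjunct makes the zero columns a class of their own.\<close>

definition gparallel :: "nat \<times> nat list \<Rightarrow> elem list \<Rightarrow> elem list \<Rightarrow> bool" where
  "gparallel K u v \<longleftrightarrow> list_all gnull u = list_all gnull v \<and>
     list_all (\<lambda>a. list_all (\<lambda>b. gnull (gsub K
         (gmul K (nth_default [] u a) (nth_default [] v b)) (gmul K (nth_default [] u b) (nth_default [] v a))))
       [0..<length u]) [0..<length u]"

text \<open>
  Only the last column of each class of parallel columns gets a weight. The weights are distinct
  multiples of a number exceeding the size of every class.
\<close>

definition gweight :: "nat \<times> nat list \<Rightarrow> elem list list \<Rightarrow> nat \<Rightarrow> nat" where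
  "gweight K F l = (if list_all (\<lambda>m. \<not> (l < m \<and> gparallel K (nth_default [] F l) (nth_default [] F m))) [0..<length F]
     then (length F + 1) * (length F - l) else 0)"

text \<open>The weights are taken from F whichever matrix A is extended, so both codes of a query
  grow by the same number of columns. For A = F the list \<open>js\<close> is i, ..., n - 1.\<close>

definition gextend :: "nat \<times> nat list \<Rightarrow> elem list list \<Rightarrow> nat \<Rightarrow> elem list list \<Rightarrow> nat list \<Rightarrow> elem list list" where
  "gextend K F i A js = A @ concat (map (\<lambda>l. map (\<lambda>_. nth_default [] A (nth_default 0 js (l - i)))
     [0..<(if l < i then 0 else gweight K F l)]) [0..<length F])"

text \<open>The list \<open>js\<close> holds the columns of G matched with the columns of F after the i-th one.\<close>

definition gtest :: "(val \<Rightarrow> bool) \<Rightarrow> nat \<times> nat list \<Rightarrow> elem list list \<Rightarrow> elem list list \<Rightarrow> nat \<Rightarrow> nat list \<Rightarrow> nat \<Rightarrow> bool" where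
  "gtest Orc K F G i js j \<longleftrightarrow> j \<notin> set js \<and>
     list_all (\<lambda>l. \<not> (i < l \<and> \<not> (gparallel K (nth_default [] F l) (nth_default [] F i) =
       gparallel K (nth_default [] G (nth_default 0 js (l - i - 1))) (nth_default [] G j)))) [0..<length F] \<and>
     Orc (inst_enc (K, gextend K F i G (j # js), gextend K F i F (map (\<lambda>l. l + i) [0..<length F - i])))"

text \<open>The fallback 0 does not arise for equivalent codes as long as the matching so far agrees
  with an equivalence: the partner of column i under it passes the test.\<close>

definition gfind :: "(val \<Rightarrow> bool) \<Rightarrow> nat \<times> nat list \<Rightarrow> elem list list \<Rightarrow> elem list list \<Rightarrow> nat \<Rightarrow> nat list \<Rightarrow> nat" where
  "gfind Orc K F G i js = foldr (\<lambda>j r. if gtest Orc K F G i js j then j else r) [0..<length F] 0"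

text \<open>\<open>foldr\<close> visits the last column first, so the accumulated list is always a
  matching of a final segment of the columns.\<close>

definition gmatch :: "(val \<Rightarrow> bool) \<Rightarrow> nat \<times> nat list \<Rightarrow> elem list list \<Rightarrow> elem list list \<Rightarrow> nat list" where
  "gmatch Orc K F G = foldr (\<lambda>i js. gfind Orc K F G i js # js) [0..<length F] []"

definition gdot :: "nat \<times> nat list \<Rightarrow> elem list \<Rightarrow> elem list \<Rightarrow> elem" where
  "gdot K u v = foldr (\<lambda>s acc. gadd K (gmul K (nth_default [] u s) (nth_default [] v s)) acc) [0..<length u] (gzero K)"

definition gelim :: "nat \<times> nat list \<Rightarrow> elem list \<Rightarrow> elem list \<Rightarrow> elem list \<Rightarrow> elem list" where
  "gelim K l w v = map (\<lambda>s. gsub K (nth_default [] v s)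
     (gmul K (gmul K (gdot K l v) (ginv K (gdot K l w))) (nth_default [] w s))) [0..<length v]"

text \<open>The first component is an optional pivot, coded as a list of length at most 1. As
  \<open>foldr\<close> starts at the end, the pivot is the last vector with nonzero value under l,
  for increasing tags the one with the largest tag. It is dropped; the vectors before it are
  corrected by multiples of it, those behind it already satisfy l.\<close>

definition gpivot :: "nat \<times> nat list \<Rightarrow> elem list \<Rightarrow> (nat \<times> elem list) list \<Rightarrow> elem list list \<times> (nat \<times> elem list) list" where
  "gpivot K l V = foldr (\<lambda>tv st. if length (fst st) = 0
     then (if gnull (gdot K l (snd tv)) then ([], tv # snd st) else ([snd tv], snd st))
     else (fst st, (fst tv, gelim K l (nth_default [] (fst st) 0) (snd tv)) # snd st)) V ([], [])"

text \<open>Elimination one equation at a time: the current list is a basis of the solutions of the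
  equations treated so far, and each new equation removes at most one vector. The tag of a vector is
  a coordinate where it is 1 and the others are 0.\<close>

definition gkernel :: "nat \<times> nat list \<Rightarrow> elem list list \<Rightarrow> (nat \<times> elem list) list \<Rightarrow> (nat \<times> elem list) list" where
  "gkernel K eqs V = foldr (\<lambda>l V. snd (gpivot K l V)) eqs V"

definition gsum :: "nat \<times> nat list \<Rightarrow> nat \<Rightarrow> (nat \<times> elem list) list \<Rightarrow> elem list" where
  "gsum K m V = map (\<lambda>s. foldr (\<lambda>tv acc. gadd K (nth_default [] (snd tv) s) acc) V (gzero K)) [0..<m]"

definition gunits :: "nat \<times> nat list \<Rightarrow> nat \<Rightarrow> (nat \<times> elem list) list" where
  "gunits K m = map (\<lambda>t. (t, map (\<lambda>s. if s = t then gone K else gzero K) [0..<m])) [0..<m]"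

definition gheight :: "elem list list \<Rightarrow> nat" where
  "gheight F = length (nth_default [] F 0)"

text \<open>
  The linear system S G = F diag(d), with the unknowns d followed by the columns of S.
\<close>

definition gequations :: "nat \<times> nat list \<Rightarrow> elem list list \<Rightarrow> elem list list \<Rightarrow> elem list list" where
  "gequations K F G = concat (map (\<lambda>i. map (\<lambda>j. map (\<lambda>s.
       if s < length F then (if s = j then gsub K (gzero K) (nth_default [] (nth_default [] F j) i) else gzero K)
       else (if (s - length F) mod gheight F = i
         then nth_default [] (nth_default [] G j) ((s - length F) div gheight F) else gzero K))
     [0..<length F + gheight F * gheight F]) [0..<length F]) [0..<gheight F])"

definition gsolution :: "nat \<times> nat list \<Rightarrow> elem list list \<Rightarrow> elem list list \<Rightarrow> elem list" where
  "gsolution K F G = gsum K (length F + gheight F * gheight F)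
     (gkernel K (gequations K F G) (gunits K (length F + gheight F * gheight F)))"

definition gselect :: "elem list list \<Rightarrow> nat list \<Rightarrow> elem list list" where
  "gselect G js = map (\<lambda>j. nth_default [] G j) js"

text \<open>Column by column, in agreement with the encoding of matrices and with the order of the
  unknowns in \<open>gequations\<close>.\<close>

definition gscaling :: "nat \<times> nat list \<Rightarrow> elem list list \<Rightarrow> elem list \<Rightarrow> elem list list" where
  "gscaling K F w = map (\<lambda>l. map (\<lambda>i. nth_default [] w (length F + l * gheight F + i)) [0..<gheight F]) [0..<gheight F]"

text \<open>The linear system has its diagonal matrix on the side of F, so the entries of D are the
  inverses of the computed ones.\<close>

definition gdiag :: "nat \<times> nat list \<Rightarrow> elem list list \<Rightarrow> elem list \<Rightarrow> elem list list" where
  "gdiag K F w = map (\<lambda>j. map (\<lambda>i. if i = j then ginv K (nth_default [] w j) else gzero K) [0..<length F]) [0..<length F]"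

definition gperm :: "nat \<times> nat list \<Rightarrow> elem list list \<Rightarrow> nat list \<Rightarrow> elem list list" where
  "gperm K F js = map (\<lambda>j. map (\<lambda>i. if i = nth_default 0 js j then gone K else gzero K) [0..<length F]) [0..<length F]"

definition gsolve :: "(val \<Rightarrow> bool) \<Rightarrow> nat \<times> nat list \<Rightarrow> elem list list \<Rightarrow> elem list list \<Rightarrow>
    elem list list \<times> elem list list \<times> elem list list" where
  "gsolve Orc K F G = (gscaling K F (gsolution K F (gselect G (gmatch Orc K F G))),
     gperm K F (gmatch Orc K F G), gdiag K F (gsolution K F (gselect G (gmatch Orc K F G))))"


section \<open>Running time of the algorithm\<close>

lemmas PT_field_rules = PT_gadd PT_gsub PT_gmul PT_ginv PT_gnull PT_gzero PT_gone

lemma PT_gparallel': "PT (pair_enc field_enc (pair_enc vec_enc vec_enc)) bool_enc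
    (\<lambda>Orc z. gparallel (fst z) (fst (snd z)) (snd (snd z)))"
  unfolding gparallel_def by (rule PT_rules PT_field_rules)+

lemmas PT_gparallel = PT_app3[where F = "\<lambda>_. gparallel", OF PT_gparallel']

lemma PT_gweight': "PT (pair_enc field_enc (pair_enc mat_enc Num)) Num
    (\<lambda>Orc z. gweight (fst z) (fst (snd z)) (snd (snd z)))"
  unfolding gweight_def by (rule PT_rules PT_gparallel)+

lemmas PT_gweight = PT_app3[where F = "\<lambda>_. gweight", OF PT_gweight']

text \<open>A weight is a number of repetitions, so it has to be polynomial in value and not just in
  bit length; it never exceeds (n + 1) n.\<close>

lemma UB_gweight:
  assumes "PT E (enc_list e) F" shows "UB E (\<lambda>Orc c. gweight (K Orc c) (F Orc c) (l Orc c))"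
proof (rule UB_le)
  show "UB E (\<lambda>Orc c. (length (F Orc c) + 1) * length (F Orc c))"
    by (rule UB_mult UB_add UB_const UB_length assms)+
  show "gweight (K Orc c) (F Orc c) (l Orc c) \<le> (length (F Orc c) + 1) * length (F Orc c)" for Orc c
    unfolding gweight_def by (auto intro: mult_le_mono2 simp del: mult_Suc)
qed

lemma PT_gextend': "PT (pair_enc field_enc (pair_enc mat_enc (pair_enc Num (pair_enc mat_enc (enc_list Num))))) mat_enc
    (\<lambda>Orc z. gextend (fst z) (fst (snd z)) (fst (snd (snd z))) (fst (snd (snd (snd z)))) (snd (snd (snd (snd z)))))"
  unfolding gextend_def by (rule PT_rules UB_If PT_gweight UB_gweight)+

lemmas PT_gextend = PT_app5[where F = "\<lambda>_. gextend", OF PT_gextend']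

lemma PT_gtest': "PT (pair_enc field_enc (pair_enc mat_enc (pair_enc mat_enc (pair_enc Num (pair_enc (enc_list Num) Num))))) bool_enc
    (\<lambda>Orc z. gtest Orc (fst z) (fst (snd z)) (fst (snd (snd z))) (fst (snd (snd (snd z))))
      (fst (snd (snd (snd (snd z))))) (snd (snd (snd (snd (snd z))))))"
  unfolding gtest_def by (rule PT_rules PT_oracle PT_gparallel PT_gextend)+

lemma PT_gtest:
  assumes "PT E field_enc K" "PT E mat_enc F" "PT E mat_enc G" "PT E Num i" "PT E (enc_list Num) js" "PT E Num j"
  shows "PT E bool_enc (\<lambda>Orc c. gtest Orc (K Orc c) (F Orc c) (G Orc c) (i Orc c) (js Orc c) (j Orc c))"
  using PT_comp[OF PT_Pair[OF assms(1) PT_Pair[OF assms(2) PT_Pair[OF assms(3) PT_Pair[OF assms(4) PT_Pair[OF assms(5,6)]]]]]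
      PT_gtest'] by simp

lemma foldr_find_le: "foldr (\<lambda>j r. if P j then j else r) xs (0::nat) \<in> insert 0 (set xs)"
  by (induction xs) auto

lemma gfind_le: "gfind Orc K F G i js \<le> length F"
  using foldr_find_le[of "gtest Orc K F G i js" "[0..<length F]"] by (auto simp: gfind_def)

lemma vsize_Num_le: "n \<le> m \<Longrightarrow> vsize (Num n) \<le> 1 + m"
  using floorlog_le[of n] by simp

lemma PT_gfind': "PT (pair_enc field_enc (pair_enc mat_enc (pair_enc mat_enc (pair_enc Num (enc_list Num))))) Num
    (\<lambda>Orc z. gfind Orc (fst z) (fst (snd z)) (fst (snd (snd z))) (fst (snd (snd (snd z)))) (snd (snd (snd (snd z)))))"
  (is "PT ?E _ _")
  unfolding gfind_def
proof (rule PT_foldr)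
  have "UB ?E (\<lambda>Orc c. length (fst (snd c)))"
    by (rule UB_length PT_fst PT_snd PT_id)+
  then obtain g where g: "pb g" "\<And>c. length (fst (snd c)) \<le> g (vsize (?E c))"
    unfolding UB_def by blast
  have "vsize (Num (foldr (\<lambda>j r. if P j then j else r) zs 0)) \<le> 1 + g (vsize (?E c))"
    if "[0..<length (fst (snd c))] = ys @ zs" for c ys zs P
  proof (rule vsize_Num_le)
    have "set zs \<subseteq> {..<length (fst (snd c))}"
      using arg_cong[OF that, of set] by auto
    then have "foldr (\<lambda>j r. if P j then j else r) zs 0 \<le> length (fst (snd c))"
      using foldr_find_le[of P zs] by (auto dest!: subsetD)
    then show "foldr (\<lambda>j r. if P j then j else r) zs 0 \<le> g (vsize (?E c))"
      using g(2)[of c] by simp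
  qed
  then show "\<exists>g. pb g \<and> (\<forall>Orc c ys zs. [0..<length (fst (snd c))] = ys @ zs \<longrightarrow>
      vsize (Num (foldr (\<lambda>j r. if gtest Orc (fst c) (fst (snd c)) (fst (snd (snd c)))
        (fst (snd (snd (snd c)))) (snd (snd (snd (snd c)))) j then j else r) zs 0)) \<le> g (vsize (?E c)))"
    by (intro exI[of _ "\<lambda>s. 1 + g s"] conjI pb_intros g(1)) blast
qed (rule PT_rules PT_gtest)+

lemmas PT_gfind = PT_app5[where F = gfind, OF PT_gfind']

lemma PT_gmatch': "PT (pair_enc field_enc (pair_enc mat_enc mat_enc)) (enc_list Num)
    (\<lambda>Orc z. gmatch Orc (fst z) (fst (snd z)) (snd (snd z)))" (is "PT ?E _ _")
  unfolding gmatch_def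
proof (rule PT_foldr)
  have "UB ?E (\<lambda>Orc c. length (fst (snd c)))"
    by (rule UB_length PT_fst PT_snd PT_id)+
  then obtain g where g: "pb g" "\<And>c. length (fst (snd c)) \<le> g (vsize (?E c))"
    unfolding UB_def by blast
  have "vsize (enc_list Num (foldr (\<lambda>i js. gfind Orc (fst c) (fst (snd c)) (snd (snd c)) i js # js) zs []))
      \<le> 1 + g (vsize (?E c)) * (1 + (1 + g (vsize (?E c))))"
    if "[0..<length (fst (snd c))] = ys @ zs" for Orc c ys zs
  proof (rule vsize_enc_list_le)
    let ?f = "\<lambda>i js. gfind Orc (fst c) (fst (snd c)) (snd (snd c)) i js # js"
    have "length (foldr ?f zs []) = length zs" by (induction zs) auto
    also have "\<dots> \<le> length (fst (snd c))" using arg_cong[OF that, of length] by simp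
    also have "\<dots> \<le> g (vsize (?E c))" by (rule g(2))
    finally show "length (foldr ?f zs []) \<le> g (vsize (?E c))" .
    fix j assume "j \<in> set (foldr ?f zs [])"
    then have "j \<le> length (fst (snd c))" by (induction zs) (auto intro: gfind_le)
    then show "vsize (Num j) \<le> 1 + g (vsize (?E c))"
      using g(2)[of c] by (intro vsize_Num_le) simp
  qed
  then show "\<exists>g. pb g \<and> (\<forall>Orc c ys zs. [0..<length (fst (snd c))] = ys @ zs \<longrightarrow>
      vsize (enc_list Num (foldr (\<lambda>i js. gfind Orc (fst c) (fst (snd c)) (snd (snd c)) i js # js) zs [])) \<le> g (vsize (?E c)))"
    by (intro exI[of _ "\<lambda>s. 1 + g s * (1 + (1 + g s))"] conjI pb_intros g(1)) blast
qed (rule PT_rules PT_gfind)+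

lemmas PT_gmatch = PT_app3[where F = gmatch, OF PT_gmatch']

lemma PT_foldr_gsmall:
  assumes "PT E field_enc K" "\<And>Orc c zs. gsmall (K Orc c) (foldr (h Orc c) zs (s0 Orc c))"
    "PT (pair_enc E (pair_enc ex elem_enc)) elem_enc (\<lambda>Orc z. h Orc (fst z) (fst (snd z)) (snd (snd z)))"
    "PT E (enc_list ex) xs" "PT E elem_enc s0"
  shows "PT E elem_enc (\<lambda>Orc c. foldr (h Orc c) (xs Orc c) (s0 Orc c))"
  using gsmall_bound[OF assms(1)] assms(2) by (intro PT_foldr[OF assms(3-5)]) blast

lemma gsmall_foldr_gadd: "gsmall K (foldr (\<lambda>x acc. gadd K (h x) acc) xs (gzero K))"
  by (cases xs) (auto simp: gsmall_gzero gsmall_gadd)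

lemma PT_gdot': "PT (pair_enc field_enc (pair_enc vec_enc vec_enc)) elem_enc
    (\<lambda>Orc z. gdot (fst z) (fst (snd z)) (snd (snd z)))"
  unfolding gdot_def
  by (rule PT_foldr_gsmall[OF PT_fst[OF PT_id] gsmall_foldr_gadd]; (rule PT_rules PT_field_rules)+)

lemmas PT_gdot = PT_app3[where F = "\<lambda>_. gdot", OF PT_gdot']

lemma PT_gelim': "PT (pair_enc field_enc (pair_enc vec_enc (pair_enc vec_enc vec_enc))) vec_enc
    (\<lambda>Orc z. gelim (fst z) (fst (snd z)) (fst (snd (snd z))) (snd (snd (snd z))))"
  unfolding gelim_def by (rule PT_rules PT_field_rules PT_gdot)+

lemmas PT_gelim = PT_app4[where F = "\<lambda>_. gelim", OF PT_gelim']

text \<open>During elimination an entry is either an untouched input, of size at most b, or the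
  result of a field operation, which is small whatever its operands were. So the sizes do not grow
  from step to step, even on invalid inputs.\<close>

definition vec_small :: "nat \<times> nat list \<Rightarrow> nat \<Rightarrow> elem list \<Rightarrow> bool" where
  "vec_small K b v \<longleftrightarrow> length v \<le> b \<and> (\<forall>a\<in>set v. gsmall K a \<or> vsize (elem_enc a) \<le> b)"

definition basis_small :: "nat \<times> nat list \<Rightarrow> nat \<Rightarrow> (nat \<times> elem list) list \<Rightarrow> bool" where
  "basis_small K b V \<longleftrightarrow> length V \<le> b \<and> (\<forall>tv\<in>set V. vsize (Num (fst tv)) \<le> b \<and> vec_small K b (snd tv))"

lemma vsize_vec_small:
  assumes "vec_small K b v" "\<And>a. gsmall K a \<Longrightarrow> vsize (elem_enc a) \<le> g"
  shows "vsize (vec_enc v) \<le> 1 + b * (1 + (b + g))"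
  using assms by (intro vsize_enc_list_le) (fastforce simp: vec_small_def)+

lemma vsize_basis_small:
  assumes "basis_small K b V" "\<And>a. gsmall K a \<Longrightarrow> vsize (elem_enc a) \<le> g"
  shows "vsize (basis_enc V) \<le> 1 + b * (1 + (1 + b + (1 + b * (1 + (b + g)))))"
proof (rule vsize_enc_list_le)
  fix tv assume "tv \<in> set V"
  then have "vec_small K b (snd tv)" "vsize (Num (fst tv)) \<le> b"
    using assms(1) by (auto simp: basis_small_def)
  moreover from this(1) have "vsize (vec_enc (snd tv)) \<le> 1 + b * (1 + (b + g))"
    using assms(2) by (rule vsize_vec_small)
  ultimately show "vsize (pair_enc Num vec_enc tv) \<le> 1 + b + (1 + b * (1 + (b + g)))"
    unfolding pair_enc_def by simp
qed (use assms(1) in \<open>simp add: basis_small_def\<close>)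

lemma basis_small_self: "basis_small K (vsize (basis_enc V)) V"
  unfolding basis_small_def vec_small_def
proof (intro conjI ballI disjI2)
  show "length V \<le> vsize (basis_enc V)"
    using length_le_vsize[of V "pair_enc Num vec_enc"] by simp
  fix tv assume tv: "tv \<in> set V"
  have *: "vsize (Num (fst tv)) + vsize (vec_enc (snd tv)) \<le> vsize (basis_enc V)"
    using vsize_mem_le[OF tv, of "pair_enc Num vec_enc"] by (simp add: pair_enc_def)
  then show "vsize (Num (fst tv)) \<le> vsize (basis_enc V)" by simp
  show "length (snd tv) \<le> vsize (basis_enc V)"
    using * length_le_vsize[of "snd tv" elem_enc] by simp
  fix a assume "a \<in> set (snd tv)"
  then show "vsize (elem_enc a) \<le> vsize (basis_enc V)"
    using * vsize_mem_le[of a "snd tv" elem_enc] by simp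
qed

lemma vec_small_gelim: "vec_small K b v \<Longrightarrow> vec_small K b (gelim K l w v)"
  by (auto simp: vec_small_def gelim_def gsmall_gsub)

lemma gpivot_Nil: "gpivot K l [] = ([], [])"
  by (simp add: gpivot_def)

lemma gpivot_Cons: "gpivot K l (tv # V) = (if length (fst (gpivot K l V)) = 0
     then (if gnull (gdot K l (snd tv)) then ([], tv # snd (gpivot K l V)) else ([snd tv], snd (gpivot K l V)))
     else (fst (gpivot K l V), (fst tv, gelim K l (nth_default [] (fst (gpivot K l V)) 0) (snd tv)) # snd (gpivot K l V)))"
  by (simp add: gpivot_def)

lemma gpivot_small:
  assumes "basis_small K b V"
  shows "length (fst (gpivot K l V)) \<le> 1 \<and> (\<forall>v\<in>set (fst (gpivot K l V)). vec_small K b v) \<and>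
    basis_small K b (snd (gpivot K l V)) \<and> length (snd (gpivot K l V)) \<le> length V"
  using assms
proof (induction V)
  case (Cons tv V)
  obtain vs W where st: "gpivot K l V = (vs, W)" by (rule prod.exhaust)
  have "basis_small K b V" using Cons.prems by (simp add: basis_small_def)
  then have IH: "length vs \<le> 1" "\<forall>v\<in>set vs. vec_small K b v" "basis_small K b W" "length W \<le> length V"
    using Cons.IH st by simp_all
  have b: "vsize (Num (fst tv)) \<le> b" "vec_small K b (snd tv)" "Suc (length V) \<le> b"
    using Cons.prems by (auto simp: basis_small_def)
  have W: "basis_small K b ((fst tv, v) # W)" if "vec_small K b v" for v
    using IH(3,4) b that by (simp add: basis_small_def)
  show ?case
    unfolding gpivot_Cons st fst_conv snd_conv
    using IH W[OF b(2)] W[OF vec_small_gelim[OF b(2)]] b by simp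
qed (simp add: gpivot_Nil basis_small_def)

lemma PT_gpivot': "PT (pair_enc field_enc (pair_enc vec_enc basis_enc)) (pair_enc mat_enc basis_enc)
    (\<lambda>Orc z. gpivot (fst z) (fst (snd z)) (snd (snd z)))" (is "PT ?E _ _")
  unfolding gpivot_def
proof (rule PT_foldr)
  obtain g where g: "pb g" "\<And>c a. gsmall (fst c) a \<Longrightarrow> vsize (elem_enc a) \<le> g (vsize (?E c))"
    using gsmall_bound[OF PT_fst[OF PT_id], of "pair_enc vec_enc basis_enc"] by blast
  let ?B = "\<lambda>s. 2 + (1 + s * (1 + (s + g s))) + (1 + s * (1 + (1 + s + (1 + s * (1 + (s + g s))))))"
  have *: "vsize (pair_enc mat_enc basis_enc (gpivot (fst c) (fst (snd c)) zs)) \<le> 1 + ?B (vsize (?E c))"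
    if "snd (snd c) = ys @ zs" for c ys zs
  proof -
    let ?s = "vsize (?E c)" and ?st = "gpivot (fst c) (fst (snd c)) zs"
    have "vsize (basis_enc (snd (snd c))) \<le> ?s" by (simp add: pair_enc_def)
    then have "basis_small (fst c) ?s (snd (snd c))"
      using basis_small_self[of "fst c" "snd (snd c)"] order_trans
      unfolding basis_small_def vec_small_def by blast
    then have "basis_small (fst c) ?s zs"
      unfolding that by (auto simp: basis_small_def)
    from gpivot_small[OF this, of "fst (snd c)"]
    have 1: "length (fst ?st) \<le> 1" "\<And>v. v \<in> set (fst ?st) \<Longrightarrow> vec_small (fst c) ?s v" and 2: "basis_small (fst c) ?s (snd ?st)"
      by auto
    have "vsize (mat_enc (fst ?st)) \<le> 1 + 1 * (1 + (1 + ?s * (1 + (?s + g ?s))))"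
    proof (rule vsize_enc_list_le[OF 1(1)])
      fix v assume "v \<in> set (fst ?st)"
      from 1(2)[OF this] g(2) show "vsize (vec_enc v) \<le> 1 + ?s * (1 + (?s + g ?s))"
        by (rule vsize_vec_small)
    qed
    moreover have "vsize (basis_enc (snd ?st)) \<le> 1 + ?s * (1 + (1 + ?s + (1 + ?s * (1 + (?s + g ?s)))))"
      by (rule vsize_basis_small[OF 2 g(2)])
    ultimately show ?thesis unfolding pair_enc_def[of mat_enc] by simp
  qed
  show "\<exists>g. pb g \<and> (\<forall>Orc c ys zs. snd (snd c) = ys @ zs \<longrightarrow>
      vsize (pair_enc mat_enc basis_enc (foldr (\<lambda>tv st. if length (fst st) = 0
     then (if gnull (gdot (fst c) (fst (snd c)) (snd tv)) then ([], tv # snd st) else ([snd tv], snd st))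
     else (fst st, (fst tv, gelim (fst c) (fst (snd c)) (nth_default [] (fst st) 0) (snd tv)) # snd st)) zs ([], []))) \<le> g (vsize (?E c)))"
    by (intro exI[of _ "\<lambda>s. 1 + ?B s"] conjI pb_intros g(1) allI impI *[unfolded gpivot_def])
qed (rule PT_rules PT_field_rules PT_gdot PT_gelim)+

lemmas PT_gpivot = PT_app3[where F = "\<lambda>_. gpivot", OF PT_gpivot']

lemma PT_gkernel': "PT (pair_enc field_enc (pair_enc mat_enc basis_enc)) basis_enc
    (\<lambda>Orc z. gkernel (fst z) (fst (snd z)) (snd (snd z)))" (is "PT ?E _ _")
  unfolding gkernel_def
proof (rule PT_foldr)
  obtain g where g: "pb g" "\<And>c a. gsmall (fst c) a \<Longrightarrow> vsize (elem_enc a) \<le> g (vsize (?E c))"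
    using gsmall_bound[OF PT_fst[OF PT_id], of "pair_enc mat_enc basis_enc"] by blast
  let ?B = "\<lambda>s. 1 + s * (1 + (1 + s + (1 + s * (1 + (s + g s)))))"
  have *: "vsize (basis_enc (foldr (\<lambda>l V. snd (gpivot (fst c) l V)) zs (snd (snd c)))) \<le> ?B (vsize (?E c))" for c zs
  proof -
    let ?s = "vsize (?E c)"
    have "vsize (basis_enc (snd (snd c))) \<le> ?s" by (simp add: pair_enc_def)
    then have "basis_small (fst c) ?s (snd (snd c))"
      using basis_small_self[of "fst c" "snd (snd c)"] order_trans
      unfolding basis_small_def vec_small_def by blast
    then have "basis_small (fst c) ?s (foldr (\<lambda>l V. snd (gpivot (fst c) l V)) zs (snd (snd c)))"
      by (induction zs) (simp_all add: gpivot_small)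
    then show ?thesis by (rule vsize_basis_small[OF _ g(2)])
  qed
  show "\<exists>g. pb g \<and> (\<forall>Orc c ys zs. fst (snd c) = ys @ zs \<longrightarrow>
      vsize (basis_enc (foldr (\<lambda>l V. snd (gpivot (fst c) l V)) zs (snd (snd c)))) \<le> g (vsize (?E c)))"
    by (intro exI[of _ ?B] conjI pb_intros g(1) allI impI *)
qed (rule PT_rules PT_gpivot)+

lemmas PT_gkernel = PT_app3[where F = "\<lambda>_. gkernel", OF PT_gkernel']

text \<open>\<open>UB\<close> refers to the context in which m arises; as a bare input, m would be
  bounded in bit length only. The tuple version therefore takes the index range as a list.\<close>

lemma PT_gsum:
  assumes "PT E field_enc K" "PT E Num m" "UB E m" "PT E basis_enc V"
  shows "PT E vec_enc (\<lambda>Orc c. gsum (K Orc c) (m Orc c) (V Orc c))"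
proof -
  let ?e = "pair_enc field_enc (pair_enc (enc_list Num) basis_enc)"
  have "PT ?e vec_enc
      (\<lambda>Orc z. map (\<lambda>s. foldr (\<lambda>tv acc. gadd (fst z) (nth_default [] (snd tv) s) acc) (snd (snd z)) (gzero (fst z))) (fst (snd z)))"
    by (rule PT_map, rule PT_foldr_gsmall[OF PT_fst[OF PT_fst[OF PT_id]] gsmall_foldr_gadd];
      (rule PT_rules PT_field_rules)+)
  from PT_comp[OF PT_Pair[OF assms(1) PT_Pair[OF PT_upt[OF assms(2,3)] assms(4)]] this]
  show ?thesis unfolding gsum_def fst_conv snd_conv .
qed

lemma PT_gunits:
  assumes "PT E field_enc K" "PT E Num m" "UB E m"
  shows "PT E basis_enc (\<lambda>Orc c. gunits (K Orc c) (m Orc c))"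
proof -
  have "PT (pair_enc field_enc (enc_list Num)) basis_enc
      (\<lambda>Orc z. map (\<lambda>t. (t, map (\<lambda>s. if s = t then gone (fst z) else gzero (fst z)) (snd z))) (snd z))"
    by (rule PT_rules PT_field_rules)+
  from PT_comp[OF PT_Pair[OF assms(1) PT_upt[OF assms(2,3)]] this]
  show ?thesis unfolding gunits_def fst_conv snd_conv .
qed

lemma PT_gheight: "PT E mat_enc F \<Longrightarrow> PT E Num (\<lambda>Orc c. gheight (F Orc c))"
  unfolding gheight_def by (rule PT_length PT_nth PT_Nil PT_Num | assumption)+

lemma UB_gheight: "PT E mat_enc F \<Longrightarrow> UB E (\<lambda>Orc c. gheight (F Orc c))"
  unfolding gheight_def by (rule UB_length PT_nth PT_Nil PT_Num | assumption)+

lemma PT_gequations': "PT (pair_enc field_enc (pair_enc mat_enc mat_enc)) mat_enc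
    (\<lambda>Orc z. gequations (fst z) (fst (snd z)) (snd (snd z)))"
  unfolding gequations_def by (rule PT_rules PT_field_rules PT_gheight UB_gheight)+

lemmas PT_gequations = PT_app3[where F = "\<lambda>_. gequations", OF PT_gequations']

lemma PT_gsolution': "PT (pair_enc field_enc (pair_enc mat_enc mat_enc)) vec_enc
    (\<lambda>Orc z. gsolution (fst z) (fst (snd z)) (snd (snd z)))"
  unfolding gsolution_def
  by (rule PT_rules PT_gsum PT_gkernel PT_gunits PT_gequations PT_gheight UB_gheight)+

lemmas PT_gsolution = PT_app3[where F = "\<lambda>_. gsolution", OF PT_gsolution']

lemma PT_gscaling': "PT (pair_enc field_enc (pair_enc mat_enc vec_enc)) mat_enc
    (\<lambda>Orc z. gscaling (fst z) (fst (snd z)) (snd (snd z)))"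
  unfolding gscaling_def by (rule PT_rules PT_gheight UB_gheight)+

lemmas PT_gscaling = PT_app3[where F = "\<lambda>_. gscaling", OF PT_gscaling']

lemma PT_gdiag': "PT (pair_enc field_enc (pair_enc mat_enc vec_enc)) mat_enc
    (\<lambda>Orc z. gdiag (fst z) (fst (snd z)) (snd (snd z)))"
  unfolding gdiag_def by (rule PT_rules PT_field_rules)+

lemmas PT_gdiag = PT_app3[where F = "\<lambda>_. gdiag", OF PT_gdiag']

lemma PT_gperm': "PT (pair_enc field_enc (pair_enc mat_enc (enc_list Num))) mat_enc
    (\<lambda>Orc z. gperm (fst z) (fst (snd z)) (snd (snd z)))"
  unfolding gperm_def by (rule PT_rules PT_field_rules)+

lemmas PT_gperm = PT_app3[where F = "\<lambda>_. gperm", OF PT_gperm']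

lemma PT_gselect': "PT (pair_enc mat_enc (enc_list Num)) mat_enc (\<lambda>Orc z. gselect (fst z) (snd z))"
  unfolding gselect_def by (rule PT_rules)+

lemmas PT_gselect = PT_app2[where F = "\<lambda>_. gselect", OF PT_gselect']

lemma PT_gsolve: "PT inst_enc (pair_enc mat_enc (pair_enc mat_enc mat_enc))
    (\<lambda>Orc z. gsolve Orc (fst z) (fst (snd z)) (snd (snd z)))"
  unfolding gsolve_def by (rule PT_rules PT_gscaling PT_gsolution PT_gselect PT_gmatch PT_gperm PT_gdiag)+

section \<open>Correctness of the field arithmetic\<close>

lemma coeff_int_poly: "coeff (int_poly a) i = int (nth_default 0 a i)"
  by (auto simp: int_poly_def coeff_Poly_eq nth_default_def)

lemma coeff_gf_modulus: "coeff (gf_modulus f) i = (if i = length f then 1 else int (nth_default 0 f i))"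
  by (auto simp: gf_modulus_def coeff_int_poly nth_default_def)

lemma degree_gf_modulus: "degree (gf_modulus f) = length f"
proof (rule antisym)
  show "degree (gf_modulus f) \<le> length f"
    by (rule degree_le) (auto simp: coeff_gf_modulus nth_default_def)
  show "length f \<le> degree (gf_modulus f)"
    by (rule le_degree) (simp add: coeff_gf_modulus)
qed

lemma gf_modulus_nonzero: "gf_modulus f \<noteq> 0"
  using coeff_gf_modulus[of f "length f"] by auto

lemma pseudo_mod_gf_modulus:
  shows "\<exists>q. U = gf_modulus f * q + pseudo_mod U (gf_modulus f)"
    and "length f \<le> i \<Longrightarrow> coeff (pseudo_mod U (gf_modulus f)) i = 0"
proof -
  have lc: "coeff (gf_modulus f) (degree (gf_modulus f)) = 1"
    by (simp add: degree_gf_modulus coeff_gf_modulus)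
  obtain q where "pseudo_divmod U (gf_modulus f) = (q, pseudo_mod U (gf_modulus f))"
    by (cases "pseudo_divmod U (gf_modulus f)") (auto simp: pseudo_mod_def)
  from pseudo_divmod(1)[OF gf_modulus_nonzero this]
  show "\<exists>q. U = gf_modulus f * q + pseudo_mod U (gf_modulus f)"
    by (auto simp: lc)
  show "coeff (pseudo_mod U (gf_modulus f)) i = 0" if "length f \<le> i"
    using pseudo_mod(2)[OF gf_modulus_nonzero[of f], of U] that
    by (auto simp: degree_gf_modulus intro: coeff_eq_0)
qed

text \<open>Two candidate remainders differ by a multiple of the modulus; a nonzero multiple has
  degree at least \<open>length f\<close>, where both remainders have zero coefficients.\<close>

lemma pseudo_mod_gf_modulus_unique:
  assumes "U = gf_modulus f * q + r" "\<And>i. length f \<le> i \<Longrightarrow> coeff r i = 0"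
  shows "pseudo_mod U (gf_modulus f) = r"
proof (rule ccontr)
  let ?h = "gf_modulus f" and ?r = "pseudo_mod U (gf_modulus f)"
  assume ne: "?r \<noteq> r"
  obtain q' where q': "U = ?h * q' + ?r" using pseudo_mod_gf_modulus(1) by blast
  have eq: "?r - r = ?h * (q - q')" using assms(1) q' by (simp add: algebra_simps)
  then have "q - q' \<noteq> 0" using ne by auto
  have deg: "length f \<le> degree (?r - r)"
    unfolding eq degree_mult_eq[OF gf_modulus_nonzero \<open>q - q' \<noteq> 0\<close>] degree_gf_modulus by simp
  then have "coeff (?r - r) (degree (?r - r)) = 0"
    using assms(2) pseudo_mod_gf_modulus(2) by simp
  then show False using ne by (simp only: leading_coeff_0_iff right_minus_eq)
qed

lemma pseudo_mod_gf_modulus_add: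
  "pseudo_mod (U + V) (gf_modulus f) = pseudo_mod U (gf_modulus f) + pseudo_mod V (gf_modulus f)"
proof -
  obtain q q' where "U = gf_modulus f * q + pseudo_mod U (gf_modulus f)" "V = gf_modulus f * q' + pseudo_mod V (gf_modulus f)"
    using pseudo_mod_gf_modulus(1) by metis
  then have "U + V = gf_modulus f * (q + q') + (pseudo_mod U (gf_modulus f) + pseudo_mod V (gf_modulus f))"
    by (metis (no_types, opaque_lifting) add.assoc add.left_commute distrib_left)
  then show ?thesis by (rule pseudo_mod_gf_modulus_unique) (simp add: pseudo_mod_gf_modulus)
qed

lemma pseudo_mod_gf_modulus_small: "(\<And>i. length f \<le> i \<Longrightarrow> coeff U i = 0) \<Longrightarrow> pseudo_mod U (gf_modulus f) = U"
  by (rule pseudo_mod_gf_modulus_unique[where q = 0]) auto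

text \<open>If r is the remainder of U, then x r has degree at most m, and subtracting its
  coefficient at x^m times the monic modulus brings the degree below m. Over the integers this is
  what \<open>gshift\<close> does modulo p.\<close>

lemma pseudo_mod_gf_modulus_pCons:
  fixes U :: "int poly"
  assumes "f \<noteq> []"
  defines "r \<equiv> pseudo_mod U (gf_modulus f)"
  shows "pseudo_mod (pCons 0 U) (gf_modulus f) = pCons 0 r - smult (coeff r (length f - 1)) (gf_modulus f)"
proof -
  obtain q where "U = gf_modulus f * q + r"
    using pseudo_mod_gf_modulus(1) unfolding r_def by blast
  then have "pCons 0 U = gf_modulus f * (pCons 0 q + [:coeff r (length f - 1):])
      + (pCons 0 r - smult (coeff r (length f - 1)) (gf_modulus f))"
    by (simp add: algebra_simps)
  then show ?thesis
  proof (rule pseudo_mod_gf_modulus_unique)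
    fix i assume i: "length f \<le> i"
    show "coeff (pCons 0 r - smult (coeff r (length f - 1)) (gf_modulus f)) i = 0"
    proof (cases "i = length f")
      case True
      then show ?thesis using assms(1) by (simp add: coeff_gf_modulus coeff_pCons split: nat.split)
    next
      case False
      then show ?thesis
        using i pseudo_mod_gf_modulus(2)[of f "i - 1" U]
        by (auto simp: coeff_gf_modulus coeff_pCons nth_default_def r_def split: nat.split)
    qed
  qed
qed

text \<open>The product of \<open>GF\<close> as a function of an arbitrary integer polynomial,
  because the induction on the first factor leaves the carrier: a tail is too short.\<close>

definition residue_list :: "nat \<Rightarrow> nat list \<Rightarrow> int poly \<Rightarrow> nat list" where
  "residue_list p f U = map (\<lambda>i. nat (coeff (pseudo_mod U (gf_modulus f)) i mod int p)) [0..<length f]"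

lemma gshift_step_mod:
  assumes "0 < (p::nat)"
  shows "int (((((a + (p - (t * c) mod p)) mod p) + x * b) mod p)) = (x * b + (int a - int t * int c)) mod int p"
proof -
  have "int (p - (t * c) mod p) = int p - (int t * int c) mod int p"
    using assms by (simp add: of_nat_diff less_imp_le zmod_int)
  then have "int (((((a + (p - (t * c) mod p)) mod p) + x * b) mod p)) =
      (int a + (int p - (int t * int c) mod int p) + int x * int b) mod int p"
    by (simp only: zmod_int of_nat_add of_nat_mult mod_add_left_eq)
  also have "int a + (int p - (int t * int c) mod int p) + int x * int b =
      (x * b + (int a - int t * int c)) + int p * (1 + (int t * int c) div int p)"
    by (simp add: algebra_simps)
  finally show ?thesis by (simp only: mod_mult_self2 of_nat_mult)
qed

lemma nth_default_map_upt: "i < n \<Longrightarrow> nth_default d (map h [0..<n]) i = h i"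
  by (simp add: nth_default_def)

text \<open>Each Horner step is compared with the corresponding step of the remainder over the
  integers; coefficients need to agree only modulo p.\<close>

lemma gmul_residue_list:
  assumes p: "0 < p" and f: "f \<noteq> []" and b: "length b = length f"
  shows "gmul (p, f) a b = residue_list p f (int_poly a * int_poly b)"
proof (induction a)
  case Nil
  have "pseudo_mod 0 (gf_modulus f) = 0"
    by (rule pseudo_mod_gf_modulus_small) simp
  then show ?case by (simp add: gmul_def gzero_def residue_list_def int_poly_def)
next
  case (Cons x a)
  let ?W = "int_poly a * int_poly b" and ?m = "length f"
  define r where "r = pseudo_mod ?W (gf_modulus f)"
  define acc where "acc = gmul (p, f) a b"
  have acc: "acc = residue_list p f ?W" using Cons acc_def by simp
  have acc_nth: "int (nth_default 0 acc i) = coeff r i mod int p" if "i < ?m" for i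
    using that p by (simp add: acc residue_list_def nth_default_def r_def)
  have split: "int_poly (x # a) * int_poly b = smult (int x) (int_poly b) + pCons 0 ?W"
    by (simp add: int_poly_def mult_pCons_left)
  have "pseudo_mod (smult (int x) (int_poly b)) (gf_modulus f) = smult (int x) (int_poly b)"
    by (rule pseudo_mod_gf_modulus_small) (simp add: coeff_int_poly nth_default_def b)
  then have pm: "pseudo_mod (int_poly (x # a) * int_poly b) (gf_modulus f) =
      smult (int x) (int_poly b) + (pCons 0 r - smult (coeff r (?m - 1)) (gf_modulus f))"
    unfolding split pseudo_mod_gf_modulus_add r_def by (simp add: pseudo_mod_gf_modulus_pCons[OF f])
  have gmod: "gmod (p, f) y = y mod p" for y using p by (simp add: gmod_def)
  have entry: "nth_default 0 (gaddmul (p, f) (gshift (p, f) acc) x b) i =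
      nat (coeff (pseudo_mod (int_poly (x # a) * int_poly b) (gf_modulus f)) i mod int p)" if i: "i < ?m" for i
  proof -
    let ?s = "if i = 0 then 0 else nth_default 0 acc (i - 1)"
    have s: "int ?s mod int p = coeff (pCons 0 r) i mod int p"
      using acc_nth[of "i - 1"] i by (cases i) auto
    have t: "int (nth_default 0 acc (?m - 1)) mod int p = coeff r (?m - 1) mod int p"
      using acc_nth[of "?m - 1"] f by simp
    have c: "coeff (pseudo_mod (int_poly (x # a) * int_poly b) (gf_modulus f)) i =
        int x * int (nth_default 0 b i) + (coeff (pCons 0 r) i - coeff r (?m - 1) * int (nth_default 0 f i))"
      unfolding pm using i by (simp add: coeff_int_poly coeff_gf_modulus)
    have "int (nth_default 0 (gaddmul (p, f) (gshift (p, f) acc) x b) i) =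
        int (((((?s + (p - (nth_default 0 acc (?m - 1) * nth_default 0 f i) mod p)) mod p) + x * nth_default 0 b i) mod p))"
      unfolding gaddmul_def gshift_def snd_conv nth_default_map_upt[OF i] gmod by simp
    also have "\<dots> = (int x * int (nth_default 0 b i) + (int ?s - int (nth_default 0 acc (?m - 1)) * int (nth_default 0 f i))) mod int p"
      by (rule gshift_step_mod[OF p])
    also have "\<dots> = (int x * int (nth_default 0 b i) + (coeff (pCons 0 r) i - coeff r (?m - 1) * int (nth_default 0 f i))) mod int p"
      by (intro mod_add_cong mod_diff_cong mod_mult_cong refl s t)
    finally show ?thesis unfolding c by simp
  qed
  show ?case
  proof (rule nth_equalityI)
    show "length (gmul (p, f) (x # a) b) = length (residue_list p f (int_poly (x # a) * int_poly b))"
      by (simp add: gmul_def gaddmul_def residue_list_def)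
    fix i assume "i < length (gmul (p, f) (x # a) b)"
    then have i: "i < ?m" by (simp add: gmul_def gaddmul_def)
    have "gmul (p, f) (x # a) b ! i = nth_default 0 (gaddmul (p, f) (gshift (p, f) acc) x b) i"
      using i by (simp add: gmul_def acc_def gaddmul_def nth_default_def)
    then show "gmul (p, f) (x # a) b ! i = residue_list p f (int_poly (x # a) * int_poly b) ! i"
      unfolding entry[OF i] using i by (simp add: residue_list_def)
  qed
qed

locale gf =
  fixes p :: nat and f :: "nat list"
  assumes field_GF: "field (GF p f)"
begin

abbreviation "K \<equiv> (p, f)"
abbreviation "R \<equiv> GF p f"

sublocale R: field "GF p f" by (rule field_GF)

lemma carrier_iff: "a \<in> carrier R \<longleftrightarrow> length a = length f \<and> (\<forall>c\<in>set a. c < p)"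
  by (simp add: GF_def)

lemma f_nonempty: "f \<noteq> []"
proof
  assume "f = []"
  then have "\<one>\<^bsub>R\<^esub> = \<zero>\<^bsub>R\<^esub>" by (simp add: GF_def)
  then show False using R.one_not_zero by simp
qed

lemma p_gt_1: "1 < p"
proof -
  have "\<one>\<^bsub>R\<^esub> ! 0 < p"
    using R.one_closed f_nonempty unfolding carrier_iff by simp
  then show ?thesis using f_nonempty by (simp add: GF_def)
qed

lemma gmod_K [simp]: "gmod K x = x mod p"
  using p_gt_1 by (simp add: gmod_def)

lemma nth_default_carrier [simp]: "a \<in> carrier R \<Longrightarrow> i < length f \<Longrightarrow> nth_default 0 a i = a ! i"
  by (simp add: carrier_iff nth_default_def)

lemma gzero: "gzero K = \<zero>\<^bsub>R\<^esub>"
  by (simp add: gzero_def GF_def map_replicate_const)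

lemma gone: "gone K = \<one>\<^bsub>R\<^esub>"
  by (simp add: gone_def GF_def)

lemma gadd: "a \<in> carrier R \<Longrightarrow> b \<in> carrier R \<Longrightarrow> gadd K a b = a \<oplus>\<^bsub>R\<^esub> b"
  by (simp add: gadd_def) (simp add: GF_def nth_default_def)

lemma gmul: "a \<in> carrier R \<Longrightarrow> b \<in> carrier R \<Longrightarrow> gmul K a b = a \<otimes>\<^bsub>R\<^esub> b"
  using gmul_residue_list[of p f b a] p_gt_1 f_nonempty by (simp add: carrier_iff) (simp add: GF_def residue_list_def)

text \<open>Subtraction is recognised by adding b back, which avoids an explicit description of
  additive inverses in \<open>GF\<close>.\<close>

lemma gsub:
  assumes "a \<in> carrier R" "b \<in> carrier R"
  shows "gsub K a b = a \<ominus>\<^bsub>R\<^esub> b"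
proof -
  have c: "gsub K a b \<in> carrier R"
    using p_gt_1 by (auto simp: carrier_iff gsub_def)
  have "gsub K a b \<oplus>\<^bsub>R\<^esub> b = gadd K (gsub K a b) b"
    using gadd[OF c assms(2)] by simp
  also have "\<dots> = a"
  proof (rule nth_equalityI)
    fix i assume "i < length (gadd K (gsub K a b) b)"
    then have i: "i < length f" by (simp add: gadd_def)
    have "a ! i < p" "b ! i < p" using assms i by (auto simp: carrier_iff)
    then show "gadd K (gsub K a b) b ! i = a ! i"
      using i assms by (simp add: gadd_def gsub_def mod_simps nth_default_def[of _ "map _ _"])
  qed (use assms in \<open>simp add: gadd_def carrier_iff\<close>)
  finally have "gsub K a b \<oplus>\<^bsub>R\<^esub> b = a" .
  then show ?thesis
    using assms c by (metis R.add.inv_solve_right R.minus_eq)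
qed

lemma gnull: "a \<in> carrier R \<Longrightarrow> gnull a \<longleftrightarrow> a = \<zero>\<^bsub>R\<^esub>"
  by (auto simp: gnull_def list_all_iff carrier_iff GF_def replicate_eqI)

lemma gpow: "a \<in> carrier R \<Longrightarrow> gpow K a n = a [^]\<^bsub>R\<^esub> n"
proof (induction n rule: nat_bits.induct)
  case (1 n)
  show ?case
  proof (cases "n = 0")
    case True
    then show ?thesis by (simp add: gpow_def nat_bits.simps gone)
  next
    case False
    let ?k = "n div 2"
    have IH: "gpow K a ?k = a [^]\<^bsub>R\<^esub> ?k" using 1 False by simp
    have "gpow K a n = (if odd n then gmul K (gmul K (gpow K a ?k) (gpow K a ?k)) a else gmul K (gpow K a ?k) (gpow K a ?k))"
      using False by (simp add: gpow_def nat_bits.simps[of n])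
    also have "\<dots> = (if odd n then a [^]\<^bsub>R\<^esub> (?k + ?k) \<otimes>\<^bsub>R\<^esub> a else a [^]\<^bsub>R\<^esub> (?k + ?k))"
      unfolding IH using 1(2) by (simp add: gmul R.nat_pow_mult)
    also have "\<dots> = a [^]\<^bsub>R\<^esub> n"
    proof (cases "odd n")
      case True
      then have "n = Suc (?k + ?k)" by presburger
      then have "a [^]\<^bsub>R\<^esub> n = a [^]\<^bsub>R\<^esub> (?k + ?k) \<otimes>\<^bsub>R\<^esub> a" by (metis R.nat_pow_Suc)
      then show ?thesis using True by simp
    next
      case False
      then have "?k + ?k = n" by presburger
      then show ?thesis using False by simp
    qed
    finally show ?thesis .
  qed
qed

lemma carrier_eq_lists: "carrier R = {a. set a \<subseteq> {..<p} \<and> length a = length f}"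
  by (auto simp: GF_def)

lemma finite_carrier: "finite (carrier R)"
  unfolding carrier_eq_lists by (rule finite_lists_length_eq) simp

lemma card_carrier: "card (carrier R) = p ^ length f"
  unfolding carrier_eq_lists by (simp add: card_lists_length_eq)

lemma ginv_closed: "a \<in> carrier R \<Longrightarrow> ginv K a \<in> carrier R"
  by (simp add: ginv_def gpow)

lemma ginv:
  assumes "a \<in> carrier R" "a \<noteq> \<zero>\<^bsub>R\<^esub>"
  shows "ginv K a \<otimes>\<^bsub>R\<^esub> a = \<one>\<^bsub>R\<^esub>"
proof -
  have u: "a \<in> Units R" using assms R.field_Units by simp
  have "card (Units R) = p ^ length f - 1"
    unfolding R.field_Units using card_carrier finite_carrier R.zero_closed by (simp add: card_Diff_singleton)
  \<comment> \<open>This makes the natural subtraction in \<open>ginv\<close> exact: the successor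
    of q - 2 is q - 1, the order of the unit group.\<close>
  moreover have "2 \<le> p ^ length f"
    using self_le_power[of p "length f"] p_gt_1 f_nonempty by simp
  ultimately have "card (Units R) = Suc (gord K - 2)" by (simp add: gord_eq)
  then have "a [^]\<^bsub>R\<^esub> Suc (gord K - 2) = \<one>\<^bsub>R\<^esub>"
    using R.units_power_order_eq_one[OF R.finite_ring_finite_units[OF finite_carrier] u] by simp
  then show ?thesis using assms by (simp add: ginv_def gpow)
qed

end

section \<open>Matrices over a commutative ring\<close>

context cring
begin

lemma finsum_swap:
  assumes "finite A" "finite B" "\<And>i j. i \<in> A \<Longrightarrow> j \<in> B \<Longrightarrow> h i j \<in> carrier R"
  shows "(\<Oplus>i\<in>A. \<Oplus>j\<in>B. h i j) = (\<Oplus>j\<in>B. \<Oplus>i\<in>A. h i j)"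
  using assms(1,3)
proof (induction A)
  case empty
  then show ?case by simp
next
  case (insert a A)
  have "(\<Oplus>i\<in>insert a A. \<Oplus>j\<in>B. h i j) = (\<Oplus>j\<in>B. h a j) \<oplus> (\<Oplus>j\<in>B. \<Oplus>i\<in>A. h i j)"
    using insert by (subst finsum_insert) (auto intro!: finsum_closed)
  also have "\<dots> = (\<Oplus>j\<in>B. h a j \<oplus> (\<Oplus>i\<in>A. h i j))"
    using insert.prems by (subst finsum_addf) (auto intro!: finsum_closed)
  also have "\<dots> = (\<Oplus>j\<in>B. \<Oplus>i\<in>insert a A. h i j)"
    using insert by (intro finsum_cong') (auto intro!: finsum_closed simp: finsum_insert)
  finally show ?case .
qed

lemma matsD: "A \<in> mats R k n \<Longrightarrow> dim_row A = k \<and> dim_col A = n"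
  by (auto simp: mats_def)

lemma mats_closed: "A \<in> mats R k n \<Longrightarrow> i < k \<Longrightarrow> j < n \<Longrightarrow> A $$ (i, j) \<in> carrier R"
  by (auto simp: mats_def)

lemma mat_prod_index:
  "A \<in> mats R k l \<Longrightarrow> B \<in> mats R l n \<Longrightarrow> i < k \<Longrightarrow> j < n \<Longrightarrow>
    mat_prod R A B $$ (i, j) = (\<Oplus>s\<in>{..<l}. A $$ (i, s) \<otimes> B $$ (s, j))"
  using matsD[of A k l] matsD[of B l n] by (simp add: mat_prod_def)

lemma mat_prod_mats: "A \<in> mats R k l \<Longrightarrow> B \<in> mats R l n \<Longrightarrow> mat_prod R A B \<in> mats R k n"
  using matsD[of A k l] matsD[of B l n]
  by (auto simp: mats_def mat_prod_def intro!: finsum_closed)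

lemma mats_eqI:
  assumes "A \<in> mats R k n" "B \<in> mats R k n" "\<And>i j. i < k \<Longrightarrow> j < n \<Longrightarrow> A $$ (i, j) = B $$ (i, j)"
  shows "A = B"
  by (rule eq_matI) (use assms matsD in auto)

lemma mat_prod_assoc:
  assumes A: "A \<in> mats R k l" and B: "B \<in> mats R l m" and C: "C \<in> mats R m n"
  shows "mat_prod R (mat_prod R A B) C = mat_prod R A (mat_prod R B C)"
proof (rule mats_eqI)
  fix i j assume i: "i < k" and j: "j < n"
  have "mat_prod R (mat_prod R A B) C $$ (i, j) = (\<Oplus>t\<in>{..<m}. (\<Oplus>s\<in>{..<l}. A $$ (i, s) \<otimes> B $$ (s, t)) \<otimes> C $$ (t, j))"
    using mat_prod_index[OF mat_prod_mats[OF A B] C i j] mat_prod_index[OF A B i] mats_closed A B C i j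
    by (auto intro!: finsum_cong' finsum_closed m_closed)
  also have "\<dots> = (\<Oplus>t\<in>{..<m}. \<Oplus>s\<in>{..<l}. A $$ (i, s) \<otimes> B $$ (s, t) \<otimes> C $$ (t, j))"
    using mats_closed[OF A i] mats_closed[OF B] mats_closed[OF C _ j]
    by (intro finsum_cong') (auto intro!: finsum_closed finsum_ldistr)
  also have "\<dots> = (\<Oplus>s\<in>{..<l}. \<Oplus>t\<in>{..<m}. A $$ (i, s) \<otimes> B $$ (s, t) \<otimes> C $$ (t, j))"
    using mats_closed[OF A i] mats_closed[OF B] mats_closed[OF C _ j] by (intro finsum_swap) auto
  also have "\<dots> = (\<Oplus>s\<in>{..<l}. A $$ (i, s) \<otimes> (\<Oplus>t\<in>{..<m}. B $$ (s, t) \<otimes> C $$ (t, j)))"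
    using mats_closed[OF A i] mats_closed[OF B] mats_closed[OF C _ j]
    by (intro finsum_cong') (auto intro!: finsum_closed m_closed finsum_cong' simp: finsum_rdistr m_assoc)
  also have "\<dots> = mat_prod R A (mat_prod R B C) $$ (i, j)"
    using mat_prod_index[OF A mat_prod_mats[OF B C] i j] mat_prod_index[OF B C _ j]
      mats_closed[OF A i] mats_closed[OF B] mats_closed[OF C _ j]
    by (auto intro!: finsum_cong' finsum_closed m_closed)
  finally show "mat_prod R (mat_prod R A B) C $$ (i, j) = mat_prod R A (mat_prod R B C) $$ (i, j)" .
qed (use assms mat_prod_mats in blast)+

lemma mat_one_mats: "mat_one R k \<in> mats R k k"
  by (auto simp: mats_def mat_one_def)

lemma finsum_single:
  assumes "finite A" "i \<in> A" "h i \<in> carrier R" "\<And>j. j \<in> A \<Longrightarrow> j \<noteq> i \<Longrightarrow> h j = \<zero>"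
  shows "finsum R h A = h i"
proof -
  have "finsum R h A = (\<Oplus>j\<in>A. if i = j then h i else \<zero>)"
    using assms by (intro finsum_cong') auto
  also have "\<dots> = h i"
    using assms(1-3) finsum_singleton[of i A "\<lambda>_. h i"] by simp
  finally show ?thesis .
qed

lemma mat_prod_one_left: "A \<in> mats R k n \<Longrightarrow> mat_prod R (mat_one R k) A = A"
proof (rule mats_eqI[of _ k n])
  assume A: "A \<in> mats R k n"
  fix i j assume i: "i < k" and j: "j < n"
  have "(\<Oplus>s\<in>{..<k}. mat_one R k $$ (i, s) \<otimes> A $$ (s, j)) = mat_one R k $$ (i, i) \<otimes> A $$ (i, j)"
    using i j mats_closed[OF A] by (intro finsum_single) (auto simp: mat_one_def)
  then show "mat_prod R (mat_one R k) A $$ (i, j) = A $$ (i, j)"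
    unfolding mat_prod_index[OF mat_one_mats A i j] using i j mats_closed[OF A] by (simp add: mat_one_def)
qed (auto intro: mat_prod_mats mat_one_mats)

lemma mat_prod_one_right: "A \<in> mats R k n \<Longrightarrow> mat_prod R A (mat_one R n) = A"
proof (rule mats_eqI[of _ k n])
  assume A: "A \<in> mats R k n"
  fix i j assume i: "i < k" and j: "j < n"
  have "(\<Oplus>s\<in>{..<n}. A $$ (i, s) \<otimes> mat_one R n $$ (s, j)) = A $$ (i, j) \<otimes> mat_one R n $$ (j, j)"
    using i j mats_closed[OF A] by (intro finsum_single) (auto simp: mat_one_def)
  then show "mat_prod R A (mat_one R n) $$ (i, j) = A $$ (i, j)"
    unfolding mat_prod_index[OF A mat_one_mats i j] using i j mats_closed[OF A] by (simp add: mat_one_def)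
qed (auto intro: mat_prod_mats mat_one_mats)

lemma mat_prod_diag:
  assumes "A \<in> mats R k n" "D \<in> mats R n n" "\<And>i j. i < n \<Longrightarrow> j < n \<Longrightarrow> i \<noteq> j \<Longrightarrow> D $$ (i, j) = \<zero>" "i < k" "j < n"
  shows "mat_prod R A D $$ (i, j) = A $$ (i, j) \<otimes> D $$ (j, j)"
  unfolding mat_prod_index[OF assms(1,2,4,5)]
  using assms mats_closed by (intro finsum_single) auto

lemma mat_prod_perm:
  assumes "A \<in> mats R k n" "P \<in> perm_mats R n" "i < k" "j < n" "s < n" "P $$ (s, j) = \<one>"
  shows "mat_prod R A P $$ (i, j) = A $$ (i, s)"
proof -
  have P: "P \<in> mats R n n" using assms(2) by (simp add: perm_mats_def)
  have "P $$ (t, j) = \<zero>" if "t < n" "t \<noteq> s" for t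
    using assms(2,4-6) that unfolding perm_mats_def by blast
  then have "mat_prod R A P $$ (i, j) = A $$ (i, s) \<otimes> P $$ (s, j)"
    unfolding mat_prod_index[OF assms(1) P assms(3,4)]
    using assms P mats_closed by (intro finsum_single) auto
  then show ?thesis using assms mats_closed by simp
qed

section \<open>Row vectors, generator matrices and invertibility\<close>

lemma vec_mat_prod_vecs: "x \<in> vecs R k \<Longrightarrow> A \<in> mats R k n \<Longrightarrow> vec_mat_prod R x A \<in> vecs R n"
  using matsD[of A k n] by (auto simp: vecs_def mats_def vec_mat_prod_def intro!: finsum_closed)

text \<open>A vector is treated as a matrix with one row, so that associativity is inherited.\<close>

definition row_mat :: "'a vec \<Rightarrow> 'a mat" where
  "row_mat x = mat 1 (dim_vec x) (\<lambda>(i, j). x $ j)"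

lemma row_mat_mats: "x \<in> vecs R n \<Longrightarrow> row_mat x \<in> mats R 1 n"
  by (auto simp: vecs_def mats_def row_mat_def)

lemma row_mat_inject: "dim_vec x = dim_vec y \<Longrightarrow> row_mat x = row_mat y \<longleftrightarrow> x = y"
  unfolding row_mat_def by (auto simp: mat_eq_iff intro!: eq_vecI)

lemma row_mat_vec_mat_prod:
  assumes "x \<in> vecs R k" "A \<in> mats R k n"
  shows "row_mat (vec_mat_prod R x A) = mat_prod R (row_mat x) A"
  using assms matsD[of A k n] mats_closed[of A k n]
  by (intro eq_matI) (auto simp: row_mat_def vec_mat_prod_def mat_prod_def vecs_def intro!: finsum_cong')

lemma vec_mat_prod_assoc:
  assumes "x \<in> vecs R k" "A \<in> mats R k l" "B \<in> mats R l n"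
  shows "vec_mat_prod R (vec_mat_prod R x A) B = vec_mat_prod R x (mat_prod R A B)"
proof -
  have "row_mat (vec_mat_prod R (vec_mat_prod R x A) B) = row_mat (vec_mat_prod R x (mat_prod R A B))"
    unfolding row_mat_vec_mat_prod[OF vec_mat_prod_vecs[OF assms(1,2)] assms(3)]
      row_mat_vec_mat_prod[OF assms(1,2)] row_mat_vec_mat_prod[OF assms(1) mat_prod_mats[OF assms(2,3)]]
    by (rule mat_prod_assoc[OF row_mat_mats[OF assms(1)] assms(2,3)])
  then show ?thesis
    by (subst (asm) row_mat_inject) (simp_all add: vec_mat_prod_def mat_prod_def)
qed

lemma vec_zero_vecs: "vec_zero R n \<in> vecs R n"
  by (auto simp: vecs_def vec_zero_def)

lemma vecs_eqI: "x \<in> vecs R n \<Longrightarrow> y \<in> vecs R n \<Longrightarrow> (\<And>i. i < n \<Longrightarrow> x $ i = y $ i) \<Longrightarrow> x = y"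
  by (rule eq_vecI) (auto simp: vecs_def)

lemma vec_mat_prod_index:
  "x \<in> vecs R k \<Longrightarrow> A \<in> mats R k n \<Longrightarrow> j < n \<Longrightarrow>
    vec_mat_prod R x A $ j = (\<Oplus>i\<in>{..<k}. x $ i \<otimes> A $$ (i, j))"
  using matsD[of A k n] by (simp add: vec_mat_prod_def)

lemma vec_mat_prod_zero: "A \<in> mats R k n \<Longrightarrow> vec_mat_prod R (vec_zero R k) A = vec_zero R n"
proof (rule vecs_eqI[of _ n])
  assume A: "A \<in> mats R k n"
  fix j assume j: "j < n"
  have "(\<Oplus>i\<in>{..<k}. vec_zero R k $ i \<otimes> A $$ (i, j)) = \<zero>"
    using mats_closed[OF A _ j] by (intro add.finprod_one_eqI) (simp add: vec_zero_def)
  then show "vec_mat_prod R (vec_zero R k) A $ j = vec_zero R n $ j"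
    unfolding vec_mat_prod_index[OF vec_zero_vecs A j] using j by (simp add: vec_zero_def)
qed (auto intro: vec_mat_prod_vecs vec_zero_vecs)

lemma vec_add_vecs: "x \<in> vecs R n \<Longrightarrow> y \<in> vecs R n \<Longrightarrow> vec_add R x y \<in> vecs R n"
  by (auto simp: vecs_def vec_add_def)

lemma vec_scale_vecs: "c \<in> carrier R \<Longrightarrow> x \<in> vecs R n \<Longrightarrow> vec_scale R c x \<in> vecs R n"
  by (auto simp: vecs_def vec_scale_def)

lemma vec_add_index: "x \<in> vecs R n \<Longrightarrow> j < n \<Longrightarrow> vec_add R x y $ j = x $ j \<oplus> y $ j"
  by (auto simp: vecs_def vec_add_def)

lemma vec_scale_index: "x \<in> vecs R n \<Longrightarrow> j < n \<Longrightarrow> vec_scale R c x $ j = c \<otimes> x $ j"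
  by (auto simp: vecs_def vec_scale_def)

lemma vec_mat_prod_add:
  assumes x: "x \<in> vecs R k" and y: "y \<in> vecs R k" and A: "A \<in> mats R k n"
  shows "vec_mat_prod R (vec_add R x y) A = vec_add R (vec_mat_prod R x A) (vec_mat_prod R y A)"
proof (rule vecs_eqI[of _ n])
  fix j assume j: "j < n"
  have xi: "x $ i \<in> carrier R" "y $ i \<in> carrier R" "A $$ (i, j) \<in> carrier R" if "i < k" for i
    using x y mats_closed[OF A] that j by (auto simp: vecs_def)
  have "vec_mat_prod R (vec_add R x y) A $ j = (\<Oplus>i\<in>{..<k}. x $ i \<otimes> A $$ (i, j) \<oplus> y $ i \<otimes> A $$ (i, j))"
    unfolding vec_mat_prod_index[OF vec_add_vecs[OF x y] A j]
    using xi x y by (intro finsum_cong') (auto simp: vec_add_def vecs_def l_distr)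
  also have "\<dots> = (\<Oplus>i\<in>{..<k}. x $ i \<otimes> A $$ (i, j)) \<oplus> (\<Oplus>i\<in>{..<k}. y $ i \<otimes> A $$ (i, j))"
    using xi by (intro finsum_addf) auto
  finally show "vec_mat_prod R (vec_add R x y) A $ j = vec_add R (vec_mat_prod R x A) (vec_mat_prod R y A) $ j"
    unfolding vec_add_index[OF vec_mat_prod_vecs[OF x A] j]
    using vec_mat_prod_index[OF x A j] vec_mat_prod_index[OF y A j] by simp
qed (use assms in \<open>auto intro!: vec_mat_prod_vecs vec_add_vecs\<close>)

lemma vec_mat_prod_scale:
  assumes c: "c \<in> carrier R" and x: "x \<in> vecs R k" and A: "A \<in> mats R k n"
  shows "vec_mat_prod R (vec_scale R c x) A = vec_scale R c (vec_mat_prod R x A)"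
proof (rule vecs_eqI[of _ n])
  fix j assume j: "j < n"
  have xi: "x $ i \<in> carrier R" "A $$ (i, j) \<in> carrier R" if "i < k" for i
    using x mats_closed[OF A] that j by (auto simp: vecs_def)
  have "vec_mat_prod R (vec_scale R c x) A $ j = (\<Oplus>i\<in>{..<k}. c \<otimes> (x $ i \<otimes> A $$ (i, j)))"
    unfolding vec_mat_prod_index[OF vec_scale_vecs[OF c x] A j]
    using xi x c by (intro finsum_cong') (auto simp: vec_scale_def vecs_def m_assoc)
  also have "\<dots> = c \<otimes> (\<Oplus>i\<in>{..<k}. x $ i \<otimes> A $$ (i, j))"
    using xi c by (intro finsum_rdistr[symmetric]) auto
  finally show "vec_mat_prod R (vec_scale R c x) A $ j = vec_scale R c (vec_mat_prod R x A) $ j"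
    unfolding vec_scale_index[OF vec_mat_prod_vecs[OF x A] j]
    using vec_mat_prod_index[OF x A j] by simp
qed (use assms in \<open>auto intro!: vec_mat_prod_vecs vec_scale_vecs\<close>)

lemma independent_rows_generator_matrix:
  assumes A: "A \<in> mats R k n" and "independent_rows R A"
  shows "generator_matrix R k n A"
  unfolding generator_matrix_def linear_code_def
proof (intro conjI exI[of _ "row_span R A"] A refl ballI)
  have k: "dim_row A = k" using matsD[OF A] by simp
  show "row_span R A \<subseteq> vecs R n"
    unfolding row_span_def k using vec_mat_prod_vecs[OF _ A] by auto
  show "vec_zero R n \<in> row_span R A"
    unfolding row_span_def k using vec_mat_prod_zero[OF A] vec_zero_vecs by (metis image_eqI)
  show "vec_add R v w \<in> row_span R A" if "v \<in> row_span R A" "w \<in> row_span R A" for v w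
    using that vec_mat_prod_add[OF _ _ A] vec_add_vecs unfolding row_span_def k by (auto simp flip: vec_mat_prod_add[OF _ _ A])
  show "vec_scale R c v \<in> row_span R A" if "c \<in> carrier R" "v \<in> row_span R A" for c v
    using that vec_scale_vecs unfolding row_span_def k by (auto simp flip: vec_mat_prod_scale[OF _ _ A])
  show "\<exists>B\<in>mats R k n. independent_rows R B \<and> row_span R B = row_span R A"
    using assms by blast
qed

lemma independent_rows_inj:
  assumes A: "A \<in> mats R k n" and ind: "independent_rows R A"
  shows "inj_on (\<lambda>x. vec_mat_prod R x A) (vecs R k)"
proof (rule inj_onI)
  fix x y assume x: "x \<in> vecs R k" and y: "y \<in> vecs R k" and eq: "vec_mat_prod R x A = vec_mat_prod R y A"
  let ?z = "vec_add R x (vec_scale R (\<ominus> \<one>) y)"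
  have z: "?z \<in> vecs R k" using x y by (intro vec_add_vecs vec_scale_vecs) auto
  have "vec_mat_prod R ?z A = vec_add R (vec_mat_prod R y A) (vec_scale R (\<ominus> \<one>) (vec_mat_prod R y A))"
    using x y eq by (simp add: vec_mat_prod_add[OF _ _ A] vec_mat_prod_scale[OF _ _ A] vec_scale_vecs)
  also have "\<dots> = vec_zero R n"
    using vec_mat_prod_vecs[OF y A]
    by (intro eq_vecI) (auto simp: vec_add_def vec_scale_def vec_zero_def vecs_def l_minus r_neg)
  finally have "?z = vec_zero R k"
    using ind z matsD[OF A] unfolding independent_rows_def by auto
  then have "?z $ i = \<zero>" if "i < k" for i using that by (simp add: vec_zero_def)
  then have "x $ i \<oplus> \<ominus> (y $ i) = \<zero>" if "i < k" for i
    using that x y by (auto simp: vec_add_def vec_scale_def vecs_def l_minus)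
  then have "x $ i = y $ i" if "i < k" for i
    using that x y by (metis (no_types, lifting) vecs_def mem_Collect_eq minus_equality minus_minus a_inv_closed add.inv_comm)
  then show "x = y" by (rule vecs_eqI[OF x y])
qed

lemma vecs_eq_image: "vecs R n = vec_of_list ` {xs. set xs \<subseteq> carrier R \<and> length xs = n}"
proof (intro equalityI subsetI)
  fix x assume x: "x \<in> vecs R n"
  then have "x = vec_of_list (list_of_vec x)" "length (list_of_vec x) = n" "set (list_of_vec x) \<subseteq> carrier R"
    by (auto simp: vecs_def vec_list set_list_of_vec vec_set_def)
  then show "x \<in> vec_of_list ` {xs. set xs \<subseteq> carrier R \<and> length xs = n}" by blast
next
  fix x assume "x \<in> vec_of_list ` {xs. set xs \<subseteq> carrier R \<and> length xs = n}"
  then obtain xs where xs: "x = vec_of_list xs" "set xs \<subseteq> carrier R" "length xs = n" by blast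
  have "x \<in> carrier_vec n" by (rule carrier_vecI) (simp add: xs)
  moreover have "x $ i \<in> carrier R" if "i < n" for i
    using that xs by (simp add: vec_of_list_index subset_iff)
  ultimately show "x \<in> vecs R n" by (simp add: vecs_def)
qed

lemma card_vecs:
  assumes "finite (carrier R)"
  shows "finite (vecs R n)" "card (vecs R n) = card (carrier R) ^ n"
proof -
  show "finite (vecs R n)"
    unfolding vecs_eq_image using assms by (intro finite_imageI finite_lists_length_eq)
  have "inj vec_of_list" by (metis injI list_vec)
  then show "card (vecs R n) = card (carrier R) ^ n"
    unfolding vecs_eq_image using assms
    by (subst card_image[OF inj_on_subset[OF _ subset_UNIV]]) (simp_all add: card_lists_length_eq)
qed

text \<open>A generator matrix is only required to span a code that has some basis of k rows. By
  that basis the code has q^k words, so x |-> x A maps q^k vectors onto q^k words and is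
  injective.\<close>

lemma generator_matrix_independent_rows:
  assumes fin: "finite (carrier R)" and G: "generator_matrix R k n A"
  shows "A \<in> mats R k n" "independent_rows R A"
proof -
  show A: "A \<in> mats R k n" using G by (simp add: generator_matrix_def)
  have "linear_code R k n (row_span R A)" using G by (simp add: generator_matrix_def)
  then have "\<exists>B\<in>mats R k n. independent_rows R B \<and> row_span R B = row_span R A"
    by (simp add: linear_code_def)
  then obtain B where B: "B \<in> mats R k n" "independent_rows R B" "row_span R B = row_span R A"
    by (elim bexE conjE)
  have "card ((\<lambda>x. vec_mat_prod R x A) ` vecs R k) = card (vecs R k)"
    using B(3) card_image[OF independent_rows_inj[OF B(1,2)]] matsD[OF A] matsD[OF B(1)] by (simp add: row_span_def)
  then have "inj_on (\<lambda>x. vec_mat_prod R x A) (vecs R k)"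
    using card_vecs(1)[OF fin] by (rule eq_card_imp_inj_on[rotated])
  then show "independent_rows R A"
    unfolding independent_rows_def using matsD[OF A] vec_mat_prod_zero[OF A] vec_zero_vecs
    by (metis inj_onD)
qed

text \<open>Over a finite ring the injective map x |-> x S is onto, and preimages of the unit
  vectors are the rows of a left inverse T.\<close>

lemma independent_rows_GL:
  assumes fin: "finite (carrier R)" and S: "S \<in> mats R k k" and ind: "independent_rows R S"
  shows "S \<in> GL R k"
proof -
  have inj: "inj_on (\<lambda>x. vec_mat_prod R x S) (vecs R k)" by (rule independent_rows_inj[OF S ind])
  then have "(\<lambda>x. vec_mat_prod R x S) ` vecs R k = vecs R k"
    using vec_mat_prod_vecs[OF _ S] card_vecs(1)[OF fin] by (intro endo_inj_surj) auto
  moreover have "row (mat_one R k) i \<in> vecs R k" if "i < k" for i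
    using that by (auto simp: vecs_def mat_one_def)
  ultimately have "\<forall>i. \<exists>x. i < k \<longrightarrow> x \<in> vecs R k \<and> vec_mat_prod R x S = row (mat_one R k) i"
    by (metis (no_types, lifting) image_iff)
  then obtain x where x: "\<And>i. i < k \<Longrightarrow> x i \<in> vecs R k" "\<And>i. i < k \<Longrightarrow> vec_mat_prod R (x i) S = row (mat_one R k) i"
    by metis
  define T where "T = mat k k (\<lambda>(i, j). x i $ j)"
  have T: "T \<in> mats R k k" using x(1) by (auto simp: T_def mats_def vecs_def)
  have TS: "mat_prod R T S = mat_one R k"
  proof (rule mats_eqI[OF mat_prod_mats[OF T S] mat_one_mats])
    fix i j assume i: "i < k" and j: "j < k"
    have "mat_prod R T S $$ (i, j) = vec_mat_prod R (x i) S $ j"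
      unfolding mat_prod_index[OF T S i j] vec_mat_prod_index[OF x(1)[OF i] S j]
      using i j mats_closed[OF S] x(1)[OF i] by (intro finsum_cong') (auto simp: T_def vecs_def)
    then show "mat_prod R T S $$ (i, j) = mat_one R k $$ (i, j)"
      using x(2)[OF i] i j by (simp add: mat_one_def)
  qed
  \<comment> \<open>From T S = 1 follows (S T) S = 1 S, and injectivity of x |-> x S, applied row by
    row, cancels S.\<close>
  have rows: "mat_prod R S T $$ (i, j) = mat_one R k $$ (i, j)" if i: "i < k" and j: "j < k" for i j
  proof -
    let ?y = "vec k (\<lambda>j. mat_prod R S T $$ (i, j))" and ?e = "row (mat_one R k) i"
    have ST: "mat_prod R S T \<in> mats R k k" by (rule mat_prod_mats[OF S T])
    have y: "?y \<in> vecs R k" using mats_closed[OF ST] i by (auto simp: vecs_def)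
    have e: "?e \<in> vecs R k" using i by (auto simp: vecs_def mat_one_def)
    have "mat_prod R (mat_prod R S T) S = S"
      by (simp add: mat_prod_assoc[OF S T S] TS mat_prod_one_right[OF S])
    moreover have "mat_prod R (mat_one R k) S = S" by (rule mat_prod_one_left[OF S])
    moreover have "vec_mat_prod R ?y S $ j = mat_prod R (mat_prod R S T) S $$ (i, j)"
      "vec_mat_prod R ?e S $ j = mat_prod R (mat_one R k) S $$ (i, j)" if j: "j < k" for j
      unfolding vec_mat_prod_index[OF y S j] vec_mat_prod_index[OF e S j]
        mat_prod_index[OF ST S i j] mat_prod_index[OF mat_one_mats S i j]
      using i j mats_closed[OF S] mats_closed[OF ST] by (auto intro!: finsum_cong' simp: mat_one_def)
    ultimately have "vec_mat_prod R ?y S = vec_mat_prod R ?e S"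
      by (intro vecs_eqI[OF vec_mat_prod_vecs[OF y S] vec_mat_prod_vecs[OF e S]]) simp
    then have "?y = ?e" using inj y e by (auto dest: inj_onD)
    then have "?y $ j = ?e $ j" by simp
    then show ?thesis using i j by (simp add: mat_one_def)
  qed
  have "mat_prod R S T = mat_one R k"
    by (rule mats_eqI[OF mat_prod_mats[OF S T] mat_one_mats rows])
  then show ?thesis using S T TS unfolding GL_def by blast
qed

end

section \<open>Code equivalence in terms of columns\<close>

definition mat_of_columns :: "nat \<Rightarrow> 'a list list \<Rightarrow> 'a mat" where
  "mat_of_columns k F = mat k (length F) (\<lambda>(i, j). F ! j ! i)"

lemma map_list_of_vec_cols:
  assumes "\<forall>c\<in>set F. length c = k"
  shows "map list_of_vec (cols (mat_of_columns k F)) = F"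
proof (rule nth_equalityI)
  fix j assume "j < length (map list_of_vec (cols (mat_of_columns k F)))"
  then have j: "j < length F" by (simp add: mat_of_columns_def)
  have "length (F ! j) = k" using assms j by auto
  then have "list_of_vec (col (mat_of_columns k F) j) = F ! j"
    using j by (intro nth_equalityI) (auto simp: mat_of_columns_def list_of_vec_index)
  then show "map list_of_vec (cols (mat_of_columns k F)) ! j = F ! j"
    using j by (simp add: mat_of_columns_def)
qed (simp add: mat_of_columns_def)

lemma enc_mat_mat_of_columns:
  assumes "\<forall>c\<in>set F. length c = k" shows "enc_mat (mat_of_columns k F) = mat_enc F"
  unfolding enc_mat_def map_list_of_vec_cols[OF assms] enc_nats_def ..

lemma mat_of_columns_cols:
  assumes "A \<in> carrier_mat k n" shows "mat_of_columns k (map list_of_vec (cols A)) = A"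
  using assms by (intro eq_matI) (auto simp: mat_of_columns_def list_of_vec_index)

section \<open>Proportional columns and the action of invertible matrices on them\<close>

context field
begin

definition columns :: "nat \<Rightarrow> nat \<Rightarrow> 'a list list \<Rightarrow> bool" where
  "columns k n F \<longleftrightarrow> length F = n \<and> (\<forall>c\<in>set F. length c = k \<and> set c \<subseteq> carrier R)"

definition parallel :: "'a list \<Rightarrow> 'a list \<Rightarrow> bool" where
  "parallel u v \<longleftrightarrow> (\<exists>c\<in>carrier R. c \<noteq> \<zero> \<and> u = map (\<lambda>x. c \<otimes> x) v)"

definition apply_mat :: "'a mat \<Rightarrow> 'a list \<Rightarrow> 'a list" where
  "apply_mat S u = map (\<lambda>i. \<Oplus>s\<in>{..<dim_row S}. S $$ (i, s) \<otimes> u ! s) [0..<dim_row S]"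

lemma columns_nth: "columns k n F \<Longrightarrow> j < n \<Longrightarrow> length (F ! j) = k \<and> set (F ! j) \<subseteq> carrier R"
  by (auto simp: columns_def)

lemma columns_entry: "columns k n F \<Longrightarrow> j < n \<Longrightarrow> i < k \<Longrightarrow> F ! j ! i \<in> carrier R"
  using columns_nth by (metis nth_mem subsetD)

lemma columns_mats: "columns k n F \<Longrightarrow> mat_of_columns k F \<in> mats R k n"
  using columns_entry by (auto simp: mats_def mat_of_columns_def columns_def)

lemma columns_length: "columns k n F \<Longrightarrow> \<forall>c\<in>set F. length c = k"
  by (auto simp: columns_def)

lemma mats_columns: "A \<in> mats R k n \<Longrightarrow> columns k n (map list_of_vec (cols A))"
  by (auto simp: columns_def mats_def cols_def set_list_of_vec vec_set_def)

lemma mat_of_columns_index: "columns k n F \<Longrightarrow> i < k \<Longrightarrow> j < n \<Longrightarrow> mat_of_columns k F $$ (i, j) = F ! j ! i"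
  by (auto simp: columns_def mat_of_columns_def)

lemma columns_append:
  "columns k n F \<Longrightarrow> columns k m G \<Longrightarrow> columns k (n + m) (F @ G)"
  by (auto simp: columns_def)

lemma nz_mult: "c \<in> carrier R \<Longrightarrow> d \<in> carrier R \<Longrightarrow> c \<noteq> \<zero> \<Longrightarrow> d \<noteq> \<zero> \<Longrightarrow> c \<otimes> d \<noteq> \<zero>"
  using integral by blast

lemma nz_inv:
  assumes "c \<in> carrier R" "c \<noteq> \<zero>"
  shows "inv c \<in> carrier R" "inv c \<noteq> \<zero>" "inv c \<otimes> c = \<one>" "c \<otimes> inv c = \<one>"
proof -
  have "c \<in> Units R" using assms field_Units by simp
  then show "inv c \<in> carrier R" "inv c \<otimes> c = \<one>" "c \<otimes> inv c = \<one>" by auto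
  then show "inv c \<noteq> \<zero>" using assms(1) by auto
qed

lemma parallel_refl: "set u \<subseteq> carrier R \<Longrightarrow> parallel u u"
  unfolding parallel_def by (intro bexI[of _ \<one>]) (auto intro!: map_idI[symmetric])

lemma parallel_sym:
  assumes "parallel u v" "set v \<subseteq> carrier R" shows "parallel v u"
proof -
  obtain c where c: "c \<in> carrier R" "c \<noteq> \<zero>" "u = map (\<lambda>x. c \<otimes> x) v"
    using assms(1) unfolding parallel_def by blast
  have "v = map (\<lambda>x. inv c \<otimes> x) u"
    unfolding c(3) map_map comp_def using assms(2) nz_inv[OF c(1,2)] c(1)
    by (intro map_idI[symmetric]) (simp add: subset_iff flip: m_assoc)
  then show ?thesis unfolding parallel_def using nz_inv[OF c(1,2)] by blast
qed

lemma parallel_trans: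
  assumes "parallel u v" "parallel v w" "set w \<subseteq> carrier R" shows "parallel u w"
proof -
  obtain c where c: "c \<in> carrier R" "c \<noteq> \<zero>" "u = map (\<lambda>x. c \<otimes> x) v"
    using assms(1) unfolding parallel_def by blast
  obtain d where d: "d \<in> carrier R" "d \<noteq> \<zero>" "v = map (\<lambda>x. d \<otimes> x) w"
    using assms(2) unfolding parallel_def by blast
  have "u = map (\<lambda>x. (c \<otimes> d) \<otimes> x) w"
    unfolding c(3) d(3) map_map comp_def using assms(3) c(1) d(1)
    by (intro map_cong) (simp_all add: subset_iff m_assoc)
  then show ?thesis unfolding parallel_def using nz_mult[OF c(1) d(1) c(2) d(2)] c(1) d(1) by blast
qed

text \<open>A point of projective space, with the zero column as an additional class. As a set it
  can be compared by equality and counted in multisets.\<close>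

definition point :: "'a list \<Rightarrow> 'a list set" where
  "point u = {v. set v \<subseteq> carrier R \<and> parallel v u}"

lemma parallel_iff_point:
  assumes "set u \<subseteq> carrier R" "set v \<subseteq> carrier R"
  shows "parallel u v \<longleftrightarrow> point u = point v"
proof
  assume "parallel u v"
  then show "point u = point v"
    unfolding point_def using assms parallel_sym[OF _ assms(2)] parallel_trans[OF _ _ assms(1)] parallel_trans[OF _ _ assms(2)]
    by blast
next
  assume "point u = point v"
  then show "parallel u v" unfolding point_def using parallel_refl[OF assms(1)] assms(1) by blast
qed

lemma apply_mat_closed:
  "S \<in> mats R k k \<Longrightarrow> length u = k \<Longrightarrow> set u \<subseteq> carrier R \<Longrightarrow> length (apply_mat S u) = k \<and> set (apply_mat S u) \<subseteq> carrier R"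
  using matsD[of S k k] by (auto simp: apply_mat_def mats_closed subset_iff intro!: finsum_closed)

lemma mat_prod_columns_index:
  assumes S: "S \<in> mats R k k" and G: "columns k n G" and "i < k" "j < n"
  shows "mat_prod R S (mat_of_columns k G) $$ (i, j) = apply_mat S (G ! j) ! i"
proof -
  have "mat_prod R S (mat_of_columns k G) $$ (i, j) = (\<Oplus>s\<in>{..<k}. S $$ (i, s) \<otimes> G ! j ! s)"
    unfolding mat_prod_index[OF S columns_mats[OF G] assms(3,4)]
    using mats_closed[OF S assms(3)] columns_entry[OF G assms(4)] mat_of_columns_index[OF G _ assms(4)]
    by (intro finsum_cong') auto
  then show ?thesis using matsD[OF S] assms(3) by (simp add: apply_mat_def)
qed

lemma apply_mat_parallel:
  assumes S: "S \<in> mats R k k" and v: "length v = k" "set v \<subseteq> carrier R" and p: "parallel u v"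
  shows "parallel (apply_mat S u) (apply_mat S v)"
proof -
  obtain c where c: "c \<in> carrier R" "c \<noteq> \<zero>" "u = map (\<lambda>x. c \<otimes> x) v"
    using p unfolding parallel_def by blast
  have vs: "v ! s \<in> carrier R" if "s < k" for s using v that by (meson nth_mem subsetD)
  have "apply_mat S u ! i = c \<otimes> apply_mat S v ! i" if i: "i < k" for i
  proof -
    have "apply_mat S u ! i = (\<Oplus>s\<in>{..<k}. c \<otimes> (S $$ (i, s) \<otimes> v ! s))"
      using matsD[OF S] i c v vs mats_closed[OF S i] by (auto simp: apply_mat_def m_lcomm intro!: finsum_cong')
    also have "\<dots> = c \<otimes> (\<Oplus>s\<in>{..<k}. S $$ (i, s) \<otimes> v ! s)"
      using c vs mats_closed[OF S i] by (intro finsum_rdistr[symmetric]) auto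
    finally show ?thesis using matsD[OF S] i by (simp add: apply_mat_def)
  qed
  then have "apply_mat S u = map (\<lambda>x. c \<otimes> x) (apply_mat S v)"
    using matsD[OF S] by (intro nth_equalityI) (auto simp: apply_mat_def)
  then show ?thesis unfolding parallel_def using c by blast
qed

lemma apply_mat_mat_prod:
  assumes S: "S \<in> mats R k k" and T: "T \<in> mats R k k" and u: "length u = k" "set u \<subseteq> carrier R"
  shows "apply_mat T (apply_mat S u) = apply_mat (mat_prod R T S) u"
proof (rule nth_equalityI)
  have U: "columns k 1 [u]" "columns k 1 [apply_mat S u]"
    using u apply_mat_closed[OF S u] by (auto simp: columns_def)
  have TS: "mat_prod R T S \<in> mats R k k" by (rule mat_prod_mats[OF T S])
  have SU: "mat_prod R S (mat_of_columns k [u]) = mat_of_columns k [apply_mat S u]"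
    by (rule mats_eqI[OF mat_prod_mats[OF S columns_mats[OF U(1)]] columns_mats[OF U(2)]])
      (use mat_prod_columns_index[OF S U(1)] mat_of_columns_index[OF U(2)] in simp)
  fix i assume "i < length (apply_mat T (apply_mat S u))"
  then have i: "i < k" using matsD[OF T] by (simp add: apply_mat_def)
  show "apply_mat T (apply_mat S u) ! i = apply_mat (mat_prod R T S) u ! i"
    using mat_prod_columns_index[OF T U(2) i, of 0] mat_prod_columns_index[OF TS U(1) i, of 0]
      mat_prod_assoc[OF T S columns_mats[OF U(1)]] SU by simp
qed (simp add: apply_mat_def mat_prod_def)

lemma apply_mat_one: "length u = k \<Longrightarrow> set u \<subseteq> carrier R \<Longrightarrow> apply_mat (mat_one R k) u = u"
proof (rule nth_equalityI)
  assume u: "length u = k" "set u \<subseteq> carrier R"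
  then have U: "columns k 1 [u]" by (auto simp: columns_def)
  fix i assume "i < length (apply_mat (mat_one R k) u)"
  then have i: "i < k" by (simp add: apply_mat_def mat_one_def)
  show "apply_mat (mat_one R k) u ! i = u ! i"
    using mat_prod_columns_index[OF mat_one_mats U i, of 0] mat_prod_one_left[OF columns_mats[OF U]]
      mat_of_columns_index[OF U i, of 0] by simp
qed (simp add: apply_mat_def mat_one_def)

lemma apply_mat_parallel_iff:
  assumes S: "S \<in> GL R k" and u: "length u = k" "set u \<subseteq> carrier R" and v: "length v = k" "set v \<subseteq> carrier R"
  shows "parallel (apply_mat S u) (apply_mat S v) \<longleftrightarrow> parallel u v"
proof
  obtain T where T: "S \<in> mats R k k" "T \<in> mats R k k" "mat_prod R T S = mat_one R k"
    using S unfolding GL_def by blast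
  assume "parallel (apply_mat S u) (apply_mat S v)"
  then have "parallel (apply_mat T (apply_mat S u)) (apply_mat T (apply_mat S v))"
    using apply_mat_closed[OF T(1) v] by (intro apply_mat_parallel[OF T(2)]) auto
  then show "parallel u v"
    by (simp add: apply_mat_mat_prod[OF T(1,2)] u v T(3) apply_mat_one)
next
  assume "parallel u v"
  then show "parallel (apply_mat S u) (apply_mat S v)"
    using S v by (intro apply_mat_parallel[of S k]) (auto simp: GL_def)
qed

section \<open>Permutation and diagonal matrices as maps on columns\<close>

definition perm_mat :: "nat \<Rightarrow> (nat \<Rightarrow> nat) \<Rightarrow> 'a mat" where
  "perm_mat n \<tau> = mat n n (\<lambda>(s, j). if s = \<tau> j then \<one> else \<zero>)"

definition scaling_mat :: "nat \<Rightarrow> (nat \<Rightarrow> 'a) \<Rightarrow> 'a mat" where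
  "scaling_mat n c = mat n n (\<lambda>(i, j). if i = j then c j else \<zero>)"

lemma perm_mat_perm_mats:
  assumes "bij_betw \<tau> {..<n} {..<n}" shows "perm_mat n \<tau> \<in> perm_mats R n"
proof -
  have e: "perm_mat n \<tau> $$ (i, j) = (if i = \<tau> j then \<one> else \<zero>)" if "i < n" "j < n" for i j
    using that by (simp add: perm_mat_def)
  have ex: "\<exists>!j. j < n \<and> i = \<tau> j" if "i < n" for i
    using assms that unfolding bij_betw_def inj_on_def by (metis imageE imageI lessThan_iff)
  have lt: "\<tau> j < n" if "j < n" for j
    using assms that by (auto simp: bij_betw_def)
  show ?thesis unfolding perm_mats_def
  proof (intro CollectI conjI allI impI)
    show "perm_mat n \<tau> \<in> mats R n n" by (auto simp: mats_def perm_mat_def)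
    show "perm_mat n \<tau> $$ (i, j) \<in> {\<zero>, \<one>}" if "i < n" "j < n" for i j using that by (simp add: e)
    show "\<exists>!j. j < n \<and> perm_mat n \<tau> $$ (i, j) = \<one>" if "i < n" for i
    proof -
      have "(j < n \<and> perm_mat n \<tau> $$ (i, j) = \<one>) \<longleftrightarrow> (j < n \<and> i = \<tau> j)" for j
        using that by (auto simp: e split: if_splits)
      then show ?thesis using ex[OF that] by simp
    qed
    show "\<exists>!i. i < n \<and> perm_mat n \<tau> $$ (i, j) = \<one>" if "j < n" for j
    proof -
      have "(i < n \<and> perm_mat n \<tau> $$ (i, j) = \<one>) \<longleftrightarrow> i = \<tau> j" for i
        using that lt[OF that] by (auto simp: e split: if_splits)
      then show ?thesis by simp
    qed
  qed
qed

lemma scaling_mat_nz_diag_mats: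
  assumes "\<And>j. j < n \<Longrightarrow> c j \<in> carrier R \<and> c j \<noteq> \<zero>" shows "scaling_mat n c \<in> nz_diag_mats R n"
  using assms by (auto simp: nz_diag_mats_def mats_def scaling_mat_def)

lemma code_equivalenceI:
  assumes S: "S \<in> GL R k" and F: "F \<in> mats R k n" and G: "G \<in> mats R k n"
    and \<tau>: "bij_betw \<tau> {..<n} {..<n}" and c: "\<And>j. j < n \<Longrightarrow> c j \<in> carrier R \<and> c j \<noteq> \<zero>"
    and eq: "\<And>i j. i < k \<Longrightarrow> j < n \<Longrightarrow> F $$ (i, j) = mat_prod R S G $$ (i, \<tau> j) \<otimes> c j"
  shows "code_equivalence R k n G F S (perm_mat n \<tau>) (scaling_mat n c)"
  unfolding code_equivalence_def
proof (intro conjI S perm_mat_perm_mats[OF \<tau>] scaling_mat_nz_diag_mats[OF c])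
  have S': "S \<in> mats R k k" using S by (simp add: GL_def)
  have P: "perm_mat n \<tau> \<in> perm_mats R n" by (rule perm_mat_perm_mats[OF \<tau>])
  then have P': "perm_mat n \<tau> \<in> mats R n n" by (simp add: perm_mats_def)
  have D: "scaling_mat n c \<in> nz_diag_mats R n" by (rule scaling_mat_nz_diag_mats[OF c])
  then have D': "scaling_mat n c \<in> mats R n n" by (simp add: nz_diag_mats_def)
  have SG: "mat_prod R S G \<in> mats R k n" by (rule mat_prod_mats[OF S' G])
  show "F = mat_prod R (mat_prod R (mat_prod R S G) (perm_mat n \<tau>)) (scaling_mat n c)"
  proof (rule mats_eqI[OF F mat_prod_mats[OF mat_prod_mats[OF SG P'] D']])
    fix i j assume i: "i < k" and j: "j < n"
    have t: "\<tau> j < n" using \<tau> j by (auto simp: bij_betw_def)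
    have "mat_prod R (mat_prod R (mat_prod R S G) (perm_mat n \<tau>)) (scaling_mat n c) $$ (i, j) =
        mat_prod R (mat_prod R S G) (perm_mat n \<tau>) $$ (i, j) \<otimes> c j"
      using i j mat_prod_diag[OF mat_prod_mats[OF SG P'] D' _ i j] by (simp add: scaling_mat_def)
    also have "mat_prod R (mat_prod R S G) (perm_mat n \<tau>) $$ (i, j) = mat_prod R S G $$ (i, \<tau> j)"
      using j t by (intro mat_prod_perm[OF SG P i j t]) (simp add: perm_mat_def)
    finally show "F $$ (i, j) = mat_prod R (mat_prod R (mat_prod R S G) (perm_mat n \<tau>)) (scaling_mat n c) $$ (i, j)"
      using eq[OF i j] by simp
  qed
qed

text \<open>\<open>\<tau> j\<close> is the row of the 1 in column j of P, so column j of G P is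
  column \<open>\<tau> j\<close> of G; the diagonal entry of D scales it.\<close>

lemma code_equivalenceE:
  assumes G: "G \<in> mats R k n" and eqv: "code_equivalence R k n G F S P D"
  obtains \<tau> c where "S \<in> GL R k" "bij_betw \<tau> {..<n} {..<n}" "\<And>j. j < n \<Longrightarrow> c j \<in> carrier R \<and> c j \<noteq> \<zero>"
    "\<And>i j. i < k \<Longrightarrow> j < n \<Longrightarrow> F $$ (i, j) = mat_prod R S G $$ (i, \<tau> j) \<otimes> c j"
proof -
  have S: "S \<in> GL R k" and P: "P \<in> perm_mats R n" and D: "D \<in> nz_diag_mats R n"
    and F: "F = mat_prod R (mat_prod R (mat_prod R S G) P) D"
    using eqv by (auto simp: code_equivalence_def)
  have S': "S \<in> mats R k k" using S by (simp add: GL_def)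
  have P': "P \<in> mats R n n" using P by (simp add: perm_mats_def)
  have D': "D \<in> mats R n n" using D by (simp add: nz_diag_mats_def)
  have SG: "mat_prod R S G \<in> mats R k n" by (rule mat_prod_mats[OF S' G])
  have P2: "\<forall>j<n. \<exists>!i. i < n \<and> P $$ (i, j) = \<one>" "\<forall>i<n. \<exists>!j. j < n \<and> P $$ (i, j) = \<one>"
    using P by (simp_all add: perm_mats_def)
  have "\<forall>j. \<exists>s. j < n \<longrightarrow> s < n \<and> P $$ (s, j) = \<one>"
    using P2(1) by (meson ex1_implies_ex)
  then obtain \<tau> where \<tau>: "\<And>j. j < n \<Longrightarrow> \<tau> j < n \<and> P $$ (\<tau> j, j) = \<one>" by metis
  have "inj_on \<tau> {..<n}"
  proof (rule inj_onI)
    fix x y assume xy: "x \<in> {..<n}" "y \<in> {..<n}" "\<tau> x = \<tau> y"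
    then have "\<tau> x < n" "x < n \<and> P $$ (\<tau> x, x) = \<one>" "y < n \<and> P $$ (\<tau> x, y) = \<one>"
      using \<tau>[of x] \<tau>[of y] by simp_all
    moreover from this(1) have "\<exists>!j. j < n \<and> P $$ (\<tau> x, j) = \<one>" using P2(2) by simp
    ultimately show "x = y" by (blast elim: ex1E)
  qed
  moreover have "\<tau> ` {..<n} \<subseteq> {..<n}" using \<tau> by auto
  ultimately have bij: "bij_betw \<tau> {..<n} {..<n}"
    by (simp add: bij_betw_def endo_inj_surj)
  have c: "D $$ (j, j) \<in> carrier R \<and> D $$ (j, j) \<noteq> \<zero>" if "j < n" for j
    using D that by (auto simp: nz_diag_mats_def mats_def)
  have "F $$ (i, j) = mat_prod R S G $$ (i, \<tau> j) \<otimes> D $$ (j, j)" if i: "i < k" and j: "j < n" for i j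
  proof -
    have "F $$ (i, j) = mat_prod R (mat_prod R S G) P $$ (i, j) \<otimes> D $$ (j, j)"
      unfolding F using D by (intro mat_prod_diag[OF mat_prod_mats[OF SG P'] D' _ i j]) (auto simp: nz_diag_mats_def)
    then show ?thesis using mat_prod_perm[OF SG P i j, of "\<tau> j"] \<tau>[OF j] by simp
  qed
  from that[OF S bij c this] show ?thesis by blast
qed

text \<open>Code equivalence with the diagonal matrix absorbed into proportionality of
  columns.\<close>

definition matches :: "nat \<Rightarrow> nat \<Rightarrow> 'a list list \<Rightarrow> 'a list list \<Rightarrow> 'a mat \<Rightarrow> (nat \<Rightarrow> nat) \<Rightarrow> bool" where
  "matches k n F G S \<tau> \<longleftrightarrow> S \<in> GL R k \<and> bij_betw \<tau> {..<n} {..<n} \<and>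
     (\<forall>j<n. parallel (F ! j) (apply_mat S (G ! \<tau> j)))"

lemma LCE_iff_matches:
  assumes F: "columns k n F" and G: "columns k n G"
  shows "LCE R k n (mat_of_columns k G) (mat_of_columns k F) \<longleftrightarrow> (\<exists>S \<tau>. matches k n F G S \<tau>)"
proof
  assume "LCE R k n (mat_of_columns k G) (mat_of_columns k F)"
  then obtain S P D where "code_equivalence R k n (mat_of_columns k G) (mat_of_columns k F) S P D"
    unfolding LCE_def by blast
  from code_equivalenceE[OF columns_mats[OF G] this] obtain \<tau> c where
    S: "S \<in> GL R k" and \<tau>: "bij_betw \<tau> {..<n} {..<n}" and c: "\<And>j. j < n \<Longrightarrow> c j \<in> carrier R \<and> c j \<noteq> \<zero>"
    and eq: "\<And>i j. i < k \<Longrightarrow> j < n \<Longrightarrow>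
      mat_of_columns k F $$ (i, j) = mat_prod R S (mat_of_columns k G) $$ (i, \<tau> j) \<otimes> c j" by metis
  have S': "S \<in> mats R k k" using S by (simp add: GL_def)
  have "parallel (F ! j) (apply_mat S (G ! \<tau> j))" if j: "j < n" for j
  proof -
    have t: "\<tau> j < n" using \<tau> j by (auto simp: bij_betw_def)
    have cl: "length (apply_mat S (G ! \<tau> j)) = k" "set (apply_mat S (G ! \<tau> j)) \<subseteq> carrier R"
      using apply_mat_closed[OF S'] columns_nth[OF G t] by auto
    have "F ! j = map (\<lambda>x. c j \<otimes> x) (apply_mat S (G ! \<tau> j))"
    proof (rule nth_equalityI)
      fix i assume "i < length (F ! j)"
      then have i: "i < k" using columns_nth[OF F j] by simp
      have "apply_mat S (G ! \<tau> j) ! i \<in> carrier R" using cl i by (meson nth_mem subsetD)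
      then show "F ! j ! i = map (\<lambda>x. c j \<otimes> x) (apply_mat S (G ! \<tau> j)) ! i"
        using eq[OF i j] c[OF j] i j t cl
        by (simp add: mat_of_columns_index[OF F] mat_prod_columns_index[OF S' G] m_comm)
    qed (use cl columns_nth[OF F j] in simp)
    then show ?thesis unfolding parallel_def using c[OF j] by blast
  qed
  then show "\<exists>S \<tau>. matches k n F G S \<tau>" unfolding matches_def using S \<tau> by blast
next
  assume "\<exists>S \<tau>. matches k n F G S \<tau>"
  then obtain S \<tau> where S: "S \<in> GL R k" and \<tau>: "bij_betw \<tau> {..<n} {..<n}"
    and par: "\<And>j. j < n \<Longrightarrow> parallel (F ! j) (apply_mat S (G ! \<tau> j))"
    unfolding matches_def by blast
  have S': "S \<in> mats R k k" using S by (simp add: GL_def)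
  have "\<forall>j. \<exists>c. j < n \<longrightarrow> c \<in> carrier R \<and> c \<noteq> \<zero> \<and> F ! j = map (\<lambda>x. c \<otimes> x) (apply_mat S (G ! \<tau> j))"
    using par unfolding parallel_def by blast
  then obtain c where c: "\<And>j. j < n \<Longrightarrow> c j \<in> carrier R \<and> c j \<noteq> \<zero>"
    "\<And>j. j < n \<Longrightarrow> F ! j = map (\<lambda>x. c j \<otimes> x) (apply_mat S (G ! \<tau> j))" by metis
  have "mat_of_columns k F $$ (i, j) = mat_prod R S (mat_of_columns k G) $$ (i, \<tau> j) \<otimes> c j"
    if i: "i < k" and j: "j < n" for i j
  proof -
    have t: "\<tau> j < n" using \<tau> j by (auto simp: bij_betw_def)
    have cl: "length (apply_mat S (G ! \<tau> j)) = k" "set (apply_mat S (G ! \<tau> j)) \<subseteq> carrier R"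
      using apply_mat_closed[OF S'] columns_nth[OF G t] by auto
    have "apply_mat S (G ! \<tau> j) ! i \<in> carrier R" using cl i by (meson nth_mem subsetD)
    then show ?thesis
      using c[OF j] i j t cl by (simp add: mat_of_columns_index[OF F] mat_prod_columns_index[OF S' G] m_comm)
  qed
  from code_equivalenceI[OF S columns_mats[OF F] columns_mats[OF G] \<tau> c(1) this]
  show "LCE R k n (mat_of_columns k G) (mat_of_columns k F)" unfolding LCE_def by blast
qed

end

section \<open>Recovering the permutation\<close>

text \<open>Fibres of equal size admit bijections, and bijections of fibres with the same value are
  glued.\<close>

lemma bij_betw_classes:
  assumes "finite A" "finite B" "\<And>x. card {a \<in> A. u a = x} = card {b \<in> B. v b = x}"
  obtains h where "bij_betw h A B" "\<And>a. a \<in> A \<Longrightarrow> u a = v (h a)"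
proof -
  have "\<exists>g. bij_betw g {a \<in> A. u a = x} {b \<in> B. v b = x}" for x
    using assms by (intro finite_same_card_bij) auto
  then obtain g where g: "\<And>x. bij_betw (g x) {a \<in> A. u a = x} {b \<in> B. v b = x}" by metis
  define h where "h = (\<lambda>a. g (u a) a)"
  have h: "h a \<in> B \<and> v (h a) = u a" if "a \<in> A" for a
    using bij_betwE[OF g[of "u a"]] that by (auto simp: h_def)
  have "inj_on h A"
  proof (rule inj_onI)
    fix a a' assume a: "a \<in> A" "a' \<in> A" "h a = h a'"
    then have "u a = u a'" using h by metis
    then show "a = a'"
      using a bij_betw_imp_inj_on[OF g[of "u a"]] by (auto simp: h_def inj_on_def)
  qed
  moreover have "B \<subseteq> h ` A"
  proof
    fix b assume "b \<in> B"
    then have "b \<in> g (v b) ` {a \<in> A. u a = v b}"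
      using bij_betw_imp_surj_on[OF g[of "v b"]] by auto
    then obtain a where "a \<in> A" "u a = v b" "b = g (v b) a" by blast
    then have "b = h a" by (simp add: h_def)
    then show "b \<in> h ` A" using \<open>a \<in> A\<close> by (rule image_eqI)
  qed
  ultimately have "bij_betw h A B" using h unfolding bij_betw_def by blast
  then show ?thesis using that h by metis
qed

text \<open>Division with remainder by n + 1: the remainder is the size of a class, the quotient
  encodes its leader.\<close>

lemma mult_add_cancel:
  fixes a b c d n :: nat
  assumes "c + (n + 1) * a = d + (n + 1) * b" "c \<le> n" "d \<le> n"
  shows "a = b" "c = d"
proof -
  have "(c + (n + 1) * a) div (n + 1) = a" "(d + (n + 1) * b) div (n + 1) = b"
    using assms(2,3) by (simp_all only: div_mult_self2) simp_all
  then show "a = b" using assms(1) by simp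
  then show "c = d" using assms(1) by simp
qed

text \<open>
  The multiplicity of a class on either side is its size, at most n, plus the weight of its leader.
  So equal multiplicities force equal sizes and equal leaders.
\<close>

lemma weighted_classes:
  fixes u v :: "nat \<Rightarrow> 'k" and \<pi> w :: "nat \<Rightarrow> nat"
  assumes "i \<le> n" and inj: "inj_on \<pi> {i..<n}" and range: "\<pi> ` {i..<n} \<subseteq> {..<n}"
    and pattern: "\<And>l m. l \<in> {i..<n} \<Longrightarrow> m \<in> {i..<n} \<Longrightarrow> u l = u m \<longleftrightarrow> v (\<pi> l) = v (\<pi> m)"
    and w: "\<And>l. l < n \<Longrightarrow> w l = (if \<forall>m. l < m \<and> m < n \<longrightarrow> u l \<noteq> u m then (n + 1) * (n - l) else 0)"
    and eq: "image_mset u (mset_set {..<n}) + (\<Sum>l\<in>{i..<n}. replicate_mset (w l) (u l)) =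
      image_mset v (mset_set {..<n}) + (\<Sum>l\<in>{i..<n}. replicate_mset (w l) (v (\<pi> l)))"
  obtains \<tau> where "bij_betw \<tau> {..<n} {..<n}" "\<And>l. l \<in> {i..<n} \<Longrightarrow> \<tau> l = \<pi> l" "\<And>l. l < n \<Longrightarrow> u l = v (\<tau> l)"
proof -
  \<comment> \<open>Within one class only the last index carries weight, so the weights over B add
    up to (n + 1) a, where a is n - L if this index L lies in B and 0 otherwise.\<close>
  have single: "\<exists>a. (\<Sum>l\<in>B. w l) = (n + 1) * a \<and> (\<forall>L\<in>B. w L \<noteq> 0 \<longrightarrow> a = n - L)"
    if B: "B \<subseteq> {i..<n}" and cl: "\<And>l m. l \<in> B \<Longrightarrow> m \<in> B \<Longrightarrow> u l = u m" for B
  proof (cases "\<exists>L\<in>B. w L \<noteq> 0")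
    case True
    then obtain L where L: "L \<in> B" "w L \<noteq> 0" by blast
    have lead: "l = L" if "l \<in> B" "w l \<noteq> 0" for l
    proof -
      have lt: "l < n" "L < n" using B that(1) L(1) by auto
      have "\<forall>m. l < m \<and> m < n \<longrightarrow> u l \<noteq> u m"
        using that(2) unfolding w[OF lt(1)] by presburger
      moreover have "\<forall>m. L < m \<and> m < n \<longrightarrow> u L \<noteq> u m"
        using L(2) unfolding w[OF lt(2)] by presburger
      ultimately show ?thesis using cl[OF that(1) L(1)] lt by (metis linorder_neqE_nat)
    qed
    have "(\<Sum>l\<in>B. w l) = (\<Sum>l\<in>{L}. w l)"
    proof (rule sum.mono_neutral_right)
      show "finite B" using B by (rule finite_subset) simp
      show "\<forall>l\<in>B - {L}. w l = 0" using lead by blast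
    qed (use L(1) in simp)
    also have "\<dots> = w L" by simp
    also have "\<dots> = (n + 1) * (n - L)"
    proof -
      have "L < n" using B L(1) by auto
      from w[OF this] L(2) show ?thesis by metis
    qed
    finally show ?thesis using lead by blast
  next
    case False
    then show ?thesis by (intro exI[of _ 0]) auto
  qed
  have single_u: "\<exists>a. (\<Sum>l\<in>{l\<in>{i..<n}. u l = x}. w l) = (n + 1) * a \<and> (\<forall>L\<in>{l\<in>{i..<n}. u l = x}. w L \<noteq> 0 \<longrightarrow> a = n - L)" for x
    by (rule single, blast, simp)
  \<comment> \<open>By \<open>pattern\<close>, indices whose partners lie in one class of v lie in
    one class of u, so \<open>single\<close> applies on this side too.\<close>
  have single_v: "\<exists>a. (\<Sum>l\<in>{l\<in>{i..<n}. v (\<pi> l) = x}. w l) = (n + 1) * a \<and> (\<forall>L\<in>{l\<in>{i..<n}. v (\<pi> l) = x}. w L \<noteq> 0 \<longrightarrow> a = n - L)" for x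
    by (rule single, blast, simp add: pattern)
  have cnt: "card {l \<in> {..<n}. u l = x} + (\<Sum>l\<in>{l\<in>{i..<n}. u l = x}. w l) =
      card {l \<in> {..<n}. v l = x} + (\<Sum>l\<in>{l\<in>{i..<n}. v (\<pi> l) = x}. w l)" for x
  proof -
    have *: "count (\<Sum>l\<in>{i..<n}. replicate_mset (w l) (h l)) x = (\<Sum>l\<in>{l\<in>{i..<n}. h l = x}. w l)" for h
      unfolding count_sum count_replicate_mset by (simp only: sum.inter_filter[OF finite_atLeastLessThan] eq_commute)
    show ?thesis
      using arg_cong[OF eq, of "\<lambda>M. count M x"]
      unfolding count_union * count_image_mset_eq_card_vimage[OF finite_lessThan] .
  qed
  have both: "card {l \<in> {..<n}. u l = x} = card {l \<in> {..<n}. v l = x} \<and>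
      (\<Sum>l\<in>{l\<in>{i..<n}. u l = x}. w l) = (\<Sum>l\<in>{l\<in>{i..<n}. v (\<pi> l) = x}. w l)" for x
  proof -
    obtain a where a: "(\<Sum>l\<in>{l\<in>{i..<n}. u l = x}. w l) = (n + 1) * a"
      using single_u[of x] by blast
    obtain b where b: "(\<Sum>l\<in>{l\<in>{i..<n}. v (\<pi> l) = x}. w l) = (n + 1) * b"
      using single_v[of x] by blast
    have le: "card {l \<in> {..<n}. q l} \<le> n" for q
      using card_mono[OF finite_lessThan Collect_restrict, of n q] by simp
    from mult_add_cancel[OF cnt[of x, unfolded a b] le le] show ?thesis unfolding a b by simp
  qed
  have hit: "u l = v (\<pi> l)" if l: "l \<in> {i..<n}" for l
  proof -
    \<comment> \<open>The last index of the class of l is at least l and so lies in the matched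
      range. This is the reason for giving the weight to the last column and matching
      downwards.\<close>
    define L where "L = Max {m \<in> {i..<n}. u m = u l}"
    have "L \<in> {m \<in> {i..<n}. u m = u l}"
      unfolding L_def using l by (intro Max_in) auto
    then have L: "L \<in> {i..<n}" "u L = u l" by auto
    have max: "m \<le> L" if "m \<in> {i..<n}" "u m = u l" for m
      unfolding L_def using that by (intro Max_ge) auto
    have wL: "w L = (n + 1) * (n - L)"
    proof -
      have "\<forall>m. L < m \<and> m < n \<longrightarrow> u L \<noteq> u m"
      proof (intro allI impI notI)
        fix m assume m: "L < m \<and> m < n" "u L = u m"
        then have "m \<le> L" using L by (intro max) auto
        then show False using m(1) by simp
      qed
      moreover have "L < n" using L(1) by simp
      ultimately show ?thesis using w[of L] by metis
    qed
    let ?B = "{m\<in>{i..<n}. u m = u l}" and ?C = "{m\<in>{i..<n}. v (\<pi> m) = u l}"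
    \<comment> \<open>The leader L has positive weight, so by \<open>both\<close> the class of the
      same name on the side of v has weight as well. Its weighted index M has the same quotient, n -
      M = n - L, and \<open>pattern\<close> carries the agreement from L to l.\<close>
    have "w L \<le> (\<Sum>m\<in>?B. w m)" using L by (intro member_le_sum) auto
    then have pos: "0 < (\<Sum>m\<in>?C. w m)" using both[of "u l"] wL L(1) by auto
    then obtain M where M: "M \<in> ?C" "w M \<noteq> 0" by (metis (no_types, lifting) less_numeral_extra(3) sum.neutral)
    obtain a where a: "(\<Sum>m\<in>?B. w m) = (n + 1) * a" "\<forall>L\<in>?B. w L \<noteq> 0 \<longrightarrow> a = n - L"
      using single_u by blast
    obtain b where b: "(\<Sum>m\<in>?C. w m) = (n + 1) * b" "\<forall>L\<in>?C. w L \<noteq> 0 \<longrightarrow> b = n - L"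
      using single_v by blast
    have "a = b" using a(1) b(1) both[of "u l"] by (metis Suc_eq_plus1 mult_cancel1 nat.distinct(1))
    moreover have "a = n - L" using a(2) L wL by auto
    moreover have "b = n - M" using b(2) M by blast
    ultimately have "L = M" using L(1) M(1) by auto
    then have "v (\<pi> L) = u l" using M(1) by simp
    moreover have "v (\<pi> l) = v (\<pi> L)" using pattern[OF l L(1)] L(2) by simp
    ultimately show ?thesis by simp
  qed
  have rng: "\<pi> l < n" if "i \<le> l" "l < n" for l
    using range that by (auto simp: image_subset_iff)
  \<comment> \<open>Classes of equal size lose equally many members when the matched indices are
    removed, so the matching can be completed below i.\<close>
  have "card {a \<in> {..<i}. u a = x} = card {b \<in> {..<n} - \<pi> ` {i..<n}. v b = x}" for x
  proof -
    have 1: "card {a \<in> {..<i}. u a = x} = card {a \<in> {..<n}. u a = x} - card {a \<in> {i..<n}. u a = x}"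
      using \<open>i \<le> n\<close> by (subst card_Diff_subset[symmetric]) (auto intro!: arg_cong[where f = card])
    have "card {b \<in> {..<n} - \<pi> ` {i..<n}. v b = x} = card {b \<in> {..<n}. v b = x} - card (\<pi> ` {l \<in> {i..<n}. v (\<pi> l) = x})"
      by (subst card_Diff_subset[symmetric]) (auto simp: rng intro!: arg_cong[where f = card])
    also have "card (\<pi> ` {l \<in> {i..<n}. v (\<pi> l) = x}) = card {l \<in> {i..<n}. v (\<pi> l) = x}"
      by (intro card_image inj_on_subset[OF inj]) auto
    also have "{l \<in> {i..<n}. v (\<pi> l) = x} = {l \<in> {i..<n}. u l = x}" using hit by auto
    finally show ?thesis using 1 both[of x] by simp
  qed
  then obtain h where h: "bij_betw h {..<i} ({..<n} - \<pi> ` {i..<n})" "\<And>a. a \<in> {..<i} \<Longrightarrow> u a = v (h a)"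
    using bij_betw_classes[of "{..<i}" "{..<n} - \<pi> ` {i..<n}" u v] by auto
  define \<tau> where "\<tau> = (\<lambda>l. if l < i then h l else \<pi> l)"
  have "bij_betw \<tau> ({..<i} \<union> {i..<n}) (({..<n} - \<pi> ` {i..<n}) \<union> \<pi> ` {i..<n})"
  proof (rule bij_betw_combine)
    show "bij_betw \<tau> {..<i} ({..<n} - \<pi> ` {i..<n})"
      using h(1) by (rule bij_betw_cong[THEN iffD1, rotated]) (simp add: \<tau>_def)
    show "bij_betw \<tau> {i..<n} (\<pi> ` {i..<n})"
      using inj by (intro bij_betw_imageI) (auto simp: \<tau>_def inj_on_def)
  qed auto
  moreover have "{..<i} \<union> {i..<n} = {..<n}" "({..<n} - \<pi> ` {i..<n}) \<union> \<pi> ` {i..<n} = {..<n}"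
    using \<open>i \<le> n\<close> range by auto
  ultimately have "bij_betw \<tau> {..<n} {..<n}" by simp
  moreover have "\<tau> l = \<pi> l" if "l \<in> {i..<n}" for l using that by (simp add: \<tau>_def)
  moreover have "u l = v (\<tau> l)" if "l < n" for l using that hit h(2) by (simp add: \<tau>_def)
  ultimately show ?thesis by (rule that)
qed

lemma mset_map_nth: "mset (map h xs) = image_mset (\<lambda>j. h (xs ! j)) (mset_set {..<length xs})"
proof -
  have "mset (map h xs) = mset (map (\<lambda>j. h (xs ! j)) [0..<length xs])"
    by (rule arg_cong[where f = mset], rule nth_equalityI) auto
  then show ?thesis by (simp add: atLeast0LessThan)
qed

lemma mset_map_concat_replicate:
  assumes "distinct xs"
  shows "mset (map h (concat (map (\<lambda>l. replicate (w l) l) xs))) = (\<Sum>l\<in>set xs. replicate_mset (w l) (h l))"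
  using assms by (induction xs) auto

lemma foldr_find:
  fixes d :: 'a
  assumes "\<exists>j\<in>set xs. P j"
  shows "P (foldr (\<lambda>j r. if P j then j else r) xs d) \<and> foldr (\<lambda>j r. if P j then j else r) xs d \<in> set xs"
  using assms by (induction xs) auto

text \<open>The list of repeated indices depends on neither A nor \<open>js\<close>, so the two
  extensions of a query become maps over one and the same list.\<close>

lemma gextend_eq:
  assumes n: "length A = n" "length F = n" "i \<le> n" and js: "length js = n - i" "set js \<subseteq> {..<n}"
  shows "gextend K F i A js = A @ map (\<lambda>l. A ! (js ! (l - i))) (concat (map (\<lambda>l. replicate (gweight K F l) l) [i..<n]))"
proof -
  let ?g = "\<lambda>l. map (\<lambda>_. nth_default [] A (nth_default 0 js (l - i))) [0..<(if l < i then 0 else gweight K F l)]"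
  have js': "js ! (l - i) < n" if "i \<le> l" "l < n" for l
    using js that by (metis diff_less_mono lessThan_iff nth_mem subsetD)
  have "concat (map ?g [0..<n]) = concat (map ?g [0..<i]) @ concat (map ?g [i..<n])"
    using upt_add_eq_append[of 0 i "n - i"] n(3) by simp
  also have "concat (map ?g [0..<i]) = []" by simp
  also have "map ?g [i..<n] = map (\<lambda>l. map (\<lambda>l. A ! (js ! (l - i))) (replicate (gweight K F l) l)) [i..<n]"
  proof (rule map_cong[OF refl])
    fix l assume "l \<in> set [i..<n]"
    then show "?g l = map (\<lambda>l. A ! (js ! (l - i))) (replicate (gweight K F l) l)"
      using js js'[of l] n diff_less_mono[of l n i] by (simp add: map_replicate_const nth_default_def)
  qed
  also have "concat (map (\<lambda>l. map (\<lambda>l. A ! (js ! (l - i))) (replicate (gweight K F l) l)) [i..<n]) =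
      map (\<lambda>l. A ! (js ! (l - i))) (concat (map (\<lambda>l. replicate (gweight K F l) l) [i..<n]))"
    by (simp add: map_concat comp_def)
  finally show ?thesis unfolding gextend_def using n by simp
qed

text \<open>A relation between the rows of the extended matrix is one between the rows of the
  original, so marking preserves the dimension and the queries remain valid instances.\<close>

lemma (in field) independent_rows_append:
  assumes G: "columns k n G" and E: "columns k m E" and ind: "independent_rows R (mat_of_columns k G)"
  shows "independent_rows R (mat_of_columns k (G @ E))"
  unfolding independent_rows_def
proof (intro ballI impI)
  have GE: "columns k (n + m) (G @ E)" by (rule columns_append[OF G E])
  have dim: "dim_row (mat_of_columns k (G @ E)) = k" "dim_col (mat_of_columns k (G @ E)) = n + m"
    using GE by (auto simp: mat_of_columns_def columns_def)
  fix x assume "x \<in> vecs R (dim_row (mat_of_columns k (G @ E)))"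
    and z: "vec_mat_prod R x (mat_of_columns k (G @ E)) = vec_zero R (dim_col (mat_of_columns k (G @ E)))"
  then have x: "x \<in> vecs R k" by (simp add: dim)
  have "vec_mat_prod R x (mat_of_columns k G) = vec_zero R n"
  proof (rule vecs_eqI[OF vec_mat_prod_vecs[OF x columns_mats[OF G]] vec_zero_vecs])
    fix j assume j: "j < n"
    have "vec_mat_prod R x (mat_of_columns k G) $ j = vec_mat_prod R x (mat_of_columns k (G @ E)) $ j"
      unfolding vec_mat_prod_index[OF x columns_mats[OF G] j] vec_mat_prod_index[OF x columns_mats[OF GE] trans_less_add1[OF j]]
    proof (rule finsum_cong')
      show "(\<lambda>i. x $ i \<otimes> mat_of_columns k (G @ E) $$ (i, j)) \<in> {..<k} \<rightarrow> carrier R"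
        using x mats_closed[OF columns_mats[OF GE] _ trans_less_add1[OF j]] by (auto simp: vecs_def)
      fix i assume "i \<in> {..<k}"
      then show "x $ i \<otimes> mat_of_columns k G $$ (i, j) = x $ i \<otimes> mat_of_columns k (G @ E) $$ (i, j)"
        using j G mat_of_columns_index[OF G] mat_of_columns_index[OF GE] by (simp add: nth_append columns_def)
    qed simp
    then show "vec_mat_prod R x (mat_of_columns k G) $ j = vec_zero R n $ j"
      using j by (simp add: z dim vec_zero_def)
  qed
  then show "x = vec_zero R (dim_row (mat_of_columns k (G @ E)))"
    using ind x G unfolding independent_rows_def dim by (simp add: mat_of_columns_def columns_def)
qed

lemma (in field) diff_zero_iff: "a \<in> carrier R \<Longrightarrow> b \<in> carrier R \<Longrightarrow> a \<ominus> b = \<zero> \<longleftrightarrow> a = b"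
  using minus_equality[of a "\<ominus> b"] by (auto simp: minus_eq r_neg)

lemma list_all_upt: "list_all P [0..<n] \<longleftrightarrow> (\<forall>a<n. P a)"
  by (auto simp: list_all_iff)

section \<open>The parallelism test and the oracle in terms of columns\<close>

context gf
begin

lemma gnull_iff: "length u = k \<Longrightarrow> set u \<subseteq> carrier R \<Longrightarrow> list_all gnull u \<longleftrightarrow> (\<forall>a<k. u ! a = \<zero>\<^bsub>R\<^esub>)"
  unfolding list_all_length using gnull by (metis nth_mem subsetD)

lemma gparallel:
  assumes u: "length u = k" "set u \<subseteq> carrier R" and v: "length v = k" "set v \<subseteq> carrier R"
  shows "gparallel K u v \<longleftrightarrow> R.parallel u v"
proof -
  have uc: "u ! a \<in> carrier R" and vc: "v ! a \<in> carrier R" if "a < k" for a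
    using u v that by (auto simp: subset_iff)
  have *: "gnull (gsub K (gmul K (nth_default [] u a) (nth_default [] v b)) (gmul K (nth_default [] u b) (nth_default [] v a)))
      \<longleftrightarrow> u ! a \<otimes>\<^bsub>R\<^esub> v ! b = u ! b \<otimes>\<^bsub>R\<^esub> v ! a" if "a < k" "b < k" for a b
    using that u(1) v(1) uc vc by (simp add: nth_default_nth gmul gsub gnull R.diff_zero_iff)
  have cross: "gparallel K u v \<longleftrightarrow> ((\<forall>a<k. u ! a = \<zero>\<^bsub>R\<^esub>) \<longleftrightarrow> (\<forall>a<k. v ! a = \<zero>\<^bsub>R\<^esub>)) \<and>
      (\<forall>a<k. \<forall>b<k. u ! a \<otimes>\<^bsub>R\<^esub> v ! b = u ! b \<otimes>\<^bsub>R\<^esub> v ! a)"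
    unfolding gparallel_def u(1) list_all_upt gnull_iff[OF u] gnull_iff[OF v] by (simp add: * conj_commute)
  show ?thesis
  proof
    assume "R.parallel u v"
    then obtain c where c: "c \<in> carrier R" "c \<noteq> \<zero>\<^bsub>R\<^esub>" "u = map (\<lambda>x. c \<otimes>\<^bsub>R\<^esub> x) v"
      unfolding R.parallel_def by blast
    have ua: "u ! a = c \<otimes>\<^bsub>R\<^esub> v ! a" if "a < k" for a using c(3) v(1) that by simp
    have "u ! a = \<zero>\<^bsub>R\<^esub> \<longleftrightarrow> v ! a = \<zero>\<^bsub>R\<^esub>" if "a < k" for a
      unfolding ua[OF that] using R.nz_mult[OF c(1) vc[OF that] c(2)] c(1) by auto
    moreover have "u ! a \<otimes>\<^bsub>R\<^esub> v ! b = u ! b \<otimes>\<^bsub>R\<^esub> v ! a" if "a < k" "b < k" for a b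
      unfolding ua[OF that(1)] ua[OF that(2)] using c(1) vc that by (simp add: R.m_ac)
    ultimately show "gparallel K u v" unfolding cross by simp
  next
    assume "gparallel K u v"
    then have zero: "(\<forall>a<k. u ! a = \<zero>\<^bsub>R\<^esub>) \<longleftrightarrow> (\<forall>a<k. v ! a = \<zero>\<^bsub>R\<^esub>)"
      and cr: "\<And>a b. a < k \<Longrightarrow> b < k \<Longrightarrow> u ! a \<otimes>\<^bsub>R\<^esub> v ! b = u ! b \<otimes>\<^bsub>R\<^esub> v ! a"
      unfolding cross by blast+
    show "R.parallel u v"
    proof (cases "\<forall>a<k. u ! a = \<zero>\<^bsub>R\<^esub>")
      case True
      then have "u = v" using zero u(1) v(1) by (intro nth_equalityI) auto
      then show ?thesis using R.parallel_refl[OF u(2)] by simp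
    next
      case False
      then obtain a b where a: "a < k" "u ! a \<noteq> \<zero>\<^bsub>R\<^esub>" and b: "b < k" "v ! b \<noteq> \<zero>\<^bsub>R\<^esub>"
        using zero by blast
      \<comment> \<open>Since u_a v_b is nonzero and equals u_b v_a, the entry v_a is nonzero as
        well; then u_a / v_a is the factor of proportionality.\<close>
      have "u ! a \<otimes>\<^bsub>R\<^esub> v ! b \<noteq> \<zero>\<^bsub>R\<^esub>" by (rule R.nz_mult[OF uc[OF a(1)] vc[OF b(1)] a(2) b(2)])
      then have va: "v ! a \<noteq> \<zero>\<^bsub>R\<^esub>" using cr[OF a(1) b(1)] uc[OF b(1)] by auto
      note i = R.nz_inv[OF vc[OF a(1)] va]
      let ?c = "u ! a \<otimes>\<^bsub>R\<^esub> inv\<^bsub>R\<^esub> (v ! a)"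
      have "u ! s = ?c \<otimes>\<^bsub>R\<^esub> v ! s" if "s < k" for s
      proof -
        have "?c \<otimes>\<^bsub>R\<^esub> v ! s = (u ! a \<otimes>\<^bsub>R\<^esub> v ! s) \<otimes>\<^bsub>R\<^esub> inv\<^bsub>R\<^esub> (v ! a)"
          using i(1) uc[OF a(1)] vc[OF that] by (simp add: R.m_ac)
        also have "\<dots> = (u ! s \<otimes>\<^bsub>R\<^esub> v ! a) \<otimes>\<^bsub>R\<^esub> inv\<^bsub>R\<^esub> (v ! a)" using cr[OF a(1) that] by simp
        also have "\<dots> = u ! s" using i uc[OF that] vc[OF a(1)] by (simp add: R.m_assoc)
        finally show ?thesis by simp
      qed
      then have "u = map (\<lambda>x. ?c \<otimes>\<^bsub>R\<^esub> x) v" using u(1) v(1) by (intro nth_equalityI) auto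
      moreover have "?c \<in> carrier R" "?c \<noteq> \<zero>\<^bsub>R\<^esub>"
        using R.nz_mult[OF uc[OF a(1)] i(1) a(2) i(2)] uc[OF a(1)] i(1) by auto
      ultimately show ?thesis unfolding R.parallel_def by blast
    qed
  qed
qed

lemma oracle_matches:
  assumes orc: "LCE_oracle Orc" and F: "R.columns k n F" and G: "R.columns k n G"
    and indF: "independent_rows R (mat_of_columns k F)" and indG: "independent_rows R (mat_of_columns k G)"
  shows "Orc (inst_enc (K, G, F)) \<longleftrightarrow> (\<exists>S \<tau>. R.matches k n F G S \<tau>)"
proof -
  have e: "inst_enc (K, G, F) = enc_instance p f (mat_of_columns k G) (mat_of_columns k F)"
    by (simp add: pair_enc_def enc_instance_def enc_nats_def
        enc_mat_mat_of_columns[OF R.columns_length[OF F]] enc_mat_mat_of_columns[OF R.columns_length[OF G]])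
  have "generator_matrix R k n (mat_of_columns k F)" "generator_matrix R k n (mat_of_columns k G)"
    using R.independent_rows_generator_matrix R.columns_mats F G indF indG by blast+
  then have "Orc (inst_enc (K, G, F)) \<longleftrightarrow> LCE R k n (mat_of_columns k G) (mat_of_columns k F)"
    unfolding e using orc field_GF unfolding LCE_oracle_def by blast
  then show ?thesis using R.LCE_iff_matches[OF F G] by simp
qed

end

section \<open>Equivalences and repeated columns\<close>

context field
begin

lemma matches_closed:
  assumes "columns k n G" "S \<in> GL R k" "j < n"
  shows "length (apply_mat S (G ! j)) = k" "set (apply_mat S (G ! j)) \<subseteq> carrier R"
  using apply_mat_closed[of S k "G ! j"] columns_nth[OF assms(1,3)] assms(2) by (auto simp: GL_def)

lemma matches_point:
  assumes F: "columns k n F" and G: "columns k n G" and m: "matches k n F G S \<tau>" and j: "j < n"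
  shows "\<tau> j < n" "point (F ! j) = point (apply_mat S (G ! \<tau> j))"
proof -
  show t: "\<tau> j < n" using m j by (auto simp: matches_def bij_betw_def)
  have "S \<in> GL R k" "parallel (F ! j) (apply_mat S (G ! \<tau> j))"
    using m j by (auto simp: matches_def)
  then show "point (F ! j) = point (apply_mat S (G ! \<tau> j))"
    using parallel_iff_point columns_nth[OF F j] matches_closed[OF G _ t] by blast
qed

lemma matches_parallel_iff:
  assumes F: "columns k n F" and G: "columns k n G" and m: "matches k n F G S \<tau>" and j: "i < n" "j < n"
  shows "parallel (F ! i) (F ! j) \<longleftrightarrow> parallel (G ! \<tau> i) (G ! \<tau> j)"
proof -
  have S: "S \<in> GL R k" using m by (simp add: matches_def)
  note t = matches_point[OF F G m j(1)] matches_point[OF F G m j(2)]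
  have "parallel (F ! i) (F ! j) \<longleftrightarrow> parallel (apply_mat S (G ! \<tau> i)) (apply_mat S (G ! \<tau> j))"
    using parallel_iff_point columns_nth[OF F] j t matches_closed[OF G S] by simp
  also have "\<dots> \<longleftrightarrow> parallel (G ! \<tau> i) (G ! \<tau> j)"
    using columns_nth[OF G] t by (intro apply_mat_parallel_iff[OF S]) auto
  finally show ?thesis .
qed

lemma columns_map: "columns k n A \<Longrightarrow> set L \<subseteq> I \<Longrightarrow> \<phi> ` I \<subseteq> {..<n} \<Longrightarrow> columns k (length L) (map (\<lambda>l. A ! \<phi> l) L)"
  unfolding columns_def by (fastforce simp: image_subset_iff subset_iff)

text \<open>An equivalence that respects the partial matching sends each appended column to the one
  appended at the same place. So the right candidate is always accepted.\<close>

lemma matches_extend: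
  assumes F: "columns k n F" and G: "columns k n G" and m: "matches k n F G S \<tau>" and L: "set L \<subseteq> I" "I \<subseteq> {..<n}"
    and \<pi>: "\<And>l. l \<in> I \<Longrightarrow> \<tau> l = \<pi> l"
  shows "matches k (n + length L) (F @ map (\<lambda>l. F ! l) L) (G @ map (\<lambda>l. G ! \<pi> l) L) S (\<lambda>j. if j < n then \<tau> j else j)"
  unfolding matches_def
proof (intro conjI allI impI)
  let ?t = "\<lambda>j. if j < n then \<tau> j else j"
  have b: "bij_betw \<tau> {..<n} {..<n}" and S: "S \<in> GL R k" using m by (auto simp: matches_def)
  show "S \<in> GL R k" by (rule S)
  have "bij_betw ?t ({..<n} \<union> {n..<n + length L}) ({..<n} \<union> {n..<n + length L})"
  proof (rule bij_betw_combine)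
    show "bij_betw ?t {..<n} {..<n}"
      using b by (rule bij_betw_cong[THEN iffD1, rotated]) simp
    show "bij_betw ?t {n..<n + length L} {n..<n + length L}"
      by (rule bij_betw_cong[THEN iffD2, OF _ bij_betw_id]) simp
  qed auto
  moreover have "{..<n} \<union> {n..<n + length L} = {..<n + length L}" by auto
  ultimately show "bij_betw ?t {..<n + length L} {..<n + length L}" by simp
  fix j assume j: "j < n + length L"
  show "parallel ((F @ map (\<lambda>l. F ! l) L) ! j) (apply_mat S ((G @ map (\<lambda>l. G ! \<pi> l) L) ! ?t j))"
  proof (cases "j < n")
    case True
    then show ?thesis
      using m matches_point(1)[OF F G m True] F G by (simp add: matches_def nth_append columns_def)
  next
    case False
    have "L ! (j - n) \<in> I" using L j False by (auto simp: subset_iff)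
    then have "L ! (j - n) < n" "\<tau> (L ! (j - n)) = \<pi> (L ! (j - n))" using L(2) \<pi> by auto
    then show ?thesis
      using m j False F G by (auto simp: matches_def nth_append columns_def)
  qed
qed

text \<open>The permutation of extended codes may mix original and appended columns, and only this
  multiset equation is used of it.\<close>

lemma matches_mset:
  assumes F: "columns k n F" and G: "columns k n G" and m: "matches k n F G S \<tau>"
  shows "mset (map point F) = mset (map (\<lambda>u. point (apply_mat S u)) G)"
proof -
  have b: "bij_betw \<tau> {..<n} {..<n}" using m by (simp add: matches_def)
  have "mset (map point F) = image_mset (\<lambda>j. point (F ! j)) (mset_set {..<n})"
    using F by (simp only: mset_map_nth columns_def)
  also have "\<dots> = image_mset (\<lambda>j. point (apply_mat S (G ! j))) (image_mset \<tau> (mset_set {..<n}))"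
    unfolding multiset.map_comp comp_def using matches_point(2)[OF F G m] by (intro image_mset_cong) simp
  also have "image_mset \<tau> (mset_set {..<n}) = mset_set {..<n}"
    using image_mset_mset_set[OF bij_betw_imp_inj_on[OF b]] bij_betw_imp_surj_on[OF b] by simp
  also have "image_mset (\<lambda>j. point (apply_mat S (G ! j))) (mset_set {..<n}) = mset (map (\<lambda>u. point (apply_mat S u)) G)"
    using G by (simp only: mset_map_nth columns_def)
  finally show ?thesis .
qed

end

context gf
begin

lemma gweight_eq:
  assumes F: "R.columns k n F" and l: "l < n"
  shows "gweight K F l = (if \<forall>m. l < m \<and> m < n \<longrightarrow> R.point (F ! l) \<noteq> R.point (F ! m) then (n + 1) * (n - l) else 0)"
proof -
  have len: "length F = n" using F by (simp add: R.columns_def)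
  have "gparallel K (nth_default [] F l) (nth_default [] F m) \<longleftrightarrow> R.point (F ! l) = R.point (F ! m)" if "m < n" for m
    using l that len gparallel[of "F ! l" k "F ! m"] R.parallel_iff_point R.columns_nth[OF F] by (simp add: nth_default_nth)
  then have "list_all (\<lambda>m. \<not> (l < m \<and> gparallel K (nth_default [] F l) (nth_default [] F m))) [0..<length F] \<longleftrightarrow>
      (\<forall>m. l < m \<and> m < n \<longrightarrow> R.point (F ! l) \<noteq> R.point (F ! m))"
    unfolding list_all_upt len by blast
  then show ?thesis unfolding gweight_def len by (rule if_cong) simp_all
qed

text \<open>The invariant is that some equivalence agrees with the matching so far. Its own choice
  for column i passes the test; conversely any accepted candidate yields, through the weights, an
  equivalence of the original codes agreeing with the longer matching. This may be a different
  one.\<close>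

lemma gfind_correct:
  assumes orc: "LCE_oracle Orc" and F: "R.columns k n F" and G: "R.columns k n G"
    and indF: "independent_rows R (mat_of_columns k F)" and indG: "independent_rows R (mat_of_columns k G)"
    and i: "i < n" and js: "length js = n - Suc i"
    and m: "R.matches k n F G S \<tau>" and \<tau>: "\<And>l. i < l \<Longrightarrow> l < n \<Longrightarrow> \<tau> l = js ! (l - i - 1)"
  shows "\<exists>S' \<tau>'. R.matches k n F G S' \<tau>' \<and> (\<forall>l. i \<le> l \<and> l < n \<longrightarrow> \<tau>' l = (gfind Orc K F G i js # js) ! (l - i))"
proof -
  have lenF: "length F = n" and lenG: "length G = n" using F G by (auto simp: R.columns_def)
  define L where "L = concat (map (\<lambda>l. replicate (gweight K F l) l) [i..<n])"
  have L: "set L \<subseteq> {i..<n}" by (auto simp: L_def)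
  have bij: "bij_betw \<tau> {..<n} {..<n}" using m by (simp add: R.matches_def)
  have js_nth: "js ! s = \<tau> (Suc i + s)" if "s < length js" for s
    using \<tau>[of "Suc i + s"] that js by simp
  have set_js: "set js = \<tau> ` {i<..<n}"
  proof (intro equalityI subsetI)
    fix x assume "x \<in> set js"
    then obtain s where "s < length js" "x = js ! s" by (auto simp: in_set_conv_nth)
    then show "x \<in> \<tau> ` {i<..<n}" using js_nth[of s] js i by (intro image_eqI[of _ _ "Suc i + s"]) auto
  next
    fix x assume "x \<in> \<tau> ` {i<..<n}"
    then obtain l where l: "i < l" "l < n" "x = \<tau> l" by auto
    then show "x \<in> set js" unfolding l(3) \<tau>[OF l(1,2)] using js by (intro nth_mem) simp
  qed
  have js_lt: "set js \<subseteq> {..<n}" unfolding set_js using bij by (auto simp: bij_betw_def)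
  have distinct_js: "distinct js"
    unfolding distinct_conv_nth
  proof (intro allI impI)
    fix s t assume st: "s < length js" "t < length js" "s \<noteq> t"
    then have "\<tau> (Suc i + s) \<noteq> \<tau> (Suc i + t)"
      using inj_on_eq_iff[OF bij_betw_imp_inj_on[OF bij], of "Suc i + s" "Suc i + t"] js by simp
    then show "js ! s \<noteq> js ! t" using js_nth st by simp
  qed
  define FE where "FE = F @ map (\<lambda>l. F ! l) L"
  define GE where "GE = (\<lambda>j. G @ map (\<lambda>l. G ! ((j # js) ! (l - i))) L)"
  have FE: "gextend K F i F (map (\<lambda>l. l + i) [0..<length F - i]) = FE"
  proof -
    have "gextend K F i F (map (\<lambda>l. l + i) [0..<length F - i]) = F @ map (\<lambda>l. F ! (map (\<lambda>l. l + i) [0..<length F - i] ! (l - i))) L"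
      unfolding L_def by (rule gextend_eq) (use lenF i in auto)
    also have "map (\<lambda>l. F ! (map (\<lambda>l. l + i) [0..<length F - i] ! (l - i))) L = map (\<lambda>l. F ! l) L"
      using L lenF by (intro map_cong refl) (auto simp: subset_iff diff_less_mono)
    finally show ?thesis by (simp add: FE_def)
  qed
  have GE: "gextend K F i G (j # js) = GE j" if "j < n" for j
    unfolding L_def GE_def by (rule gextend_eq) (use lenF lenG i js js_lt that in auto)
  have ran: "(\<lambda>l. (j # js) ! (l - i)) ` {i..<n} \<subseteq> {..<n}" if "j < n" for j
  proof (intro subsetI, elim imageE)
    fix x l assume l: "x = (j # js) ! (l - i)" "l \<in> {i..<n}"
    have "l - i < length (j # js)" using l(2) js i by (simp, arith)
    then have "(j # js) ! (l - i) \<in> set (j # js)" by (rule nth_mem)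
    then show "x \<in> {..<n}" using l(1) js_lt that by auto
  qed
  have cF: "R.columns k (length L) (map (\<lambda>l. F ! l) L)"
    by (rule R.columns_map[OF F L, of "\<lambda>l. l"]) auto
  have cG: "R.columns k (length L) (map (\<lambda>l. G ! ((j # js) ! (l - i))) L)" if "j < n" for j
    by (rule R.columns_map[OF G L ran[OF that]])
  have cFE: "R.columns k (n + length L) FE" unfolding FE_def by (rule R.columns_append[OF F cF])
  have cGE: "R.columns k (n + length L) (GE j)" if "j < n" for j
    unfolding GE_def by (rule R.columns_append[OF G cG[OF that]])
  have orc_iff: "Orc (inst_enc (K, GE j, FE)) \<longleftrightarrow> (\<exists>S \<tau>. R.matches k (n + length L) FE (GE j) S \<tau>)" if j: "j < n" for j
  proof (rule oracle_matches[OF orc cFE cGE[OF j]])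
    show "independent_rows R (mat_of_columns k FE)"
      unfolding FE_def by (rule R.independent_rows_append[OF F cF indF])
    show "independent_rows R (mat_of_columns k (GE j))"
      unfolding GE_def by (rule R.independent_rows_append[OF G cG[OF j] indG])
  qed
  have par: "gparallel K (nth_default [] A a) (nth_default [] A b) \<longleftrightarrow> R.parallel (A ! a) (A ! b)"
    if "R.columns k n A" "a < n" "b < n" for A a b
  proof -
    have "length A = n" using that(1) by (simp add: R.columns_def)
    then show ?thesis using gparallel[of "A ! a" k "A ! b"] R.columns_nth[OF that(1)] that by (simp add: nth_default_nth)
  qed
  have js_l: "js ! (l - i - 1) < n" "nth_default 0 js (l - i - 1) = js ! (l - i - 1)" if "i < l" "l < n" for l
  proof -
    have "l - i - 1 < length js" using that js by simp
    then show "js ! (l - i - 1) < n" "nth_default 0 js (l - i - 1) = js ! (l - i - 1)"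
      using js_lt nth_mem by (force simp: nth_default_nth)+
  qed
  have test: "gtest Orc K F G i js j \<longleftrightarrow> j \<notin> set js \<and>
      (\<forall>l. i < l \<and> l < n \<longrightarrow> (R.parallel (F ! l) (F ! i) \<longleftrightarrow> R.parallel (G ! (js ! (l - i - 1))) (G ! j))) \<and>
      (\<exists>S \<tau>. R.matches k (n + length L) FE (GE j) S \<tau>)" if j: "j < n" for j
  proof -
    have "(i < l \<and> \<not> (gparallel K (nth_default [] F l) (nth_default [] F i) =
        gparallel K (nth_default [] G (nth_default 0 js (l - i - 1))) (nth_default [] G j))) \<longleftrightarrow>
      (i < l \<and> \<not> (R.parallel (F ! l) (F ! i) \<longleftrightarrow> R.parallel (G ! (js ! (l - i - 1))) (G ! j)))" if "l < n" for l
      using js_l[OF _ that] par[OF F that i] par[OF G _ j] by (cases "i < l") simp_all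
    then show ?thesis
      unfolding gtest_def list_all_upt lenF[symmetric] FE GE[OF j, unfolded lenF[symmetric]]
      using orc_iff[OF j] by (simp add: lenF) blast
  qed
  have ti: "\<tau> i < n" using bij i by (auto simp: bij_betw_def)
  have "gtest Orc K F G i js (\<tau> i)"
    unfolding test[OF ti]
  proof (intro conjI allI impI)
    show "\<tau> i \<notin> set js"
      unfolding set_js using inj_on_eq_iff[OF bij_betw_imp_inj_on[OF bij], of i] i by force
    show "R.parallel (F ! l) (F ! i) \<longleftrightarrow> R.parallel (G ! (js ! (l - i - 1))) (G ! \<tau> i)" if "i < l \<and> l < n" for l
      using R.matches_parallel_iff[OF F G m, of l i] \<tau>[of l] that i by simp
    have "\<tau> l = (\<tau> i # js) ! (l - i)" if "l \<in> {i..<n}" for l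
      using \<tau>[of l] that by (cases "l = i") (auto simp: nth_Cons')
    from R.matches_extend[OF F G m L _ this]
    show "\<exists>S \<tau>'. R.matches k (n + length L) FE (GE (\<tau> i)) S \<tau>'"
      unfolding FE_def GE_def by force
  qed
  then have "\<exists>j\<in>set [0..<length F]. gtest Orc K F G i js j" using ti lenF by auto
  from foldr_find[where P = "gtest Orc K F G i js", OF this, of 0]
  have found: "gtest Orc K F G i js (gfind Orc K F G i js)" "gfind Orc K F G i js < n"
    unfolding gfind_def by (auto simp: lenF)
  define j where "j = gfind Orc K F G i js"
  have j: "j < n" and jt: "j \<notin> set js"
    "\<And>l. i < l \<Longrightarrow> l < n \<Longrightarrow> R.parallel (F ! l) (F ! i) \<longleftrightarrow> R.parallel (G ! (js ! (l - i - 1))) (G ! j)"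
    using found test[of j] by (auto simp: j_def)
  obtain S' \<tau>' where m': "R.matches k (n + length L) FE (GE j) S' \<tau>'"
    using found(1) test[OF j] j_def by blast
  have S': "S' \<in> GL R k" using m' by (simp add: R.matches_def)
  define \<pi> where "\<pi> = (\<lambda>l. (j # js) ! (l - i))"
  have \<pi>i: "\<pi> i = j" by (simp add: \<pi>_def)
  have \<pi>l: "\<pi> l = js ! (l - i - 1)" "\<pi> l = \<tau> l" if "i < l" "l < n" for l
    using that \<tau>[OF that] by (auto simp: \<pi>_def nth_Cons')
  have \<pi>lt: "\<pi> l < n" if "l \<in> {i..<n}" for l using ran[OF j] that unfolding \<pi>_def by blast
  let ?u = "\<lambda>l. R.point (F ! l)" and ?v = "\<lambda>l. R.point (R.apply_mat S' (G ! l))"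
  have v_iff: "?v a = ?v b \<longleftrightarrow> R.parallel (G ! a) (G ! b)" if "a < n" "b < n" for a b
    using R.apply_mat_parallel_iff[OF S'] R.columns_nth[OF G] R.parallel_iff_point R.matches_closed[OF G S'] that by metis
  have u_iff: "?u a = ?u b \<longleftrightarrow> R.parallel (F ! a) (F ! b)" if "a < n" "b < n" for a b
    using R.columns_nth[OF F] R.parallel_iff_point that by metis
  have sym: "R.parallel (F ! a) (F ! b) \<longleftrightarrow> R.parallel (F ! b) (F ! a)"
    "R.parallel (G ! a) (G ! b) \<longleftrightarrow> R.parallel (G ! b) (G ! a)" if "a < n" "b < n" for a b
    using u_iff v_iff that by metis+
  \<comment> \<open>Only the matrix S' is kept from the answer for the extended codes. A permutation
    of the original columns that fits S' and the matching is rebuilt from multiplicities.\<close>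
  obtain \<tau>'' where t: "bij_betw \<tau>'' {..<n} {..<n}" "\<And>l. l \<in> {i..<n} \<Longrightarrow> \<tau>'' l = \<pi> l" "\<And>l. l < n \<Longrightarrow> ?u l = ?v (\<tau>'' l)"
  proof (rule weighted_classes[of i n \<pi> ?u ?v "gweight K F"])
    show "i \<le> n" using i by simp
    show "inj_on \<pi> {i..<n}"
    proof (rule inj_onI)
      fix a b assume ab: "a \<in> {i..<n}" "b \<in> {i..<n}" "\<pi> a = \<pi> b"
      have "distinct (j # js)" using distinct_js jt(1) by simp
      moreover have "a - i < length (j # js)" "b - i < length (j # js)" using ab js i by (simp, arith)+
      ultimately have "a - i = b - i" using ab(3) unfolding \<pi>_def by (metis nth_eq_iff_index_eq)
      then show "a = b" using ab by auto
    qed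
    show "\<pi> ` {i..<n} \<subseteq> {..<n}" using \<pi>lt by auto
    show "?u l = ?u m \<longleftrightarrow> ?v (\<pi> l) = ?v (\<pi> m)" if lm: "l \<in> {i..<n}" "m \<in> {i..<n}" for l m
    proof -
      have lt: "l < n" "m < n" using lm by auto
      \<comment> \<open>Pairs involving i are covered by the explicit check in \<open>gtest\<close>,
        all other pairs by the old equivalence \<open>\<tau>\<close>.\<close>
      have "R.parallel (F ! l) (F ! m) \<longleftrightarrow> R.parallel (G ! \<pi> l) (G ! \<pi> m)"
      proof (cases "l = i"; cases "m = i")
        assume "l = i" "m = i"
        then show ?thesis using u_iff[of i i] v_iff[of j j] i j \<pi>i by simp
      next
        assume "l = i" "m \<noteq> i"
        then have "i < m" using lm by simp
        then show ?thesis using jt(2)[OF _ lt(2)] sym[OF lt] sym(2)[OF j \<pi>lt[OF lm(2)]] \<pi>l[OF _ lt(2)] \<open>l = i\<close> \<pi>i by simp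
      next
        assume "l \<noteq> i" "m = i"
        then have "i < l" using lm by simp
        then show ?thesis using jt(2)[OF _ lt(1)] \<pi>l[OF _ lt(1)] \<open>m = i\<close> \<pi>i by simp
      next
        assume "l \<noteq> i" "m \<noteq> i"
        then have "i < l" "i < m" using lm by auto
        then show ?thesis using R.matches_parallel_iff[OF F G m lt] \<pi>l(2)[OF _ lt(1)] \<pi>l(2)[OF _ lt(2)] by simp
      qed
      then show ?thesis using u_iff[OF lt] v_iff[OF \<pi>lt[OF lm(1)] \<pi>lt[OF lm(2)]] by simp
    qed
    show "gweight K F l = (if \<forall>m. l < m \<and> m < n \<longrightarrow> ?u l \<noteq> ?u m then (n + 1) * (n - l) else 0)" if "l < n" for l
      by (rule gweight_eq[OF F that])
    have "mset (map R.point FE) = image_mset ?u (mset_set {..<n}) + (\<Sum>l\<in>{i..<n}. replicate_mset (gweight K F l) (?u l))"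
      unfolding FE_def map_append mset_append map_map comp_def L_def
        mset_map_concat_replicate[OF distinct_upt] mset_map_nth[of _ F] lenF by simp
    moreover have "mset (map (\<lambda>u. R.point (R.apply_mat S' u)) (GE j)) =
        image_mset ?v (mset_set {..<n}) + (\<Sum>l\<in>{i..<n}. replicate_mset (gweight K F l) (?v (\<pi> l)))"
      unfolding GE_def map_append mset_append map_map comp_def L_def \<pi>_def
        mset_map_concat_replicate[OF distinct_upt] mset_map_nth[of _ G] lenG by simp
    ultimately show "image_mset ?u (mset_set {..<n}) + (\<Sum>l\<in>{i..<n}. replicate_mset (gweight K F l) (?u l)) =
        image_mset ?v (mset_set {..<n}) + (\<Sum>l\<in>{i..<n}. replicate_mset (gweight K F l) (?v (\<pi> l)))"
      using R.matches_mset[OF cFE cGE[OF j] m'] by simp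
  qed (rule that)
  have "R.matches k n F G S' \<tau>''"
    unfolding R.matches_def
  proof (intro conjI S' t(1) allI impI)
    fix l assume l: "l < n"
    have "\<tau>'' l < n" using t(1) l by (auto simp: bij_betw_def)
    then show "R.parallel (F ! l) (R.apply_mat S' (G ! \<tau>'' l))"
      using t(3)[OF l] R.parallel_iff_point R.columns_nth[OF F l] R.matches_closed[OF G S'] by blast
  qed
  moreover have "\<forall>l. i \<le> l \<and> l < n \<longrightarrow> \<tau>'' l = (gfind Orc K F G i js # js) ! (l - i)"
    using t(2) by (simp add: \<pi>_def j_def)
  ultimately show ?thesis by blast
qed

text \<open>Downward induction on i. For i = n nothing is matched yet and any equivalence
  serves.\<close>

lemma gmatch_correct:
  assumes orc: "LCE_oracle Orc" and F: "R.columns k n F" and G: "R.columns k n G"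
    and indF: "independent_rows R (mat_of_columns k F)" and indG: "independent_rows R (mat_of_columns k G)"
    and m: "R.matches k n F G S0 \<tau>0"
  shows "length (gmatch Orc K F G) = n \<and> (\<exists>S \<tau>. R.matches k n F G S \<tau> \<and> (\<forall>l<n. \<tau> l = gmatch Orc K F G ! l))"
proof -
  let ?g = "\<lambda>i. foldr (\<lambda>i js. gfind Orc K F G i js # js) [i..<n] []"
  have "length (?g i) = n - i \<and> (\<exists>S \<tau>. R.matches k n F G S \<tau> \<and> (\<forall>l. i \<le> l \<and> l < n \<longrightarrow> \<tau> l = ?g i ! (l - i)))" if "i \<le> n" for i
    using that
  proof (induction rule: inc_induct)
    case base
    then show ?case using m by auto
  next
    case (step i)
    have g: "?g i = gfind Orc K F G i (?g (Suc i)) # ?g (Suc i)"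
      using step(2) by (simp add: upt_conv_Cons)
    obtain S \<tau> where "R.matches k n F G S \<tau>" "\<And>l. i < l \<Longrightarrow> l < n \<Longrightarrow> \<tau> l = ?g (Suc i) ! (l - i - 1)"
      using step(3) by auto
    moreover have "length (?g (Suc i)) = n - Suc i" using step(3) by simp
    ultimately show ?case
      unfolding g using gfind_correct[OF orc F G indF indG step(2)] step(2) by simp
  qed
  from this[of 0] show ?thesis using F by (simp add: gmatch_def R.columns_def)
qed

end

section \<open>Kernels of linear systems\<close>

context field
begin

definition lvec :: "nat \<Rightarrow> 'a list \<Rightarrow> bool" where
  "lvec m v \<longleftrightarrow> length v = m \<and> set v \<subseteq> carrier R"

definition dot :: "nat \<Rightarrow> 'a list \<Rightarrow> 'a list \<Rightarrow> 'a" where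
  "dot m u v = (\<Oplus>s\<in>{..<m}. u ! s \<otimes> v ! s)"

definition sub_mult :: "'a \<Rightarrow> 'a list \<Rightarrow> 'a list \<Rightarrow> 'a list" where
  "sub_mult c w v = map (\<lambda>s. v ! s \<ominus> c \<otimes> w ! s) [0..<length v]"

lemma lvec_nth [simp]: "lvec m v \<Longrightarrow> s < m \<Longrightarrow> v ! s \<in> carrier R"
  by (auto simp: lvec_def subset_iff)

lemma lvec_length: "lvec m v \<Longrightarrow> length v = m"
  by (simp add: lvec_def)

lemma lvec_map_upt: "(\<And>s. s < m \<Longrightarrow> h s \<in> carrier R) \<Longrightarrow> lvec m (map h [0..<m])"
  by (auto simp: lvec_def)

lemma lvec_eqI: "lvec m u \<Longrightarrow> lvec m v \<Longrightarrow> (\<And>s. s < m \<Longrightarrow> u ! s = v ! s) \<Longrightarrow> u = v"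
  by (intro nth_equalityI) (auto simp: lvec_def)

lemma dot_closed [simp]: "lvec m u \<Longrightarrow> lvec m v \<Longrightarrow> dot m u v \<in> carrier R"
  by (auto simp: dot_def intro!: finsum_closed)

lemma lvec_sub_mult: "c \<in> carrier R \<Longrightarrow> lvec m w \<Longrightarrow> lvec m v \<Longrightarrow> lvec m (sub_mult c w v)"
  unfolding sub_mult_def by (simp add: lvec_length lvec_map_upt)

lemma sub_mult_nth: "lvec m v \<Longrightarrow> s < m \<Longrightarrow> sub_mult c w v ! s = v ! s \<ominus> c \<otimes> w ! s"
  by (simp add: sub_mult_def lvec_length)

lemma dot_sub_mult:
  assumes c: "c \<in> carrier R" and l: "lvec m l" and w: "lvec m w" and v: "lvec m v"
  shows "dot m l (sub_mult c w v) = dot m l v \<ominus> c \<otimes> dot m l w"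
proof -
  have "dot m l (sub_mult c w v) = (\<Oplus>s\<in>{..<m}. l ! s \<otimes> v ! s \<oplus> (\<ominus> c) \<otimes> (l ! s \<otimes> w ! s))"
    unfolding dot_def
  proof (intro finsum_cong')
    fix s assume "s \<in> {..<m}"
    then have s: "l ! s \<in> carrier R" "w ! s \<in> carrier R" "v ! s \<in> carrier R" "s < m" using l w v by auto
    show "l ! s \<otimes> sub_mult c w v ! s = l ! s \<otimes> v ! s \<oplus> (\<ominus> c) \<otimes> (l ! s \<otimes> w ! s)"
      unfolding sub_mult_nth[OF v s(4)] using s c by (simp add: minus_eq r_distr r_minus l_minus m_lcomm)
  qed (use c l w v in auto)
  also have "\<dots> = (\<Oplus>s\<in>{..<m}. l ! s \<otimes> v ! s) \<oplus> (\<Oplus>s\<in>{..<m}. (\<ominus> c) \<otimes> (l ! s \<otimes> w ! s))"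
    using c l w v by (intro finsum_addf) auto
  also have "(\<Oplus>s\<in>{..<m}. (\<ominus> c) \<otimes> (l ! s \<otimes> w ! s)) = (\<ominus> c) \<otimes> dot m l w"
    unfolding dot_def using c l w by (intro finsum_rdistr[symmetric]) auto
  finally show ?thesis
    unfolding dot_def[of m l v, symmetric] using c l w v by (simp add: minus_eq l_minus)
qed

definition solves :: "nat \<Rightarrow> 'a list list \<Rightarrow> 'a list \<Rightarrow> bool" where
  "solves m eqs x \<longleftrightarrow> lvec m x \<and> (\<forall>l\<in>set eqs. dot m l x = \<zero>)"

lemma solves_lvec: "solves m eqs x \<Longrightarrow> lvec m x"
  by (simp add: solves_def)

lemma solves_sub_mult:
  assumes "\<forall>l\<in>set eqs. lvec m l" "c \<in> carrier R" "solves m eqs w" "solves m eqs v"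
  shows "solves m eqs (sub_mult c w v)"
  using assms by (auto simp: solves_def dot_sub_mult lvec_sub_mult minus_eq)

text \<open>
  The last condition on tags is what preferring pivots with large tags achieves: once the second block of
  coordinates (from n on) is determined by the first, all remaining tags lie in the first block.
\<close>

definition tagged :: "nat \<Rightarrow> nat \<Rightarrow> 'a list list \<Rightarrow> (nat \<times> 'a list) list \<Rightarrow> nat \<Rightarrow> 'a list \<Rightarrow> bool" where
  "tagged m n eqs V t v \<longleftrightarrow> t < m \<and> solves m eqs v \<and> v ! t = \<one> \<and>
     (\<forall>t' v'. (t', v') \<in> set V \<longrightarrow> t' \<noteq> t \<longrightarrow> v ! t' = \<zero>) \<and> (n \<le> t \<longrightarrow> (\<forall>s<n. v ! s = \<zero>))"

text \<open>A reduced basis. Spanning is expressed by the last condition: a solution minus the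
  combination of basis vectors with its own values at the tags vanishes at all tags, hence
  everywhere.\<close>

definition kernel_basis :: "nat \<Rightarrow> nat \<Rightarrow> 'a list list \<Rightarrow> (nat \<times> 'a list) list \<Rightarrow> bool" where
  "kernel_basis m n eqs V \<longleftrightarrow> sorted_wrt (<) (map fst V) \<and>
     (\<forall>t v. (t, v) \<in> set V \<longrightarrow> tagged m n eqs V t v) \<and>
     (\<forall>x. solves m eqs x \<longrightarrow> (\<forall>t v. (t, v) \<in> set V \<longrightarrow> x ! t = \<zero>) \<longrightarrow> (\<forall>s<m. x ! s = \<zero>))"

lemma kernel_basisI:
  assumes "sorted_wrt (<) (map fst V)" "\<And>t v. (t, v) \<in> set V \<Longrightarrow> tagged m n eqs V t v"
    "\<And>x s. solves m eqs x \<Longrightarrow> (\<And>t v. (t, v) \<in> set V \<Longrightarrow> x ! t = \<zero>) \<Longrightarrow> s < m \<Longrightarrow> x ! s = \<zero>"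
  shows "kernel_basis m n eqs V"
  unfolding kernel_basis_def
proof (intro conjI allI impI)
  fix x s assume "solves m eqs x" "\<forall>t v. (t, v) \<in> set V \<longrightarrow> x ! t = \<zero>" "s < m"
  from this(1) _ this(3) show "x ! s = \<zero>"
  proof (rule assms(3))
    fix t v assume "(t, v) \<in> set V"
    then show "x ! t = \<zero>" using \<open>\<forall>t v. (t, v) \<in> set V \<longrightarrow> x ! t = \<zero>\<close> by blast
  qed
next
  show "sorted_wrt (<) (map fst V)" by (rule assms(1))
  show "tagged m n eqs V t v" if "(t, v) \<in> set V" for t v using that by (rule assms(2))
qed

lemma kernel_basisD:
  assumes "kernel_basis m n eqs V" "(t, v) \<in> set V"
  shows "t < m" "solves m eqs v" "v ! t = \<one>" "\<And>t' v'. (t', v') \<in> set V \<Longrightarrow> t' \<noteq> t \<Longrightarrow> v ! t' = \<zero>"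
    "n \<le> t \<Longrightarrow> s < n \<Longrightarrow> v ! s = \<zero>"
proof -
  have "tagged m n eqs V t v" using assms unfolding kernel_basis_def by simp
  then show "t < m" "solves m eqs v" "v ! t = \<one>" "\<And>t' v'. (t', v') \<in> set V \<Longrightarrow> t' \<noteq> t \<Longrightarrow> v ! t' = \<zero>"
    "n \<le> t \<Longrightarrow> s < n \<Longrightarrow> v ! s = \<zero>"
    unfolding tagged_def by blast+
qed

lemma kernel_basis_unique:
  assumes "kernel_basis m n eqs V" "solves m eqs x" "\<And>t v. (t, v) \<in> set V \<Longrightarrow> x ! t = \<zero>" "s < m"
  shows "x ! s = \<zero>"
proof -
  have "\<forall>t v. (t, v) \<in> set V \<longrightarrow> x ! t = \<zero>" using assms(3) by blast
  moreover have "\<forall>x. solves m eqs x \<longrightarrow> (\<forall>t v. (t, v) \<in> set V \<longrightarrow> x ! t = \<zero>) \<longrightarrow> (\<forall>s<m. x ! s = \<zero>)"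
    using assms(1) unfolding kernel_basis_def by (elim conjE)
  ultimately show ?thesis using assms(2,4) by blast
qed

text \<open>One elimination step with the last vector w that violates l as pivot. The vectors in
  \<open>V2\<close> satisfy l, so their coefficient is 0 and one formula serves both blocks.\<close>

lemma kernel_basis_step:
  assumes kb: "kernel_basis m n eqs V" and eqs: "\<forall>l\<in>set eqs. lvec m l" and l: "lvec m l"
    and V: "V = V1 @ (t0, w) # V2" and V2: "\<And>t v. (t, v) \<in> set V2 \<Longrightarrow> dot m l v = \<zero>"
    and w: "dot m l w \<noteq> \<zero>" and c: "c \<in> carrier R" "c \<otimes> dot m l w = \<one>"
  shows "kernel_basis m n (l # eqs) (map (\<lambda>tv. (fst tv, sub_mult (dot m l (snd tv) \<otimes> c) w (snd tv))) (V1 @ V2))"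
    (is "kernel_basis _ _ _ (map ?e _)")
proof -
  have w0: "(t0, w) \<in> set V" by (simp add: V)
  note wD = kernel_basisD[OF kb w0]
  have wl: "lvec m w" using wD(2) by (rule solves_lvec)
  have sorted: "sorted_wrt (<) (map fst V1 @ t0 # map fst V2)"
    using kb unfolding kernel_basis_def V by simp
  have sub: "(t, v) \<in> set V \<and> t \<noteq> t0" if "(t, v) \<in> set (V1 @ V2)" for t v
  proof -
    have "t \<in> fst ` set V1 \<or> t \<in> fst ` set V2" using that by force
    then have "t \<noteq> t0" using sorted by (auto simp: sorted_wrt_append)
    then show ?thesis using that by (auto simp: V)
  qed
  have pt: "\<exists>v. (t, v) \<in> set (V1 @ V2) \<and> v' = sub_mult (dot m l v \<otimes> c) w v"
    if "(t, v') \<in> set (map ?e (V1 @ V2))" for t v'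
    using that by force
  have vals: "tagged m n (l # eqs) (map ?e (V1 @ V2)) t v'"
    if tv': "(t, v') \<in> set (map ?e (V1 @ V2))" for t v'
  proof -
    obtain v where v: "(t, v) \<in> set (V1 @ V2)" "v' = sub_mult (dot m l v \<otimes> c) w v"
      using pt[OF tv'] by blast
    have tv: "(t, v) \<in> set V" "t \<noteq> t0" using sub[OF v(1)] by auto
    note vD = kernel_basisD[OF kb tv(1)]
    have vl: "lvec m v" using vD(2) by (rule solves_lvec)
    let ?c = "dot m l v \<otimes> c"
    have cc: "?c \<in> carrier R" using l vl c by simp
    have nth: "v' ! s = v ! s \<ominus> ?c \<otimes> w ! s" if "s < m" for s
      unfolding v(2) by (rule sub_mult_nth[OF vl that])
    have "dot m l v' = dot m l v \<ominus> ?c \<otimes> dot m l w"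
      unfolding v(2) by (rule dot_sub_mult[OF cc l wl vl])
    also have "?c \<otimes> dot m l w = dot m l v" using c l vl wl by (simp add: m_assoc)
    also have "dot m l v \<ominus> dot m l v = \<zero>" using l vl by (simp add: minus_eq r_neg)
    finally have "solves m (l # eqs) v'"
      using solves_sub_mult[OF eqs cc wD(2) vD(2)] by (simp add: solves_def v(2))
    moreover have "v' ! t = \<one>"
      using nth[OF vD(1)] vD(3) wD(4)[OF tv] cc by (simp add: minus_eq)
    moreover have "v' ! t' = \<zero>" if t': "(t', v'') \<in> set (map ?e (V1 @ V2))" "t' \<noteq> t" for t' v''
    proof -
      obtain u where "(t', u) \<in> set (V1 @ V2)" using pt[OF t'(1)] by blast
      then have u: "(t', u) \<in> set V" "t' \<noteq> t0" using sub by auto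
      show ?thesis
        using nth[OF kernel_basisD(1)[OF kb u(1)]] vD(4)[OF u(1) t'(2)] wD(4)[OF u] cc by (simp add: minus_eq)
    qed
    moreover have "v' ! s = \<zero>" if s: "n \<le> t" "s < n" for s
    proof -
      have sm: "s < m" using s vD(1) by simp
      \<comment> \<open>Here the choice of the last pivot counts: a vector before it has a smaller
        tag, so n \<le> t gives n \<le> t0 and w itself vanishes on the first block; behind it the
        coefficient is 0.\<close>
      have "?c \<otimes> w ! s = \<zero>"
      proof (cases "(t, v) \<in> set V1")
        case True
        then have "t < t0" using sorted by (force simp: sorted_wrt_append)
        then show ?thesis using wD(5)[of s] s cc by simp
      next
        case False
        then show ?thesis using V2[of t v] v(1) c wl sm by simp
      qed
      then show ?thesis using nth[OF sm] vD(5)[OF s] by (simp add: minus_eq)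
    qed
    ultimately show ?thesis using vD(1) unfolding tagged_def by blast
  qed
  have uniq: "x ! s = \<zero>"
    if x: "solves m (l # eqs) x" and zero: "\<And>t v. (t, v) \<in> set (map ?e (V1 @ V2)) \<Longrightarrow> x ! t = \<zero>" and s: "s < m" for x s
  proof -
    have xl: "lvec m x" and xe: "solves m eqs x" and lx: "dot m l x = \<zero>" using x by (auto simp: solves_def)
    let ?a = "x ! t0"
    have a: "?a \<in> carrier R" using xl wD(1) by simp
    \<comment> \<open>Subtracting x(t0) w makes the old solution x vanish at all old tags, so x =
      x(t0) w. Since l kills x but not w, the factor is 0.\<close>
    let ?y = "sub_mult ?a w x"
    have y: "?y ! s = \<zero>" if "s < m" for s
    proof (rule kernel_basis_unique[OF kb solves_sub_mult[OF eqs a wD(2) xe] _ that])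
      fix t v assume tv: "(t, v) \<in> set V"
      note tm = kernel_basisD(1)[OF kb tv]
      show "?y ! t = \<zero>"
      proof (cases "t = t0")
        case True
        then show ?thesis using sub_mult_nth[OF xl tm, of ?a w] wD(3) a by (simp add: minus_eq r_neg)
      next
        case False
        have "(t, v) \<in> set (V1 @ V2)" using tv False by (auto simp: V)
        then have "x ! t = \<zero>" by (intro zero[of t "snd (?e (t, v))"]) force
        then show ?thesis using sub_mult_nth[OF xl tm, of ?a w] wD(4)[OF tv False] a by (simp add: minus_eq)
      qed
    qed
    have "dot m l ?y = \<zero>"
      unfolding dot_def using y l by (intro add.finprod_one_eqI) simp
    moreover have "dot m l ?y = dot m l x \<ominus> ?a \<otimes> dot m l w" by (rule dot_sub_mult[OF a l wl xl])
    ultimately have "?a \<otimes> dot m l w = \<zero>" using lx a l wl by (simp add: minus_eq)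
    then have "?a = \<zero>" using integral[OF _ a dot_closed[OF l wl]] w by simp
    then show "x ! s = \<zero>" using y[OF s] sub_mult_nth[OF xl s, of ?a w] xl wl s by (simp add: minus_eq)
  qed
  have "map fst (map ?e (V1 @ V2)) = map fst V1 @ map fst V2" by simp
  moreover have "sorted_wrt (<) (map fst V1 @ map fst V2)"
    using sorted by (simp add: sorted_wrt_append)
  ultimately have "sorted_wrt (<) (map fst (map ?e (V1 @ V2)))" by (simp only:)
  then show ?thesis by (rule kernel_basisI) (rule vals, assumption, rule uniq)
qed

lemma kernel_basis_skip:
  assumes kb: "kernel_basis m n eqs V" and all: "\<And>t v. (t, v) \<in> set V \<Longrightarrow> dot m l v = \<zero>"
  shows "kernel_basis m n (l # eqs) V"
proof (rule kernel_basisI)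
  show "sorted_wrt (<) (map fst V)" using kb by (simp add: kernel_basis_def)
  fix t v assume tv: "(t, v) \<in> set V"
  have "solves m (l # eqs) v" using kernel_basisD(2)[OF kb tv] all[OF tv] by (simp add: solves_def)
  then show "tagged m n (l # eqs) V t v"
    using kernel_basisD[OF kb tv] by (simp add: tagged_def)
next
  fix x s assume x: "solves m (l # eqs) x" "\<And>t v. (t, v) \<in> set V \<Longrightarrow> x ! t = \<zero>" "s < m"
  have "solves m eqs x" using x(1) by (simp add: solves_def)
  then show "x ! s = \<zero>" by (rule kernel_basis_unique[OF kb _ x(2,3)])
qed

lemma kernel_basis_units:
  "kernel_basis m n [] (map (\<lambda>t. (t, map (\<lambda>s. if s = t then \<one> else \<zero>) [0..<m])) [0..<m])"
  (is "kernel_basis m n [] ?V")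
proof -
  have "map fst ?V = [0..<m]" by (simp add: comp_def)
  then have "sorted_wrt (<) (map fst ?V)" by (simp only: sorted_wrt_upt)
  moreover have "lvec m (map (\<lambda>s. if s = t then \<one> else \<zero>) [0..<m])" for t
    by (rule lvec_map_upt) simp
  ultimately show ?thesis
  proof (intro kernel_basisI)
    fix x s assume "\<And>t v. (t, v) \<in> set ?V \<Longrightarrow> x ! t = \<zero>" "s < m"
    then show "x ! s = \<zero>" by force
  qed (auto simp: solves_def tagged_def)
qed

section \<open>The algebra of solutions of X G = F diag(d)\<close>

lemma mat_prod_scaling:
  assumes "A \<in> mats R k n" "\<And>j. j < n \<Longrightarrow> d j \<in> carrier R"
  shows "scaling_mat n d \<in> mats R n n"
    "i < k \<Longrightarrow> j < n \<Longrightarrow> mat_prod R A (scaling_mat n d) $$ (i, j) = A $$ (i, j) \<otimes> d j"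
proof -
  show D: "scaling_mat n d \<in> mats R n n" using assms(2) by (auto simp: mats_def scaling_mat_def)
  show "mat_prod R A (scaling_mat n d) $$ (i, j) = A $$ (i, j) \<otimes> d j" if "i < k" "j < n"
    using mat_prod_diag[OF assms(1) D _ that] that by (simp add: scaling_mat_def)
qed

definition scaled_by :: "nat \<Rightarrow> nat \<Rightarrow> 'a mat \<Rightarrow> 'a mat \<Rightarrow> 'a mat \<Rightarrow> (nat \<Rightarrow> 'a) \<Rightarrow> bool" where
  "scaled_by k n F G X d \<longleftrightarrow> X \<in> mats R k k \<and> (\<forall>j<n. d j \<in> carrier R) \<and>
     (\<forall>i<k. \<forall>j<n. mat_prod R X G $$ (i, j) = F $$ (i, j) \<otimes> d j)"

text \<open>
  Transported by a fixed solution with invertible \<open>X0\<close>, the solutions form an algebra.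
\<close>

lemma scaled_by_mult:
  assumes F: "F \<in> mats R k n" and G: "G \<in> mats R k n"
    and X0: "X0 \<in> GL R k" "scaled_by k n F G X0 d0" "\<And>j. j < n \<Longrightarrow> d0 j \<noteq> \<zero>"
    and X: "scaled_by k n F G X d" and Y: "scaled_by k n F G Y e"
  shows "\<exists>Z. scaled_by k n F G Z (\<lambda>j. d j \<otimes> e j \<otimes> inv (d0 j))"
proof -
  obtain T where T: "T \<in> mats R k k" "mat_prod R T X0 = mat_one R k" and X0': "X0 \<in> mats R k k"
    using X0(1) unfolding GL_def by blast
  have X': "X \<in> mats R k k" and Y': "Y \<in> mats R k k" using X Y by (auto simp: scaled_by_def)
  have d0: "\<And>j. j < n \<Longrightarrow> d0 j \<in> carrier R" and d: "\<And>j. j < n \<Longrightarrow> d j \<in> carrier R" and e: "\<And>j. j < n \<Longrightarrow> e j \<in> carrier R"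
    using X0 X Y by (auto simp: scaled_by_def)
  have i0: "inv (d0 j) \<in> carrier R" "d0 j \<otimes> inv (d0 j) = \<one>" if "j < n" for j
    using nz_inv[OF d0[OF that] X0(3)[OF that]] by auto
  note D = mat_prod_scaling(1)[where d = e, OF F e]
  have TF: "mat_prod R T F \<in> mats R k n" by (rule mat_prod_mats[OF T(1) F])
  have FD: "mat_prod R F (scaling_mat n c) $$ (i, j) = F $$ (i, j) \<otimes> c j"
    if "\<And>j. j < n \<Longrightarrow> c j \<in> carrier R" "i < k" "j < n" for c i j
    by (rule mat_prod_scaling(2)[OF F that])
  have YG: "mat_prod R Y G = mat_prod R F (scaling_mat n e)"
  proof (rule mats_eqI[OF mat_prod_mats[OF Y' G] mat_prod_mats[OF F mat_prod_scaling(1)[where d = e, OF F e]]])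
    fix i j assume ij: "i < k" "j < n"
    show "mat_prod R Y G $$ (i, j) = mat_prod R F (scaling_mat n e) $$ (i, j)"
      using FD[of e i j] e Y ij by (simp add: scaled_by_def)
  qed
  have X0G: "mat_prod R X0 G = mat_prod R F (scaling_mat n d0)"
  proof (rule mats_eqI[OF mat_prod_mats[OF X0' G] mat_prod_mats[OF F mat_prod_scaling(1)[where d = d0, OF F d0]]])
    fix i j assume ij: "i < k" "j < n"
    show "mat_prod R X0 G $$ (i, j) = mat_prod R F (scaling_mat n d0) $$ (i, j)"
      using FD[of d0 i j] d0 X0(2) ij by (simp add: scaled_by_def)
  qed
  have "G = mat_prod R T (mat_prod R F (scaling_mat n d0))"
    using mat_prod_assoc[OF T(1) X0' G] T(2) mat_prod_one_left[OF G] X0G by simp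
  also have "\<dots> = mat_prod R (mat_prod R T F) (scaling_mat n d0)"
    by (rule mat_prod_assoc[OF T(1) F mat_prod_scaling(1)[where d = d0, OF F d0], symmetric])
  finally have GT: "G $$ (i, j) = mat_prod R T F $$ (i, j) \<otimes> d0 j" if "i < k" "j < n" for i j
    using mat_prod_scaling(2)[where d = d0, OF TF d0] that by simp
  have TF_G: "mat_prod R T F = mat_prod R G (scaling_mat n (\<lambda>j. inv (d0 j)))"
  proof (rule mats_eqI[OF TF mat_prod_mats[OF G mat_prod_scaling(1)[OF G]]])
    fix i j assume ij: "i < k" "j < n"
    then show "mat_prod R T F $$ (i, j) = mat_prod R G (scaling_mat n (\<lambda>j. inv (d0 j))) $$ (i, j)"
      using mat_prod_scaling(2)[where d = "\<lambda>j. inv (d0 j)", OF G] i0 GT[OF ij] d0 mats_closed[OF TF ij] by (simp add: m_assoc)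
  qed (use i0 in auto)
  \<comment> \<open>With T the inverse of X0: X T Y G = X T F diag(e) = X G diag(1/d0) diag(e) = F
    diag(d e / d0).\<close>
  let ?Z = "mat_prod R X (mat_prod R T Y)"
  have TY: "mat_prod R T Y \<in> mats R k k" by (rule mat_prod_mats[OF T(1) Y'])
  have Z: "?Z \<in> mats R k k" by (rule mat_prod_mats[OF X' TY])
  have I: "scaling_mat n (\<lambda>j. inv (d0 j)) \<in> mats R n n" by (rule mat_prod_scaling(1)[OF G]) (use i0 in auto)
  have XG: "mat_prod R X G \<in> mats R k n" by (rule mat_prod_mats[OF X' G])
  have "mat_prod R ?Z G = mat_prod R X (mat_prod R (mat_prod R T Y) G)" by (rule mat_prod_assoc[OF X' TY G])
  also have "mat_prod R (mat_prod R T Y) G = mat_prod R T (mat_prod R F (scaling_mat n e))"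
    unfolding YG[symmetric] by (rule mat_prod_assoc[OF T(1) Y' G])
  also have "\<dots> = mat_prod R (mat_prod R T F) (scaling_mat n e)" by (rule mat_prod_assoc[OF T(1) F D, symmetric])
  also have "mat_prod R X \<dots> = mat_prod R (mat_prod R X (mat_prod R T F)) (scaling_mat n e)"
    by (rule mat_prod_assoc[OF X' TF D, symmetric])
  also have "mat_prod R X (mat_prod R T F) = mat_prod R (mat_prod R X G) (scaling_mat n (\<lambda>j. inv (d0 j)))"
    unfolding TF_G by (rule mat_prod_assoc[OF X' G I, symmetric])
  finally have ZG: "mat_prod R ?Z G = mat_prod R (mat_prod R (mat_prod R X G) (scaling_mat n (\<lambda>j. inv (d0 j)))) (scaling_mat n e)" .
  have "mat_prod R ?Z G $$ (i, j) = F $$ (i, j) \<otimes> (d j \<otimes> e j \<otimes> inv (d0 j))" if ij: "i < k" "j < n" for i j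
  proof -
    have "mat_prod R ?Z G $$ (i, j) = mat_prod R X G $$ (i, j) \<otimes> inv (d0 j) \<otimes> e j"
      unfolding ZG using mat_prod_scaling(2)[where d = e, OF mat_prod_mats[OF XG I] e] ij
        mat_prod_scaling(2)[where d = "\<lambda>j. inv (d0 j)", OF XG] i0 by simp
    also have "mat_prod R X G $$ (i, j) = F $$ (i, j) \<otimes> d j" using X ij by (simp add: scaled_by_def)
    finally show ?thesis using mats_closed[OF F ij] d e i0 ij by (simp add: m_ac)
  qed
  then show ?thesis unfolding scaled_by_def using Z d e i0 by (intro exI[of _ ?Z]) auto
qed

text \<open>If d = 0, every row of X is a relation between the independent rows of G. By linearity d
  thus determines X, which is what confines the tags to the first block of unknowns.\<close>

lemma scaled_by_zero:
  assumes G: "G \<in> mats R k n" "independent_rows R G" and F: "F \<in> mats R k n"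
    and X: "scaled_by k n F G X d" and zero: "\<And>j. j < n \<Longrightarrow> d j = \<zero>" and ij: "i < k" "j < k"
  shows "X $$ (i, j) = \<zero>"
proof -
  have X': "X \<in> mats R k k" using X by (simp add: scaled_by_def)
  let ?y = "vec k (\<lambda>j. X $$ (i, j))"
  have y: "?y \<in> vecs R k" using mats_closed[OF X' ij(1)] by (auto simp: vecs_def)
  have "vec_mat_prod R ?y G = vec_zero R n"
  proof (rule vecs_eqI[OF vec_mat_prod_vecs[OF y G(1)] vec_zero_vecs])
    fix t assume t: "t < n"
    have "vec_mat_prod R ?y G $ t = mat_prod R X G $$ (i, t)"
      unfolding vec_mat_prod_index[OF y G(1) t] mat_prod_index[OF X' G(1) ij(1) t]
      using mats_closed[OF X' ij(1)] mats_closed[OF G(1) _ t] by (intro finsum_cong') auto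
    also have "\<dots> = \<zero>" using X zero[OF t] ij t mats_closed[OF F ij(1) t] by (simp add: scaled_by_def)
    finally show "vec_mat_prod R ?y G $ t = vec_zero R n $ t" using t by (simp add: vec_zero_def)
  qed
  then have "?y = vec_zero R k"
    using G(2) y matsD[OF G(1)] unfolding independent_rows_def by simp
  from arg_cong[OF this, of "\<lambda>v. v $ j"] show ?thesis using ij by (simp add: vec_zero_def)
qed

text \<open>If y X = 0, then y F diag(d) = y X G = 0; as d has no zero entry, y F = 0, and
  independence of the rows of F gives y = 0.\<close>

lemma scaled_by_GL:
  assumes fin: "finite (carrier R)" and F: "F \<in> mats R k n" "independent_rows R F" and G: "G \<in> mats R k n"
    and X: "scaled_by k n F G X d" and nz: "\<And>j. j < n \<Longrightarrow> d j \<noteq> \<zero>"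
  shows "X \<in> GL R k"
proof (rule independent_rows_GL[OF fin])
  show X': "X \<in> mats R k k" using X by (simp add: scaled_by_def)
  have d: "\<And>j. j < n \<Longrightarrow> d j \<in> carrier R" using X by (simp add: scaled_by_def)
  have D: "scaling_mat n d \<in> mats R n n" by (rule mat_prod_scaling(1)[OF F(1) d])
  have XG: "mat_prod R X G = mat_prod R F (scaling_mat n d)"
    by (rule mats_eqI[OF mat_prod_mats[OF X' G] mat_prod_mats[OF F(1) D]])
      (use X mat_prod_scaling(2)[where d = d, OF F(1) d] in \<open>simp add: scaled_by_def\<close>)
  show "independent_rows R X"
    unfolding independent_rows_def
  proof (intro ballI impI)
    fix y assume "y \<in> vecs R (dim_row X)" and z: "vec_mat_prod R y X = vec_zero R (dim_col X)"
    then have y: "y \<in> vecs R k" using matsD[OF X'] by simp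
    have "vec_mat_prod R (vec_mat_prod R y F) (scaling_mat n d) = vec_mat_prod R (vec_mat_prod R y X) G"
      unfolding vec_mat_prod_assoc[OF y F(1) D] vec_mat_prod_assoc[OF y X' G] XG ..
    also have "\<dots> = vec_zero R n" using z matsD[OF X'] vec_mat_prod_zero[OF G] by simp
    finally have *: "vec_mat_prod R (vec_mat_prod R y F) (scaling_mat n d) = vec_zero R n" .
    have yF: "vec_mat_prod R y F \<in> vecs R n" by (rule vec_mat_prod_vecs[OF y F(1)])
    have "vec_mat_prod R y F = vec_zero R n"
    proof (rule vecs_eqI[OF yF vec_zero_vecs])
      fix j assume j: "j < n"
      have c: "vec_mat_prod R y F $ j \<in> carrier R" using yF j by (simp add: vecs_def)
      have "vec_mat_prod R (vec_mat_prod R y F) (scaling_mat n d) $ j =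
          vec_mat_prod R y F $ j \<otimes> scaling_mat n d $$ (j, j)"
        unfolding vec_mat_prod_index[OF yF D j]
        using yF j d by (intro finsum_single) (auto simp: vecs_def scaling_mat_def)
      then have "vec_mat_prod R y F $ j \<otimes> d j = \<zero>" using * j by (simp add: scaling_mat_def vec_zero_def)
      then show "vec_mat_prod R y F $ j = vec_zero R n $ j"
        using integral[OF _ c d[OF j]] nz[OF j] j by (simp add: vec_zero_def)
    qed
    then show "y = vec_zero R (dim_row X)"
      using F(2) y matsD[OF F(1)] matsD[OF X'] unfolding independent_rows_def by simp
  qed
qed

text \<open>Without columns every vector is a relation between the rows. This covers length 0, where
  no column shows the dimension.\<close>

lemma independent_rows_empty:
  assumes "A \<in> mats R k 0" "independent_rows R A" shows "k = 0"
proof (rule ccontr)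
  assume k: "k \<noteq> 0"
  let ?x = "vec k (\<lambda>_. \<one>)"
  have x: "?x \<in> vecs R k" by (auto simp: vecs_def)
  have "vec_mat_prod R ?x A = vec_zero R 0"
    by (rule vecs_eqI[OF vec_mat_prod_vecs[OF x assms(1)] vec_zero_vecs]) simp
  then have "?x = vec_zero R k" using assms(2) x matsD[OF assms(1)] unfolding independent_rows_def by simp
  then have "?x $ 0 = vec_zero R k $ 0" by simp
  then show False using k by (simp add: vec_zero_def)
qed

end

section \<open>Correctness of the elimination program and of the linear system\<close>

context gf
begin

lemma foldr_gadd:
  assumes "distinct xs" "\<And>x. x \<in> set xs \<Longrightarrow> h x \<in> carrier R"
  shows "foldr (\<lambda>x acc. gadd K (h x) acc) xs (gzero K) = (\<Oplus>\<^bsub>R\<^esub>x\<in>set xs. h x)"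
  using assms
proof (induction xs)
  case (Cons x xs)
  then have "(\<Oplus>\<^bsub>R\<^esub>x\<in>set xs. h x) \<in> carrier R" by (intro R.finsum_closed) auto
  then show ?case using Cons by (simp add: gadd R.finsum_insert Pi_def)
qed (simp add: gzero)

lemma gdot:
  assumes u: "R.lvec m u" and v: "R.lvec m v"
  shows "gdot K u v = R.dot m u v"
proof -
  have e: "gmul K (nth_default [] u s) (nth_default [] v s) = u ! s \<otimes>\<^bsub>R\<^esub> v ! s" if "s < m" for s
    using that u v R.lvec_length[OF u] R.lvec_length[OF v] by (simp add: nth_default_nth gmul)
  have "gdot K u v = (\<Oplus>\<^bsub>R\<^esub>s\<in>set [0..<m]. gmul K (nth_default [] u s) (nth_default [] v s))"
    unfolding gdot_def R.lvec_length[OF u] using u v by (intro foldr_gadd) (simp_all add: e)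
  also have "\<dots> = R.dot m u v"
    unfolding R.dot_def using u v by (intro R.finsum_cong') (auto simp: e)
  finally show ?thesis .
qed

lemma gelim:
  assumes l: "R.lvec m l" and w: "R.lvec m w" and v: "R.lvec m v"
  shows "gelim K l w v = R.sub_mult (R.dot m l v \<otimes>\<^bsub>R\<^esub> ginv K (R.dot m l w)) w v"
  unfolding gelim_def R.sub_mult_def gdot[OF l w] gdot[OF l v]
  using assms R.lvec_length[OF w] R.lvec_length[OF v]
  by (intro map_cong refl) (simp add: nth_default_nth gmul gsub ginv_closed)

lemma gpivot_cases:
  "(gpivot K l V = ([], V) \<and> (\<forall>tv\<in>set V. gnull (gdot K l (snd tv)))) \<or>
   (\<exists>V1 t0 w V2. V = V1 @ (t0, w) # V2 \<and> (\<forall>tv\<in>set V2. gnull (gdot K l (snd tv))) \<and> \<not> gnull (gdot K l w) \<and>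
      gpivot K l V = ([w], map (\<lambda>tv. (fst tv, gelim K l w (snd tv))) V1 @ V2))"
proof (induction V)
  case Nil
  then show ?case by (simp add: gpivot_Nil)
next
  case (Cons tv V)
  from Cons.IH show ?case
  proof (elim disjE conjE exE)
    assume "gpivot K l V = ([], V)" "\<forall>tv\<in>set V. gnull (gdot K l (snd tv))"
    then show ?thesis
      unfolding gpivot_Cons
      by (cases "gnull (gdot K l (snd tv))")
        (simp, intro disjI2 exI[of _ "[]"] exI[of _ "fst tv"] exI[of _ "snd tv"] exI[of _ V], simp)
  next
    fix V1 t0 w V2
    assume "V = V1 @ (t0, w) # V2" "\<forall>tv\<in>set V2. gnull (gdot K l (snd tv))" "\<not> gnull (gdot K l w)"
      "gpivot K l V = ([w], map (\<lambda>tv. (fst tv, gelim K l w (snd tv))) V1 @ V2)"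
    then show ?thesis
      unfolding gpivot_Cons
      by (intro disjI2 exI[of _ "tv # V1"] exI[of _ t0] exI[of _ w] exI[of _ V2]) (simp add: nth_default_def)
  qed
qed

lemma gkernel_basis:
  assumes "\<forall>l\<in>set eqs. R.lvec m l"
  shows "R.kernel_basis m n eqs (gkernel K eqs (gunits K m))"
  using assms
proof (induction eqs)
  case Nil
  show ?case
    using R.kernel_basis_units[of m n] unfolding gkernel_def gunits_def gone gzero by (simp only: foldr.simps id_apply)
next
  case (Cons l eqs)
  define V where "V = gkernel K eqs (gunits K m)"
  have kb: "R.kernel_basis m n eqs V" and l: "R.lvec m l" and eqs: "\<forall>l\<in>set eqs. R.lvec m l"
    using Cons by (auto simp: V_def)
  have k: "gkernel K (l # eqs) (gunits K m) = snd (gpivot K l V)" by (simp add: gkernel_def V_def)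
  have vl: "R.lvec m v" if "(t, v) \<in> set V" for t v
    using R.kernel_basisD(2)[OF kb that] by (rule R.solves_lvec)
  have dot0: "gnull (gdot K l v) \<longleftrightarrow> R.dot m l v = \<zero>\<^bsub>R\<^esub>" if "(t, v) \<in> set V" for t v
    using gdot[OF l vl[OF that]] gnull R.dot_closed[OF l vl[OF that]] by simp
  from gpivot_cases[of l V] show ?case unfolding k
  proof (elim disjE conjE exE)
    assume g: "gpivot K l V = ([], V)" "\<forall>tv\<in>set V. gnull (gdot K l (snd tv))"
    have "R.dot m l v = \<zero>\<^bsub>R\<^esub>" if "(t, v) \<in> set V" for t v
      using g(2) dot0[OF that] that by fastforce
    then show "R.kernel_basis m n (l # eqs) (snd (gpivot K l V))"
      unfolding g(1) snd_conv by (rule R.kernel_basis_skip[OF kb])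
  next
    fix V1 t0 w V2
    assume V: "V = V1 @ (t0, w) # V2" and V2: "\<forall>tv\<in>set V2. gnull (gdot K l (snd tv))" and w: "\<not> gnull (gdot K l w)"
      and g: "gpivot K l V = ([w], map (\<lambda>tv. (fst tv, gelim K l w (snd tv))) V1 @ V2)"
    have w0: "(t0, w) \<in> set V" by (simp add: V)
    have wl: "R.lvec m w" by (rule vl[OF w0])
    have wnz: "R.dot m l w \<noteq> \<zero>\<^bsub>R\<^esub>" using w dot0[OF w0] by simp
    let ?c = "ginv K (R.dot m l w)"
    have c: "?c \<in> carrier R" "?c \<otimes>\<^bsub>R\<^esub> R.dot m l w = \<one>\<^bsub>R\<^esub>"
      using ginv_closed ginv wnz R.dot_closed[OF l wl] by auto
    have d2: "R.dot m l v = \<zero>\<^bsub>R\<^esub>" if "(t, v) \<in> set V2" for t v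
      using V2 dot0[of t v] that V by fastforce
    have eq: "map (\<lambda>tv. (fst tv, gelim K l w (snd tv))) V1 @ V2 =
        map (\<lambda>tv. (fst tv, R.sub_mult (R.dot m l (snd tv) \<otimes>\<^bsub>R\<^esub> ?c) w (snd tv))) (V1 @ V2)"
      unfolding map_append
    proof (intro arg_cong2[where f = "(@)"])
      show "map (\<lambda>tv. (fst tv, gelim K l w (snd tv))) V1 =
          map (\<lambda>tv. (fst tv, R.sub_mult (R.dot m l (snd tv) \<otimes>\<^bsub>R\<^esub> ?c) w (snd tv))) V1"
      proof (rule map_cong[OF refl])
        fix tv assume "tv \<in> set V1"
        then have "R.lvec m (snd tv)" by (intro vl[of "fst tv"]) (simp add: V)
        then show "(fst tv, gelim K l w (snd tv)) = (fst tv, R.sub_mult (R.dot m l (snd tv) \<otimes>\<^bsub>R\<^esub> ?c) w (snd tv))"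
          using gelim[OF l wl] by simp
      qed
      \<comment> \<open>The vectors behind the pivot have value 0 under l, so the uniform formula of
        \<open>kernel_basis_step\<close> leaves them unchanged.\<close>
      show "V2 = map (\<lambda>tv. (fst tv, R.sub_mult (R.dot m l (snd tv) \<otimes>\<^bsub>R\<^esub> ?c) w (snd tv))) V2"
      proof (rule map_idI[symmetric])
        fix tv assume tv: "tv \<in> set V2"
        then have v: "R.lvec m (snd tv)" by (intro vl[of "fst tv"]) (simp add: V)
        have "R.dot m l (snd tv) = \<zero>\<^bsub>R\<^esub>" using d2[of "fst tv" "snd tv"] tv by simp
        then have "R.sub_mult (R.dot m l (snd tv) \<otimes>\<^bsub>R\<^esub> ?c) w (snd tv) = snd tv"
          using c wl v by (intro R.lvec_eqI[OF R.lvec_sub_mult[OF _ wl v] v]) (simp_all add: R.sub_mult_nth R.minus_eq)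
        then show "(fst tv, R.sub_mult (R.dot m l (snd tv) \<otimes>\<^bsub>R\<^esub> ?c) w (snd tv)) = tv" by simp
      qed
    qed
    show "R.kernel_basis m n (l # eqs) (snd (gpivot K l V))"
      unfolding g snd_conv eq
    proof (rule R.kernel_basis_step[OF kb eqs l V _ wnz c])
      fix t v assume "(t, v) \<in> set V2"
      then show "R.dot m l v = \<zero>\<^bsub>R\<^esub>" by (rule d2)
    qed
  qed
qed

text \<open>Column l of the matrix occupies k consecutive unknowns behind the n unknown
  scalars.\<close>

definition scaling_of :: "nat \<Rightarrow> nat \<Rightarrow> elem list \<Rightarrow> elem mat" where
  "scaling_of k n x = mat k k (\<lambda>(i, l). x ! (n + l * k + i))"

definition equation :: "nat \<Rightarrow> nat \<Rightarrow> elem list list \<Rightarrow> elem list list \<Rightarrow> nat \<Rightarrow> nat \<Rightarrow> elem list" where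
  "equation k n F G i j = map (\<lambda>s. if s < n then (if s = j then \<ominus>\<^bsub>R\<^esub> (F ! j ! i) else \<zero>\<^bsub>R\<^esub>)
     else (if (s - n) mod k = i then G ! j ! ((s - n) div k) else \<zero>\<^bsub>R\<^esub>)) [0..<n + k * k]"

lemma index_bound: "i < k \<Longrightarrow> l < k \<Longrightarrow> n + l * k + i < n + k * (k::nat)"
proof -
  assume "i < k" "l < k"
  then have "l * k + i < Suc l * k" by simp
  also have "\<dots> \<le> k * k" using \<open>l < k\<close> by (intro mult_le_mono1) simp
  finally show ?thesis by simp
qed

lemma in_set_concat_map_upt:
  "x \<in> set (concat (map (\<lambda>i. map (\<lambda>j. h i j) [0..<n]) [0..<k])) \<longleftrightarrow> (\<exists>i<k. \<exists>j<n. x = h i j)"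
proof -
  have "set (concat (map (\<lambda>i. map (\<lambda>j. h i j) [0..<n]) [0..<k])) = (\<Union>i\<in>{..<k}. \<Union>j\<in>{..<n}. {h i j})"
    unfolding set_concat set_map image_image UNION_singleton_eq_range by (simp add: atLeast0LessThan)
  then have "x \<in> set (concat (map (\<lambda>i. map (\<lambda>j. h i j) [0..<n]) [0..<k])) \<longleftrightarrow> (\<exists>i\<in>{..<k}. \<exists>j\<in>{..<n}. x = h i j)"
    by (simp only: UN_iff singleton_iff)
  then show ?thesis by (simp only: Bex_def lessThan_iff)
qed

lemma set_gequations:
  assumes F: "R.columns k n F" and G: "R.columns k n G" and h: "gheight F = k"
  shows "set (gequations K F G) = {equation k n F G i j | i j. i < k \<and> j < n}"
proof -
  have len: "length F = n" "length G = n" using F G by (auto simp: R.columns_def)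
  have *: "map (\<lambda>s. if s < n then (if s = j then gsub K (gzero K) (nth_default [] (nth_default [] F j) i) else gzero K)
       else (if (s - n) mod k = i then nth_default [] (nth_default [] G j) ((s - n) div k) else gzero K)) [0..<n + k * k] =
     equation k n F G i j" if ij: "i < k" "j < n" for i j
    unfolding equation_def
  proof (rule map_cong[OF refl])
    fix s assume "s \<in> set [0..<n + k * k]"
    then have s: "s < n + k * k" by simp
    have "nth_default [] (nth_default [] F j) i = F ! j ! i"
      using ij len R.columns_nth[OF F ij(2)] by (simp add: nth_default_nth)
    moreover have "gsub K (gzero K) (F ! j ! i) = \<ominus>\<^bsub>R\<^esub> (F ! j ! i)"
      using R.columns_entry[OF F ij(2,1)] by (simp add: gzero gsub R.minus_eq)
    moreover have "nth_default [] (nth_default [] G j) ((s - n) div k) = G ! j ! ((s - n) div k)" if "\<not> s < n"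
    proof -
      have "(s - n) div k < k" using s that by (intro less_mult_imp_div_less) simp
      then show ?thesis using ij len R.columns_nth[OF G ij(2)] by (simp add: nth_default_nth)
    qed
    ultimately show "(if s < n then (if s = j then gsub K (gzero K) (nth_default [] (nth_default [] F j) i) else gzero K)
       else (if (s - n) mod k = i then nth_default [] (nth_default [] G j) ((s - n) div k) else gzero K)) =
      (if s < n then (if s = j then \<ominus>\<^bsub>R\<^esub> (F ! j ! i) else \<zero>\<^bsub>R\<^esub>)
     else (if (s - n) mod k = i then G ! j ! ((s - n) div k) else \<zero>\<^bsub>R\<^esub>))"
      by (simp add: gzero)
  qed
  show ?thesis
  proof (intro equalityI subsetI)
    fix l assume "l \<in> set (gequations K F G)"
    then obtain i j where ij: "i < k" "j < n" and l: "l = map (\<lambda>s. if s < n then (if s = j then gsub K (gzero K) (nth_default [] (nth_default [] F j) i) else gzero K)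
       else (if (s - n) mod k = i then nth_default [] (nth_default [] G j) ((s - n) div k) else gzero K)) [0..<n + k * k]"
      unfolding gequations_def h len in_set_concat_map_upt by blast
    show "l \<in> {equation k n F G i j | i j. i < k \<and> j < n}"
      unfolding l *[OF ij] using ij by blast
  next
    fix l assume "l \<in> {equation k n F G i j | i j. i < k \<and> j < n}"
    then obtain i j where ij: "i < k" "j < n" and l: "l = equation k n F G i j" by blast
    show "l \<in> set (gequations K F G)"
      unfolding gequations_def h len in_set_concat_map_upt l *[OF ij, symmetric] using ij by blast
  qed
qed

lemma lvec_equation:
  assumes F: "R.columns k n F" and G: "R.columns k n G" and ij: "i < k" "j < n"
  shows "R.lvec (n + k * k) (equation k n F G i j)"
  unfolding equation_def
proof (rule R.lvec_map_upt)
  fix s assume s: "s < n + k * k"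
  have "(s - n) div k < k" if "\<not> s < n" using s that by (intro less_mult_imp_div_less) simp
  then show "(if s < n then (if s = j then \<ominus>\<^bsub>R\<^esub> (F ! j ! i) else \<zero>\<^bsub>R\<^esub>)
     else (if (s - n) mod k = i then G ! j ! ((s - n) div k) else \<zero>\<^bsub>R\<^esub>)) \<in> carrier R"
    using R.columns_entry[OF F ij(2,1)] R.columns_entry[OF G ij(2)] by simp
qed

lemma scaling_of_mats: "R.lvec (n + k * k) x \<Longrightarrow> scaling_of k n x \<in> mats R k k"
  using index_bound by (auto simp: mats_def scaling_of_def)

lemma dot_equation:
  assumes F: "R.columns k n F" and G: "R.columns k n G" and ij: "i < k" "j < n" and x: "R.lvec (n + k * k) x"
  shows "R.dot (n + k * k) (equation k n F G i j) x =
    \<ominus>\<^bsub>R\<^esub> (F ! j ! i \<otimes>\<^bsub>R\<^esub> x ! j) \<oplus>\<^bsub>R\<^esub> mat_prod R (scaling_of k n x) (mat_of_columns k G) $$ (i, j)"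
proof -
  let ?e = "equation k n F G i j" and ?m = "n + k * k" and ?h = "\<lambda>l. n + l * k + i"
  have e: "R.lvec ?m ?e" by (rule lvec_equation[OF F G ij])
  have ent: "?e ! s = (if s < n then (if s = j then \<ominus>\<^bsub>R\<^esub> (F ! j ! i) else \<zero>\<^bsub>R\<^esub>)
     else (if (s - n) mod k = i then G ! j ! ((s - n) div k) else \<zero>\<^bsub>R\<^esub>))" if "s < ?m" for s
    using that by (simp add: equation_def)
  have hb: "?h l < ?m" if "l < k" for l using index_bound[OF ij(1) that] .
  have Fc: "F ! j ! i \<in> carrier R" by (rule R.columns_entry[OF F ij(2,1)])
  have xc: "x ! s \<in> carrier R" if "s < ?m" for s using x that by simp
  have ec: "?e ! s \<otimes>\<^bsub>R\<^esub> x ! s \<in> carrier R" if "s < ?m" for s using x e that by simp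
  \<comment> \<open>The equation for entry (i, j) involves only the scalar with index j and the
    unknowns of row i of the matrix, which sit at the places \<open>?h l\<close>.\<close>
  have outside: "?e ! s \<otimes>\<^bsub>R\<^esub> x ! s = \<zero>\<^bsub>R\<^esub>" if s: "s < ?m" "s \<noteq> j" "s \<notin> ?h ` {..<k}" for s
  proof -
    have "?e ! s = \<zero>\<^bsub>R\<^esub>"
    proof (cases "s < n")
      case True
      then show ?thesis using ent[OF s(1)] s(2) by simp
    next
      case False
      have "(s - n) mod k \<noteq> i"
      proof
        assume "(s - n) mod k = i"
        then have s_eq: "s = ?h ((s - n) div k)" using False div_mult_mod_eq[of "s - n" k] by simp
        have "(s - n) div k < k" using s(1) False by (intro less_mult_imp_div_less) simp
        then have "s \<in> ?h ` {..<k}" by (subst s_eq) (rule imageI, simp)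
        then show False using s(3) by simp
      qed
      then show ?thesis using ent[OF s(1)] False by simp
    qed
    then show ?thesis using xc[OF s(1)] by simp
  qed
  have "R.dot ?m ?e x = (\<Oplus>\<^bsub>R\<^esub>s\<in>insert j (?h ` {..<k}). ?e ! s \<otimes>\<^bsub>R\<^esub> x ! s)"
    unfolding R.dot_def
    by (rule R.add.finprod_mono_neutral_cong_right) (use ij hb ec outside in \<open>auto simp: Pi_def\<close>)
  also have "\<dots> = ?e ! j \<otimes>\<^bsub>R\<^esub> x ! j \<oplus>\<^bsub>R\<^esub> (\<Oplus>\<^bsub>R\<^esub>s\<in>?h ` {..<k}. ?e ! s \<otimes>\<^bsub>R\<^esub> x ! s)"
    using ij hb ec by (intro R.finsum_insert) (auto simp: Pi_def)
  also have "(\<Oplus>\<^bsub>R\<^esub>s\<in>?h ` {..<k}. ?e ! s \<otimes>\<^bsub>R\<^esub> x ! s) = (\<Oplus>\<^bsub>R\<^esub>l\<in>{..<k}. ?e ! ?h l \<otimes>\<^bsub>R\<^esub> x ! ?h l)"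
    using hb ec ij by (intro R.finsum_reindex) (auto simp: Pi_def inj_on_def)
  also have "\<dots> = (\<Oplus>\<^bsub>R\<^esub>l\<in>{..<k}. scaling_of k n x $$ (i, l) \<otimes>\<^bsub>R\<^esub> mat_of_columns k G $$ (l, j))"
  proof (intro R.finsum_cong' refl)
    show "(\<lambda>l. scaling_of k n x $$ (i, l) \<otimes>\<^bsub>R\<^esub> mat_of_columns k G $$ (l, j)) \<in> {..<k} \<rightarrow> carrier R"
      using R.mats_closed[OF scaling_of_mats[OF x] ij(1)] R.mats_closed[OF R.columns_mats[OF G] _ ij(2)] by auto
    fix l assume "l \<in> {..<k}"
    then have l: "l < k" by simp
    have "?e ! ?h l = G ! j ! l" unfolding ent[OF hb[OF l]] using ij(1) by simp
    moreover have "scaling_of k n x $$ (i, l) = x ! ?h l" using ij(1) l by (simp add: scaling_of_def)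
    ultimately show "?e ! ?h l \<otimes>\<^bsub>R\<^esub> x ! ?h l = scaling_of k n x $$ (i, l) \<otimes>\<^bsub>R\<^esub> mat_of_columns k G $$ (l, j)"
      using R.mat_of_columns_index[OF G l ij(2)] xc[OF hb[OF l]] R.columns_entry[OF G ij(2) l] by (simp add: R.m_comm)
  qed
  also have "\<dots> = mat_prod R (scaling_of k n x) (mat_of_columns k G) $$ (i, j)"
    by (rule R.mat_prod_index[OF scaling_of_mats[OF x] R.columns_mats[OF G] ij, symmetric])
  also have "?e ! j = \<ominus>\<^bsub>R\<^esub> (F ! j ! i)" using ent[of j] ij by simp
  finally show ?thesis using Fc xc[of j] ij by (simp add: R.l_minus)
qed

lemma solves_iff_scaled_by:
  assumes F: "R.columns k n F" and G: "R.columns k n G" and h: "gheight F = k" and x: "R.lvec (n + k * k) x"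
  shows "R.solves (n + k * k) (gequations K F G) x \<longleftrightarrow>
    R.scaled_by k n (mat_of_columns k F) (mat_of_columns k G) (scaling_of k n x) (\<lambda>j. x ! j)"
proof -
  let ?P = "mat_prod R (scaling_of k n x) (mat_of_columns k G)"
  have "R.dot (n + k * k) (equation k n F G i j) x = \<zero>\<^bsub>R\<^esub> \<longleftrightarrow> ?P $$ (i, j) = mat_of_columns k F $$ (i, j) \<otimes>\<^bsub>R\<^esub> x ! j"
    if ij: "i < k" "j < n" for i j
  proof -
    have P: "?P $$ (i, j) \<in> carrier R"
      by (rule R.mats_closed[OF R.mat_prod_mats[OF scaling_of_mats[OF x] R.columns_mats[OF G]] ij])
    have b: "F ! j ! i \<otimes>\<^bsub>R\<^esub> x ! j \<in> carrier R" using R.columns_entry[OF F ij(2,1)] x ij by simp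
    have "R.dot (n + k * k) (equation k n F G i j) x = ?P $$ (i, j) \<ominus>\<^bsub>R\<^esub> F ! j ! i \<otimes>\<^bsub>R\<^esub> x ! j"
      unfolding dot_equation[OF F G ij x] using P b by (simp add: R.minus_eq R.a_comm)
    then show ?thesis using R.diff_zero_iff[OF P b] R.mat_of_columns_index[OF F ij] by simp
  qed
  then have "(\<forall>l\<in>{equation k n F G i j | i j. i < k \<and> j < n}. R.dot (n + k * k) l x = \<zero>\<^bsub>R\<^esub>) \<longleftrightarrow>
      (\<forall>i<k. \<forall>j<n. ?P $$ (i, j) = mat_of_columns k F $$ (i, j) \<otimes>\<^bsub>R\<^esub> x ! j)"
    by blast
  then show ?thesis
    unfolding R.solves_def R.scaled_by_def set_gequations[OF F G h] using x scaling_of_mats[OF x] by simp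
qed

lemma gsum:
  assumes V: "distinct V" "\<And>tv. tv \<in> set V \<Longrightarrow> R.lvec m (snd tv)"
  shows "R.lvec m (gsum K m V)" "s < m \<Longrightarrow> gsum K m V ! s = (\<Oplus>\<^bsub>R\<^esub>tv\<in>set V. snd tv ! s)"
proof -
  have c: "snd tv ! s \<in> carrier R" if "tv \<in> set V" "s < m" for tv s
    by (rule R.lvec_nth[OF V(2)[OF that(1)] that(2)])
  have *: "nth_default [] (snd tv) s = snd tv ! s" if "tv \<in> set V" "s < m" for tv s
    using that V(2)[OF that(1)] by (simp add: nth_default_nth R.lvec_length)
  have g: "gsum K m V ! s = (\<Oplus>\<^bsub>R\<^esub>tv\<in>set V. snd tv ! s)" if s: "s < m" for s
  proof -
    have "gsum K m V ! s = foldr (\<lambda>tv acc. gadd K (nth_default [] (snd tv) s) acc) V (gzero K)"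
      unfolding gsum_def using s by simp
    also have "\<dots> = (\<Oplus>\<^bsub>R\<^esub>tv\<in>set V. nth_default [] (snd tv) s)"
      by (rule foldr_gadd[OF V(1)]) (simp only: * s c)
    also have "\<dots> = (\<Oplus>\<^bsub>R\<^esub>tv\<in>set V. snd tv ! s)"
      by (intro R.finsum_cong' refl Pi_I) (simp_all only: * s c)
    finally show ?thesis .
  qed
  show "R.lvec m (gsum K m V)"
    unfolding R.lvec_def
  proof
    show "length (gsum K m V) = m" by (simp add: gsum_def)
    show "set (gsum K m V) \<subseteq> carrier R"
    proof
      fix a assume "a \<in> set (gsum K m V)"
      then obtain s where s: "s < m" "a = gsum K m V ! s" by (auto simp: in_set_conv_nth gsum_def)
      show "a \<in> carrier R" unfolding s(2) g[OF s(1)] by (intro R.finsum_closed Pi_I c s(1))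
    qed
  qed
  show "s < m \<Longrightarrow> gsum K m V ! s = (\<Oplus>\<^bsub>R\<^esub>tv\<in>set V. snd tv ! s)" by (rule g)
qed

lemma solves_gsum:
  assumes V: "distinct V" "\<And>tv. tv \<in> set V \<Longrightarrow> R.solves m eqs (snd tv)" and eqs: "\<forall>l\<in>set eqs. R.lvec m l"
  shows "R.solves m eqs (gsum K m V)"
proof -
  have l': "R.lvec m (snd tv)" if "tv \<in> set V" for tv using V(2)[OF that] by (rule R.solves_lvec)
  have vc: "snd tv ! s \<in> carrier R" if "tv \<in> set V" "s < m" for tv s
    by (rule R.lvec_nth[OF l'[OF that(1)] that(2)])
  have g1: "R.lvec m (gsum K m V)" by (rule gsum(1)[OF V(1)]) (rule l')
  have g2: "gsum K m V ! s = (\<Oplus>\<^bsub>R\<^esub>tv\<in>set V. snd tv ! s)" if "s < m" for s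
    by (rule gsum(2)[OF V(1) _ that]) (rule l')
  have "R.dot m e (gsum K m V) = \<zero>\<^bsub>R\<^esub>" if e: "e \<in> set eqs" for e
  proof -
    have el: "R.lvec m e" using eqs e by simp
    have "R.dot m e (gsum K m V) = (\<Oplus>\<^bsub>R\<^esub>s\<in>{..<m}. \<Oplus>\<^bsub>R\<^esub>tv\<in>set V. e ! s \<otimes>\<^bsub>R\<^esub> snd tv ! s)"
      unfolding R.dot_def
    proof (intro R.finsum_cong' refl)
      fix s assume "s \<in> {..<m}"
      then have s: "s < m" by simp
      show "e ! s \<otimes>\<^bsub>R\<^esub> gsum K m V ! s = (\<Oplus>\<^bsub>R\<^esub>tv\<in>set V. e ! s \<otimes>\<^bsub>R\<^esub> snd tv ! s)"
        unfolding g2[OF s] by (intro R.finsum_rdistr finite_set Pi_I vc s R.lvec_nth[OF el s])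
    next
      show "(\<lambda>s. \<Oplus>\<^bsub>R\<^esub>tv\<in>set V. e ! s \<otimes>\<^bsub>R\<^esub> snd tv ! s) \<in> {..<m} \<rightarrow> carrier R"
        by (intro Pi_I R.finsum_closed R.m_closed vc R.lvec_nth[OF el]) simp_all
    qed
    also have "\<dots> = (\<Oplus>\<^bsub>R\<^esub>tv\<in>set V. \<Oplus>\<^bsub>R\<^esub>s\<in>{..<m}. e ! s \<otimes>\<^bsub>R\<^esub> snd tv ! s)"
      by (intro R.finsum_swap finite_set finite_lessThan R.m_closed vc R.lvec_nth[OF el]) simp_all
    also have "\<dots> = \<zero>\<^bsub>R\<^esub>"
    proof (rule R.add.finprod_one_eqI)
      fix tv assume "tv \<in> set V"
      then have "R.solves m eqs (snd tv)" by (rule V(2))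
      then show "(\<Oplus>\<^bsub>R\<^esub>s\<in>{..<m}. e ! s \<otimes>\<^bsub>R\<^esub> snd tv ! s) = \<zero>\<^bsub>R\<^esub>"
        using e by (simp add: R.solves_def R.dot_def)
    qed
    finally show ?thesis .
  qed
  then show ?thesis unfolding R.solves_def using g1 by simp
qed

lemma solution_of_scaled_by:
  assumes F: "R.columns k n F" and G: "R.columns k n G" and h: "gheight F = k"
    and Z: "R.scaled_by k n (mat_of_columns k F) (mat_of_columns k G) Z d"
  shows "\<exists>x. R.solves (n + k * k) (gequations K F G) x \<and> (\<forall>j<n. x ! j = d j)"
proof -
  let ?m = "n + k * k"
  have Z': "Z \<in> mats R k k" and d: "\<And>j. j < n \<Longrightarrow> d j \<in> carrier R" using Z by (auto simp: R.scaled_by_def)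
  \<comment> \<open>The offset s - n equals l k + i, so its remainder modulo k is the row and its
    quotient the column.\<close>
  define x where "x = map (\<lambda>s. if s < n then d s else Z $$ ((s - n) mod k, (s - n) div k)) [0..<?m]"
  have x: "R.lvec ?m x"
    unfolding x_def
  proof (rule R.lvec_map_upt)
    fix s assume s: "s < ?m"
    have "(s - n) div k < k \<and> (s - n) mod k < k" if "\<not> s < n"
    proof -
      have "s - n < k * k" using s that by simp
      then show ?thesis by (cases "k = 0") (simp_all add: less_mult_imp_div_less)
    qed
    then show "(if s < n then d s else Z $$ ((s - n) mod k, (s - n) div k)) \<in> carrier R"
      using d R.mats_closed[OF Z'] by simp
  qed
  have xj: "x ! j = d j" if "j < n" for j using that by (simp add: x_def)
  have "scaling_of k n x = Z"
  proof (rule R.mats_eqI[OF scaling_of_mats[OF x] Z'])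
    fix i l assume il: "i < k" "l < k"
    then show "scaling_of k n x $$ (i, l) = Z $$ (i, l)"
      using index_bound[OF il, of n] by (simp add: scaling_of_def x_def)
  qed
  then have "R.scaled_by k n (mat_of_columns k F) (mat_of_columns k G) (scaling_of k n x) (\<lambda>j. x ! j)"
    using Z xj by (simp add: R.scaled_by_def)
  then have "R.solves ?m (gequations K F G) x" using solves_iff_scaled_by[OF F G h x] by simp
  then show ?thesis using xj by blast
qed

text \<open>
  The entrywise product of two basis vectors, divided by the known invertible solution, is again
  a solution and vanishes at every tag, so the supports of the basis vectors are disjoint. They cover
  all columns because the invertible solution is a combination of them. So the sum of the basis has no zero.
\<close>

lemma gsolution_correct:
  assumes F: "R.columns k n F" and G: "R.columns k n G" and h: "gheight F = k"
    and indF: "independent_rows R (mat_of_columns k F)" and indG: "independent_rows R (mat_of_columns k G)"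
    and X0: "X0 \<in> GL R k" "R.scaled_by k n (mat_of_columns k F) (mat_of_columns k G) X0 d0"
    and nz: "\<And>j. j < n \<Longrightarrow> d0 j \<noteq> \<zero>\<^bsub>R\<^esub>"
  defines "w \<equiv> gsolution K F G"
  shows "length w = n + k * k" "scaling_of k n w \<in> GL R k"
    "\<And>j. j < n \<Longrightarrow> w ! j \<in> carrier R \<and> w ! j \<noteq> \<zero>\<^bsub>R\<^esub>"
    "R.scaled_by k n (mat_of_columns k F) (mat_of_columns k G) (scaling_of k n w) (\<lambda>j. w ! j)"
proof -
  let ?m = "n + k * k" and ?E = "gequations K F G" and ?F = "mat_of_columns k F" and ?G = "mat_of_columns k G"
  define V where "V = gkernel K ?E (gunits K ?m)"
  have w: "w = gsum K ?m V"
    using F h by (simp add: w_def gsolution_def V_def R.columns_def)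
  have Fm: "?F \<in> mats R k n" and Gm: "?G \<in> mats R k n" using R.columns_mats F G by auto
  have eqs: "\<forall>l\<in>set ?E. R.lvec ?m l" unfolding set_gequations[OF F G h] using lvec_equation[OF F G] by auto
  have kb: "R.kernel_basis ?m n ?E V" unfolding V_def by (rule gkernel_basis[OF eqs])
  note D = R.kernel_basisD[OF kb]
  have sol: "R.scaled_by k n ?F ?G (scaling_of k n x) (\<lambda>j. x ! j)" if "R.solves ?m ?E x" for x
    using solves_iff_scaled_by[OF F G h R.solves_lvec[OF that]] that by simp
  have vl: "R.lvec ?m v" if "(t, v) \<in> set V" for t v using D(2)[OF that] by (rule R.solves_lvec)
  have vl': "R.lvec ?m (snd tv)" and sol': "R.solves ?m ?E (snd tv)" if "tv \<in> set V" for tv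
    using vl[of "fst tv" "snd tv"] D(2)[of "fst tv" "snd tv"] that by simp_all
  have "distinct (map fst V)"
    using kb strict_sorted_iff unfolding R.kernel_basis_def by blast
  then have dV: "distinct V" and tag_inj: "\<And>t v v'. (t, v) \<in> set V \<Longrightarrow> (t, v') \<in> set V \<Longrightarrow> v = v'"
    by (auto simp: distinct_map intro: eq_key_imp_eq_value)
  \<comment> \<open>A vector with tag in the second block vanishes on the first block; then its
    matrix part is 0 too, although its entry at the tag is 1.\<close>
  have tags: "t < n" if tv: "(t, v) \<in> set V" for t v
  proof (rule ccontr)
    assume "\<not> t < n"
    then have tn: "n \<le> t" by simp
    have t: "t - n < k * k" using D(1)[OF tv] tn by simp
    then have k: "(t - n) mod k < k" "(t - n) div k < k" by (cases "k = 0"; simp add: less_mult_imp_div_less)+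
    have "scaling_of k n v $$ ((t - n) mod k, (t - n) div k) = \<zero>\<^bsub>R\<^esub>"
      by (rule R.scaled_by_zero[OF Gm indG Fm sol[OF D(2)[OF tv]] _ k]) (rule D(5)[OF tv tn])
    moreover have "scaling_of k n v $$ ((t - n) mod k, (t - n) div k) = v ! (n + (t - n) div k * k + (t - n) mod k)"
      using k by (simp add: scaling_of_def)
    moreover have "n + (t - n) div k * k + (t - n) mod k = t" using tn div_mult_mod_eq[of "t - n" k] by simp
    ultimately show False using D(3)[OF tv] by simp
  qed
  have d0: "d0 j \<in> carrier R" if "j < n" for j using X0(2) that by (simp add: R.scaled_by_def)
  have disj: "v ! j = \<zero>\<^bsub>R\<^esub> \<or> v' ! j = \<zero>\<^bsub>R\<^esub>"
    if tv: "(t, v) \<in> set V" "(t', v') \<in> set V" "t \<noteq> t'" and j: "j < n" for t v t' v' j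
  proof -
    note X = sol[OF D(2)[OF tv(1)]] and Y = sol[OF D(2)[OF tv(2)]]
    have vc: "v ! j \<in> carrier R" "v' ! j \<in> carrier R" if "j < n" for j using vl[OF tv(1)] vl[OF tv(2)] that by auto
    have "\<exists>Z. R.scaled_by k n ?F ?G Z (\<lambda>j. v ! j \<otimes>\<^bsub>R\<^esub> v' ! j \<otimes>\<^bsub>R\<^esub> inv\<^bsub>R\<^esub> (d0 j))"
      by (rule R.scaled_by_mult[OF Fm Gm X0 _ X Y]) (rule nz)
    then obtain Z where "R.scaled_by k n ?F ?G Z (\<lambda>j. v ! j \<otimes>\<^bsub>R\<^esub> v' ! j \<otimes>\<^bsub>R\<^esub> inv\<^bsub>R\<^esub> (d0 j))"
      by blast
    from solution_of_scaled_by[OF F G h this]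
    obtain x where x: "R.solves ?m ?E x" "\<And>j. j < n \<Longrightarrow> x ! j = v ! j \<otimes>\<^bsub>R\<^esub> v' ! j \<otimes>\<^bsub>R\<^esub> inv\<^bsub>R\<^esub> (d0 j)"
      by blast
    have "x ! j = \<zero>\<^bsub>R\<^esub>"
    proof (rule R.kernel_basis_unique[OF kb x(1)])
      fix s u assume su: "(s, u) \<in> set V"
      have "s < n" by (rule tags[OF su])
      note i = R.nz_inv[OF d0[OF this] nz[OF this]]
      \<comment> \<open>The tags t and t' differ, so s is not the tag of both vectors, and a basis
        vector vanishes at foreign tags.\<close>
      have "v ! s = \<zero>\<^bsub>R\<^esub> \<or> v' ! s = \<zero>\<^bsub>R\<^esub>"
        using D(4)[OF tv(1) su] D(4)[OF tv(2) su] tv(3) by (cases "s = t") auto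
      then show "x ! s = \<zero>\<^bsub>R\<^esub>" unfolding x(2)[OF \<open>s < n\<close>] using vc[OF \<open>s < n\<close>] i(1) by auto
    qed (use j in simp)
    then have p: "v ! j \<otimes>\<^bsub>R\<^esub> v' ! j \<otimes>\<^bsub>R\<^esub> inv\<^bsub>R\<^esub> (d0 j) = \<zero>\<^bsub>R\<^esub>" using x(2)[OF j] by simp
    note i = R.nz_inv[OF d0[OF j] nz[OF j]]
    have "v ! j \<otimes>\<^bsub>R\<^esub> v' ! j = \<zero>\<^bsub>R\<^esub>"
      using R.integral[OF p _ i(1)] vc[OF j] i(2) by simp
    then show ?thesis using R.integral vc[OF j] by blast
  qed
  \<comment> \<open>Otherwise all basis vectors vanish at j, and clearing the tags of the invertible
    solution with them leaves its entry d0 j intact; but a solution vanishing at all tags is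
    0.\<close>
  have cover: "\<exists>(t, v)\<in>set V. v ! j \<noteq> \<zero>\<^bsub>R\<^esub>" if j: "j < n" for j
  proof (rule ccontr)
    assume "\<not> (\<exists>(t, v)\<in>set V. v ! j \<noteq> \<zero>\<^bsub>R\<^esub>)"
    then have vj: "v ! j = \<zero>\<^bsub>R\<^esub>" if "(t, v) \<in> set V" for t v using that by auto
    obtain x where x: "R.solves ?m ?E x" "\<And>j. j < n \<Longrightarrow> x ! j = d0 j"
      using solution_of_scaled_by[OF F G h X0(2)] by blast
    have "\<exists>z. R.solves ?m ?E z \<and> z ! j = d0 j \<and> (\<forall>t v. (t, v) \<in> set W \<longrightarrow> z ! t = \<zero>\<^bsub>R\<^esub>)"
      if "set W \<subseteq> set V" for W
      using that
    proof (induction W)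
      case Nil
      then show ?case using x j by auto
    next
      case (Cons tv W)
      obtain t v where tv: "tv = (t, v)" by (cases tv)
      have tvV: "(t, v) \<in> set V" using Cons.prems tv by simp
      obtain z where z: "R.solves ?m ?E z" "z ! j = d0 j" "\<And>t v. (t, v) \<in> set W \<Longrightarrow> z ! t = \<zero>\<^bsub>R\<^esub>"
        using Cons by auto
      have zl: "R.lvec ?m z" by (rule R.solves_lvec[OF z(1)])
      have c: "z ! t \<in> carrier R" using zl D(1)[OF tvV] by simp
      let ?y = "R.sub_mult (z ! t) v z"
      have nth: "?y ! s = z ! s \<ominus>\<^bsub>R\<^esub> z ! t \<otimes>\<^bsub>R\<^esub> v ! s" if "s < ?m" for s by (rule R.sub_mult_nth[OF zl that])
      have "R.solves ?m ?E ?y" by (rule R.solves_sub_mult[OF eqs c D(2)[OF tvV] z(1)])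
      moreover have "?y ! j = d0 j" using nth[of j] j vj[OF tvV] c z(2) d0[OF j] by (simp add: R.minus_eq)
      moreover have "?y ! s = \<zero>\<^bsub>R\<^esub>" if su: "(s, u) \<in> set (tv # W)" for s u
      proof -
        have suV: "(s, u) \<in> set V" using su Cons.prems by auto
        note n = nth[OF D(1)[OF suV]]
        show ?thesis
        proof (cases "s = t")
          case True
          then show ?thesis using n D(3)[OF tvV] c by (simp add: R.minus_eq R.r_neg)
        next
          case False
          then have "z ! s = \<zero>\<^bsub>R\<^esub>" using z(3)[of s u] su tv by auto
          then show ?thesis using n D(4)[OF tvV suV False] c by (simp add: R.minus_eq)
        qed
      qed
      ultimately show ?case by blast
    qed
    from this[OF order_refl] obtain z where z: "R.solves ?m ?E z" "z ! j = d0 j"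
      "\<And>t v. (t, v) \<in> set V \<Longrightarrow> z ! t = \<zero>\<^bsub>R\<^esub>" by blast
    have "z ! j = \<zero>\<^bsub>R\<^esub>" by (rule R.kernel_basis_unique[OF kb z(1)], rule z(3), assumption, use j in simp)
    then show False using z(2) nz[OF j] by simp
  qed
  have solw: "R.solves ?m ?E w" unfolding w by (rule solves_gsum[OF dV _ eqs]) (rule sol')
  show "length w = ?m" using R.solves_lvec[OF solw] by (rule R.lvec_length)
  show wj: "w ! j \<in> carrier R \<and> w ! j \<noteq> \<zero>\<^bsub>R\<^esub>" if j: "j < n" for j
  proof -
    obtain t v where tv: "(t, v) \<in> set V" "v ! j \<noteq> \<zero>\<^bsub>R\<^esub>" using cover[OF j] by auto
    have jm: "j < ?m" using j by simp
    have "w ! j = (\<Oplus>\<^bsub>R\<^esub>tv\<in>set V. snd tv ! j)" unfolding w by (rule gsum(2)[OF dV _ jm]) (rule vl')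
    \<comment> \<open>By disjointness of supports only one summand is nonzero at j, so nothing can
      cancel.\<close>
    also have "\<dots> = snd (t, v) ! j"
    proof (rule R.finsum_single)
      show "snd (t, v) ! j \<in> carrier R" using vl[OF tv(1)] jm by simp
      fix u assume u: "u \<in> set V" "u \<noteq> (t, v)"
      have "fst u \<noteq> t" using tag_inj[of t "snd u" v] u tv(1) by (cases u) auto
      then show "snd u ! j = \<zero>\<^bsub>R\<^esub>" using disj[of t v "fst u" "snd u" j] tv u(1) j by simp
    qed (use tv(1) in simp_all)
    finally show ?thesis using tv vl[OF tv(1)] jm by simp
  qed
  show sw: "R.scaled_by k n ?F ?G (scaling_of k n w) (\<lambda>j. w ! j)" by (rule sol[OF solw])
  show "scaling_of k n w \<in> GL R k"
    by (rule R.scaled_by_GL[OF finite_carrier Fm indF Gm sw]) (use wj in simp)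
qed

lemma independent_rows_permute:
  assumes G: "R.columns k n G" and G': "R.columns k n G'" and \<tau>: "bij_betw \<tau> {..<n} {..<n}"
    and eq: "\<And>j. j < n \<Longrightarrow> G' ! j = G ! \<tau> j" and ind: "independent_rows R (mat_of_columns k G)"
  shows "independent_rows R (mat_of_columns k G')"
  unfolding independent_rows_def
proof (intro ballI impI)
  note Gm = R.columns_mats[OF G] and Gm' = R.columns_mats[OF G']
  fix x assume "x \<in> vecs R (dim_row (mat_of_columns k G'))"
    and z: "vec_mat_prod R x (mat_of_columns k G') = vec_zero R (dim_col (mat_of_columns k G'))"
  then have x: "x \<in> vecs R k" using R.matsD[OF Gm'] by simp
  have "vec_mat_prod R x (mat_of_columns k G) = vec_zero R n"
  proof (rule R.vecs_eqI[OF R.vec_mat_prod_vecs[OF x Gm] R.vec_zero_vecs])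
    fix t assume t: "t < n"
    then have "t \<in> \<tau> ` {..<n}" using bij_betw_imp_surj_on[OF \<tau>] by simp
    then obtain j where j: "j < n" "t = \<tau> j" by auto
    have "vec_mat_prod R x (mat_of_columns k G) $ t = vec_mat_prod R x (mat_of_columns k G') $ j"
      unfolding R.vec_mat_prod_index[OF x Gm t] R.vec_mat_prod_index[OF x Gm' j(1)]
    proof (intro R.finsum_cong' refl)
      show "(\<lambda>i. x $ i \<otimes>\<^bsub>R\<^esub> mat_of_columns k G' $$ (i, j)) \<in> {..<k} \<rightarrow> carrier R"
        using x R.mats_closed[OF Gm' _ j(1)] by (auto simp: vecs_def)
      fix i assume "i \<in> {..<k}"
      then show "x $ i \<otimes>\<^bsub>R\<^esub> mat_of_columns k G $$ (i, t) = x $ i \<otimes>\<^bsub>R\<^esub> mat_of_columns k G' $$ (i, j)"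
        using R.mat_of_columns_index[OF G _ t] R.mat_of_columns_index[OF G' _ j(1)] eq[OF j(1)] j(2) by simp
    qed
    then show "vec_mat_prod R x (mat_of_columns k G) $ t = vec_zero R n $ t"
      using z t j(1) R.matsD[OF Gm'] by (simp add: vec_zero_def)
  qed
  then show "x = vec_zero R (dim_row (mat_of_columns k G'))"
    using ind x R.matsD[OF Gm] R.matsD[OF Gm'] unfolding independent_rows_def by simp
qed

lemma gsolve_correct:
  assumes orc: "LCE_oracle Orc" and F: "generator_matrix R k n F" and G: "generator_matrix R k n G"
    and LCE: "LCE R k n G F"
  defines "Fc \<equiv> map list_of_vec (cols F)" and "Gc \<equiv> map list_of_vec (cols G)"
  shows "\<exists>S P D. code_equivalence R k n G F S P D \<and>
    enc_solution S P D = pair_enc mat_enc (pair_enc mat_enc mat_enc) (gsolve Orc K Fc Gc)"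
proof -
  note Fm = R.generator_matrix_independent_rows[OF finite_carrier F]
  note Gm = R.generator_matrix_independent_rows[OF finite_carrier G]
  have Fcol: "R.columns k n Fc" and Gcol: "R.columns k n Gc"
    unfolding Fc_def Gc_def using R.mats_columns Fm(1) Gm(1) by auto
  have FF: "mat_of_columns k Fc = F" and GG: "mat_of_columns k Gc = G"
    unfolding Fc_def Gc_def using Fm(1) Gm(1) by (auto intro!: mat_of_columns_cols simp: mats_def)
  have indF: "independent_rows R (mat_of_columns k Fc)" and indG: "independent_rows R (mat_of_columns k Gc)"
    using Fm Gm by (simp_all add: FF GG)
  \<comment> \<open>The program reads k off the first column and gets 0 if there is none;
    independence of the rows then forces k = 0.\<close>
  have h: "gheight Fc = k"
  proof (cases "n = 0")
    case True
    have "k = 0" using R.independent_rows_empty[of F k] Fm True by simp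
    then show ?thesis using Fcol True by (simp add: gheight_def R.columns_def)
  next
    case False
    then show ?thesis using R.columns_nth[OF Fcol, of 0] Fcol by (simp add: gheight_def R.columns_def nth_default_def)
  qed
  obtain S0 \<tau>0 where "R.matches k n Fc Gc S0 \<tau>0"
    using LCE R.LCE_iff_matches[OF Fcol Gcol] unfolding FF GG by blast
  from gmatch_correct[OF orc Fcol Gcol indF indG this]
  obtain S1 \<tau> where len: "length (gmatch Orc K Fc Gc) = n" and m: "R.matches k n Fc Gc S1 \<tau>"
    and \<tau>: "\<And>l. l < n \<Longrightarrow> \<tau> l = gmatch Orc K Fc Gc ! l" by blast
  have bij: "bij_betw \<tau> {..<n} {..<n}" and S1: "S1 \<in> GL R k" using m by (auto simp: R.matches_def)
  have S1': "S1 \<in> mats R k k" using S1 by (simp add: GL_def)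
  have \<tau>lt: "\<tau> j < n" if "j < n" for j using bij that by (auto simp: bij_betw_def)
  define js where "js = gmatch Orc K Fc Gc"
  define G' where "G' = gselect Gc js"
  have lenG: "length Gc = n" and lenF: "length Fc = n" using Gcol Fcol by (auto simp: R.columns_def)
  have G'j: "G' ! j = Gc ! \<tau> j" if "j < n" for j
    using that \<tau>[OF that] \<tau>lt[OF that] len lenG by (simp add: G'_def gselect_def js_def nth_default_def)
  have G'len: "length G' = n" using len by (simp add: G'_def gselect_def js_def)
  have G'col: "R.columns k n G'"
    unfolding R.columns_def
  proof (intro conjI G'len ballI)
    fix c assume "c \<in> set G'"
    then obtain j where j: "j < n" "c = G' ! j" using G'len by (auto simp: in_set_conv_nth)
    then show "length c = k" "set c \<subseteq> carrier R" using R.columns_nth[OF Gcol \<tau>lt[OF j(1)]] G'j[OF j(1)] by auto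
  qed
  have indG': "independent_rows R (mat_of_columns k G')"
    by (rule independent_rows_permute[OF Gcol G'col bij _ indG]) (rule G'j)
  have "\<forall>j. \<exists>c. j < n \<longrightarrow> c \<in> carrier R \<and> c \<noteq> \<zero>\<^bsub>R\<^esub> \<and> Fc ! j = map (\<lambda>x. c \<otimes>\<^bsub>R\<^esub> x) (R.apply_mat S1 (Gc ! \<tau> j))"
    using m unfolding R.matches_def R.parallel_def by blast
  then obtain c where c: "\<And>j. j < n \<Longrightarrow> c j \<in> carrier R" "\<And>j. j < n \<Longrightarrow> c j \<noteq> \<zero>\<^bsub>R\<^esub>"
    "\<And>j. j < n \<Longrightarrow> Fc ! j = map (\<lambda>x. c j \<otimes>\<^bsub>R\<^esub> x) (R.apply_mat S1 (Gc ! \<tau> j))" by metis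
  note ci = R.nz_inv[OF c(1,2)]
  have P1: "mat_prod R S (mat_of_columns k G') $$ (i, j) = R.apply_mat S (Gc ! \<tau> j) ! i"
    if "S \<in> mats R k k" "i < k" "j < n" for S i j
    using R.mat_prod_columns_index[OF that(1) G'col that(2,3)] G'j[OF that(3)] by simp
  \<comment> \<open>The invertible solution that \<open>gsolution_correct\<close> requires: column j
    of F is c_j times S1 applied to the selected column, so the scalars on the side of F are 1 /
    c_j.\<close>
  have sb: "R.scaled_by k n (mat_of_columns k Fc) (mat_of_columns k G') S1 (\<lambda>j. inv\<^bsub>R\<^esub> (c j))"
    unfolding R.scaled_by_def
  proof (intro conjI S1' allI impI)
    show "inv\<^bsub>R\<^esub> (c j) \<in> carrier R" if "j < n" for j using ci(1)[OF that that] .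
    fix i j assume ij: "i < k" "j < n"
    note cl = R.matches_closed[OF Gcol S1 \<tau>lt[OF ij(2)]]
    have a: "R.apply_mat S1 (Gc ! \<tau> j) ! i \<in> carrier R" using cl ij by (meson nth_mem subsetD)
    have "Fc ! j ! i = c j \<otimes>\<^bsub>R\<^esub> R.apply_mat S1 (Gc ! \<tau> j) ! i" using c(3)[OF ij(2)] cl ij by simp
    then have "Fc ! j ! i \<otimes>\<^bsub>R\<^esub> inv\<^bsub>R\<^esub> (c j) = (inv\<^bsub>R\<^esub> (c j) \<otimes>\<^bsub>R\<^esub> c j) \<otimes>\<^bsub>R\<^esub> R.apply_mat S1 (Gc ! \<tau> j) ! i"
      using a c(1)[OF ij(2)] ci(1)[OF ij(2) ij(2)] by (simp add: R.m_ac)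
    then show "mat_prod R S1 (mat_of_columns k G') $$ (i, j) = mat_of_columns k Fc $$ (i, j) \<otimes>\<^bsub>R\<^esub> inv\<^bsub>R\<^esub> (c j)"
      using P1[OF S1' ij] R.mat_of_columns_index[OF Fcol ij] a ci(3)[OF ij(2) ij(2)] by simp
  qed
  define w where "w = gsolution K Fc G'"
  have cinz: "inv\<^bsub>R\<^esub> (c j) \<noteq> \<zero>\<^bsub>R\<^esub>" if "j < n" for j using ci(2)[OF that that] .
  note gs = gsolution_correct[OF Fcol G'col h indF indG' S1 sb, folded w_def]
  have W: "length w = n + k * k" "scaling_of k n w \<in> GL R k"
    "\<And>j. j < n \<Longrightarrow> w ! j \<in> carrier R \<and> w ! j \<noteq> \<zero>\<^bsub>R\<^esub>"
    "R.scaled_by k n (mat_of_columns k Fc) (mat_of_columns k G') (scaling_of k n w) (\<lambda>j. w ! j)"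
    by (rule gs(1), erule cinz) (rule gs(2), erule cinz, rule gs(3), erule cinz, assumption, rule gs(4), erule cinz)
  let ?S = "scaling_of k n w" and ?c = "\<lambda>j. ginv K (w ! j)"
  have S': "?S \<in> mats R k k" using W(2) by (simp add: GL_def)
  have g: "?c j \<in> carrier R" "?c j \<otimes>\<^bsub>R\<^esub> w ! j = \<one>\<^bsub>R\<^esub>" if "j < n" for j
    using ginv_closed ginv W(3)[OF that] by auto
  have gnz: "?c j \<noteq> \<zero>\<^bsub>R\<^esub>" if "j < n" for j
    using g(2)[OF that] W(3)[OF that] by (metis R.l_null R.one_not_zero)
  \<comment> \<open>The computed solution satisfies S G P = F diag(w), so the diagonal matrix of the
    equivalence is the inverse of diag(w).\<close>
  have eqv: "code_equivalence R k n G F ?S (R.perm_mat n \<tau>) (R.scaling_mat n ?c)"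
  proof (rule R.code_equivalenceI[OF W(2) Fm(1) Gm(1) bij])
    show "?c j \<in> carrier R \<and> ?c j \<noteq> \<zero>\<^bsub>R\<^esub>" if "j < n" for j using g(1)[OF that] gnz[OF that] by simp
    fix i j assume ij: "i < k" "j < n"
    have "mat_prod R ?S G $$ (i, \<tau> j) = R.apply_mat ?S (Gc ! \<tau> j) ! i"
      using R.mat_prod_columns_index[OF S' Gcol ij(1) \<tau>lt[OF ij(2)]] by (simp add: GG)
    also have "\<dots> = F $$ (i, j) \<otimes>\<^bsub>R\<^esub> w ! j"
      using P1[OF S' ij] W(4) ij by (simp add: R.scaled_by_def FF)
    finally show "F $$ (i, j) = mat_prod R ?S G $$ (i, \<tau> j) \<otimes>\<^bsub>R\<^esub> ?c j"
      using g[OF ij(2)] W(3)[OF ij(2)] R.mats_closed[OF Fm(1) ij] by (simp add: R.m_assoc R.m_comm[of "w ! j"])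
  qed
  have lenw: "length w = n + k * k" by (rule W(1))
  have Senc: "enc_mat ?S = mat_enc (gscaling K Fc w)"
  proof -
    have "mat_of_columns k (gscaling K Fc w) = ?S"
    proof (rule eq_matI)
      fix i l assume "i < dim_row ?S" "l < dim_col ?S"
      then have il: "i < k" "l < k" by (auto simp: scaling_of_def)
      then show "mat_of_columns k (gscaling K Fc w) $$ (i, l) = ?S $$ (i, l)"
        using index_bound[OF il, of n] by (simp add: mat_of_columns_def gscaling_def scaling_of_def h lenF lenw nth_default_def)
    qed (simp_all add: mat_of_columns_def gscaling_def scaling_of_def h)
    moreover have "\<forall>c\<in>set (gscaling K Fc w). length c = k" by (simp add: gscaling_def h)
    ultimately show ?thesis using enc_mat_mat_of_columns by metis
  qed
  have Penc: "enc_mat (R.perm_mat n \<tau>) = mat_enc (gperm K Fc js)"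
  proof -
    have "mat_of_columns n (gperm K Fc js) = R.perm_mat n \<tau>"
      using len \<tau> by (intro eq_matI)
        (simp_all add: mat_of_columns_def gperm_def R.perm_mat_def lenF js_def nth_default_def gone gzero)
    moreover have "\<forall>c\<in>set (gperm K Fc js). length c = n" by (simp add: gperm_def lenF)
    ultimately show ?thesis using enc_mat_mat_of_columns by metis
  qed
  have Denc: "enc_mat (R.scaling_mat n ?c) = mat_enc (gdiag K Fc w)"
  proof -
    have "mat_of_columns n (gdiag K Fc w) = R.scaling_mat n ?c"
      by (intro eq_matI)
        (simp_all add: mat_of_columns_def gdiag_def R.scaling_mat_def lenF lenw nth_default_def gzero)
    moreover have "\<forall>c\<in>set (gdiag K Fc w). length c = n" by (simp add: gdiag_def lenF)
    ultimately show ?thesis using enc_mat_mat_of_columns by metis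
  qed
  have "enc_solution ?S (R.perm_mat n \<tau>) (R.scaling_mat n ?c) =
      pair_enc mat_enc (pair_enc mat_enc mat_enc) (gsolve Orc K Fc Gc)"
    unfolding enc_solution_def Senc Penc Denc gsolve_def pair_enc_def fst_conv snd_conv
    by (simp add: w_def G'_def js_def)
  then show ?thesis using eqv by blast
qed

end

theorem theorem17:
  shows "\<exists>(prog :: oracle_program) (b :: nat poly).
    \<forall>Orc. LCE_oracle Orc \<longrightarrow>
      (\<forall>(p :: nat) (f :: nat list) (k :: nat) (n :: nat) (F :: elem mat) (G :: elem mat).
        field (GF p f) \<longrightarrow>
        generator_matrix (GF p f) k n F \<longrightarrow>
        generator_matrix (GF p f) k n G \<longrightarrow>
        (\<exists>S0 \<in> GL (GF p f) k. \<exists>P0 \<in> perm_mats (GF p f) n. \<exists>D0 \<in> nz_diag_mats (GF p f) n.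
           mat_prod (GF p f) (mat_prod (GF p f) (mat_prod (GF p f) S0 G) P0) D0 = F) \<longrightarrow>
        (\<exists>S P D t.
           computes prog Orc (enc_instance p f F G) (enc_solution S P D) t \<and>
           t \<le> poly b (vsize (enc_instance p f F G)) \<and>
           S \<in> GL (GF p f) k \<and> P \<in> perm_mats (GF p f) n \<and> D \<in> nz_diag_mats (GF p f) n \<and>
           F = mat_prod (GF p f) (mat_prod (GF p f) (mat_prod (GF p f) S G) P) D))"
proof -
  obtain funs e g where g: "pb g" and run: "\<And>Orc c. ev Orc funs [inst_enc c] e
      (pair_enc mat_enc (pair_enc mat_enc mat_enc) (gsolve Orc (fst c) (fst (snd c)) (snd (snd c)))) (g (vsize (inst_enc c)))"
    using PT_gsolve by (rule PTE) blast
  obtain d where d: "\<And>s. g s \<le> (s + 2) ^ d" using g by (auto simp: pb_def)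
  show ?thesis
  \<comment> \<open>The polynomial is (x + 2)^d, the form of bound provided by \<open>pb\<close>.
    The program is fixed before the oracle, as in \<open>PT\<close>.\<close>
  proof (intro exI[of _ "(funs, e)"] exI[of _ "[:2, 1:] ^ d :: nat poly"] allI impI)
    fix Orc p f k n F G
    assume orc: "LCE_oracle Orc" and fld: "field (GF p f)"
      and F: "generator_matrix (GF p f) k n F" and G: "generator_matrix (GF p f) k n G"
      and ex: "\<exists>S0 \<in> GL (GF p f) k. \<exists>P0 \<in> perm_mats (GF p f) n. \<exists>D0 \<in> nz_diag_mats (GF p f) n.
           mat_prod (GF p f) (mat_prod (GF p f) (mat_prod (GF p f) S0 G) P0) D0 = F"
    interpret gf p f by (rule gf.intro) (rule fld)
    let ?c = "((p, f), map list_of_vec (cols F), map list_of_vec (cols G))"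
    \<comment> \<open>The list encodings of the program produce literally the encodings of the
      statement, so no conversion of inputs is needed.\<close>
    have c: "inst_enc ?c = enc_instance p f F G"
      by (simp add: pair_enc_def enc_instance_def enc_mat_def enc_nats_def)
    have "LCE (GF p f) k n G F" using ex unfolding LCE_def code_equivalence_def by metis
    from gsolve_correct[OF orc F G this] obtain S P D where
      eqv: "code_equivalence (GF p f) k n G F S P D" and
      enc: "enc_solution S P D = pair_enc mat_enc (pair_enc mat_enc mat_enc) (gsolve Orc (p, f) (map list_of_vec (cols F)) (map list_of_vec (cols G)))"
      by blast
    obtain t where t: "t \<le> g (vsize (enc_instance p f F G))" "eval Orc funs [enc_instance p f F G] e (enc_solution S P D) t"
      using run[of Orc ?c] unfolding c ev_def enc fst_conv snd_conv by blast
    have "t \<le> poly ([:2, 1:] ^ d) (vsize (enc_instance p f F G))"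
      using t(1) d[of "vsize (enc_instance p f F G)"] by (simp add: poly_power add.commute)
    then show "\<exists>S P D t. computes (funs, e) Orc (enc_instance p f F G) (enc_solution S P D) t \<and>
           t \<le> poly ([:2, 1:] ^ d) (vsize (enc_instance p f F G)) \<and>
           S \<in> GL (GF p f) k \<and> P \<in> perm_mats (GF p f) n \<and> D \<in> nz_diag_mats (GF p f) n \<and>
           F = mat_prod (GF p f) (mat_prod (GF p f) (mat_prod (GF p f) S G) P) D"
      using t(2) eqv unfolding computes_def code_equivalence_def fst_conv snd_conv by blast
  qed
qed


end
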